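(* Let $(u_0,\tau_0,f_0)\in H^1(\Omega)^3$ with $u_0(0)=u_0(1)=0$, $f_0\ge 0$ and $f_0\not\equiv 0$. Let $(u,\tau,f)$ be the unique global solution of $$\rho\,\partial_t u=\eta\,\partial_{yy}u+\partial_y\tau,\qquad \lambda\,\partial_t\tau=G\,\partial_y u-f\tau,\qquad \partial_t f=(-1+\xi|\tau|)f^2-\nu f^3,$$ with initial conditions $(u_0,\tau_0,f_0)$ and homogeneous boundary conditions $u(t,0)=u(t,1)=0$ for all $t\ge 0$. Then $(u,\tau,f)$ converges to the steady state $(0,0,0)$ in $H^1(\Omega)\times L^\infty(\Omega)\times L^\infty(\Omega)$ in the long time: $$\|u(t,\cdot)\|_{H^1}+\|\tau(t,\cdot)\|_{L^\infty}+\|f(t,\cdot)\|_{L^\infty}\longrightarrow 0\quad\text{as } t\to\infty.$$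
   Context: $\Omega=[0,1]$ with space variable $y$; $t\ge0$ is time; $\rho,\eta,\lambda,G,\xi,\nu$ are positive constants; $u,\tau,f$ are real-valued functions of $(t,y)$. For such initial data there is a unique global solution $(u,\tau,f)$ with, for every $T>0$, $(u,\tau,f)\in (C([0,T];H^1)\cap L^2([0,T];H^2))\times C([0,T];H^1)\times C([0,T];H^1)$ and $(\partial_t u,\partial_t\tau,\partial_t f)\in L^2([0,T];L^2)\times C([0,T];L^2)\times C([0,T];L^2)$; moreover $f\ge 0$. This is the solution meant in the statement. All function spaces in $y$ are over $\Omega$. *)

theory Defs
  imports "HOL-Analysis.Analysis" "HOL-Probability.Essential_Supremum"
begin

text \<open>
  Functions of \<open>y\<close> are modelled as \<open>real \<Rightarrow> real\<close>; only their values on \<open>\<Omega> = [0,1]\<close> matter.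
  Functions of \<open>(t,y)\<close> are curried, so \<open>u t\<close> is the spatial profile at time \<open>t\<close>.
\<close>

abbreviation Omega :: "real measure"
  where "Omega \<equiv> lebesgue_on {0..1}"

text \<open>
  \<open>\<phi> \<in> C\<^sup>1\<^sub>c((a,b))\<close> with derivative \<open>\<phi>'\<close>. In dimension one, testing with \<open>C\<^sup>1\<^sub>c\<close> or with
  \<open>C\<^sup>\<infinity>\<^sub>c\<close> functions yields the same weak derivatives.
\<close>

definition test_function :: "real \<Rightarrow> real \<Rightarrow> (real \<Rightarrow> real) \<Rightarrow> (real \<Rightarrow> real) \<Rightarrow> bool"
  where "test_function a b \<phi> \<phi>' \<longleftrightarrow>
    (\<forall>x. (\<phi> has_real_derivative \<phi>' x) (at x)) \<and> continuous_on UNIV \<phi>' \<and>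
    (\<exists>K. compact K \<and> K \<subseteq> {a<..<b} \<and> (\<forall>x. x \<notin> K \<longrightarrow> \<phi> x = 0))"


subsection \<open>Function spaces on \<open>\<Omega>\<close>\<close>

definition L2 :: "(real \<Rightarrow> real) set"
  where "L2 = {v. v \<in> borel_measurable Omega \<and> integrable Omega (\<lambda>y. (v y)\<^sup>2)}"

definition L2_inner :: "(real \<Rightarrow> real) \<Rightarrow> (real \<Rightarrow> real) \<Rightarrow> real"
  where "L2_inner v w = (LINT y|Omega. v y * w y)"

definition L2_norm :: "(real \<Rightarrow> real) \<Rightarrow> real"
  where "L2_norm v = sqrt (LINT y|Omega. (v y)\<^sup>2)"

definition Linf_norm :: "(real \<Rightarrow> real) \<Rightarrow> ereal"
  where "Linf_norm v = esssup Omega (\<lambda>y. ereal \<bar>v y\<bar>)"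

definition has_weak_deriv :: "(real \<Rightarrow> real) \<Rightarrow> (real \<Rightarrow> real) \<Rightarrow> bool"
  where "has_weak_deriv v g \<longleftrightarrow>
    (\<forall>\<phi> \<phi>'. test_function 0 1 \<phi> \<phi>' \<longrightarrow>
       (LINT y|Omega. v y * \<phi>' y) = - (LINT y|Omega. g y * \<phi> y))"

text \<open>A representative of the weak derivative, which is unique up to null sets of \<open>\<Omega>\<close>.\<close>

definition wderiv :: "(real \<Rightarrow> real) \<Rightarrow> real \<Rightarrow> real"
  where "wderiv v = (SOME g. g \<in> L2 \<and> has_weak_deriv v g)"

text \<open>
  Elements of \<open>H\<^sup>1(\<Omega>)\<close> are identified with their continuous representative on \<open>[0,1]\<close>; this gives
  meaning to boundary values and to pointwise statements.
\<close>

definition H1 :: "(real \<Rightarrow> real) set"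
  where "H1 = {v \<in> L2. continuous_on {0..1} v \<and> (\<exists>g\<in>L2. has_weak_deriv v g)}"

definition H2 :: "(real \<Rightarrow> real) set"
  where "H2 = {v \<in> H1. \<exists>h\<in>L2. has_weak_deriv (wderiv v) h}"

definition H1_norm :: "(real \<Rightarrow> real) \<Rightarrow> real"
  where "H1_norm v = sqrt ((L2_norm v)\<^sup>2 + (L2_norm (wderiv v))\<^sup>2)"

definition H2_norm :: "(real \<Rightarrow> real) \<Rightarrow> real"
  where "H2_norm v =
    sqrt ((L2_norm v)\<^sup>2 + (L2_norm (wderiv v))\<^sup>2 + (L2_norm (wderiv (wderiv v)))\<^sup>2)"


subsection \<open>Spaces of functions of time with values in a function space \<open>X\<close> with norm \<open>N\<close>\<close>

definition C_time ::
  "real \<Rightarrow> (real \<Rightarrow> real) set \<Rightarrow> ((real \<Rightarrow> real) \<Rightarrow> real) \<Rightarrow> (real \<Rightarrow> real \<Rightarrow> real) set"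
  where "C_time T X N = {F. (\<forall>t\<in>{0..T}. F t \<in> X) \<and>
    (\<forall>t\<in>{0..T}. ((\<lambda>s. N (\<lambda>y. F s y - F t y)) \<longlongrightarrow> 0) (at t within {0..T}))}"

text \<open>Bochner (strong) measurability: a.e. limit in \<open>X\<close> of simple functions with values in \<open>X\<close>.\<close>

definition strongly_measurable ::
  "real \<Rightarrow> (real \<Rightarrow> real) set \<Rightarrow> ((real \<Rightarrow> real) \<Rightarrow> real) \<Rightarrow> (real \<Rightarrow> real \<Rightarrow> real) \<Rightarrow> bool"
  where "strongly_measurable T X N F \<longleftrightarrow>
    (\<exists>S :: nat \<Rightarrow> real \<Rightarrow> real \<Rightarrow> real.
       (\<forall>n. simple_function (lebesgue_on {0..T}) (S n) \<and> (\<forall>t\<in>{0..T}. S n t \<in> X)) \<and>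
       (AE t in lebesgue_on {0..T}. (\<lambda>n. N (\<lambda>y. F t y - S n t y)) \<longlonglongrightarrow> 0))"

definition L2_time ::
  "real \<Rightarrow> (real \<Rightarrow> real) set \<Rightarrow> ((real \<Rightarrow> real) \<Rightarrow> real) \<Rightarrow> (real \<Rightarrow> real \<Rightarrow> real) set"
  where "L2_time T X N = {F. (AE t in lebesgue_on {0..T}. F t \<in> X) \<and>
    strongly_measurable T X N F \<and> integrable (lebesgue_on {0..T}) (\<lambda>t. (N (F t))\<^sup>2)}"

text \<open>
  \<open>F'\<close> is the weak derivative of \<open>F\<close> on \<open>(0,T)\<close> as \<open>L\<^sup>2(\<Omega>)\<close>-valued functions, i.e.
  \<open>\<integral> \<phi>'(t) F(t) dt = - \<integral> \<phi>(t) F'(t) dt\<close> in \<open>L\<^sup>2(\<Omega>)\<close> for all scalar test functions \<open>\<phi>\<close>. The two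
  Bochner integrals are equal iff their inner products with every \<open>\<psi> \<in> L\<^sup>2(\<Omega>)\<close> are.
\<close>

definition has_weak_time_deriv ::
  "real \<Rightarrow> (real \<Rightarrow> real \<Rightarrow> real) \<Rightarrow> (real \<Rightarrow> real \<Rightarrow> real) \<Rightarrow> bool"
  where "has_weak_time_deriv T F F' \<longleftrightarrow>
    (\<forall>\<phi> \<phi>'. test_function 0 T \<phi> \<phi>' \<longrightarrow> (\<forall>\<psi>\<in>L2.
       (LINT t|lebesgue_on {0..T}. \<phi>' t * L2_inner (F t) \<psi>) =
         - (LINT t|lebesgue_on {0..T}. \<phi> t * L2_inner (F' t) \<psi>)))"


subsection \<open>The system\<close>

text \<open>\<open>lam\<close> stands for the constant \<open>\<lambda>\<close>.\<close>

definition global_solution ::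
  "real \<Rightarrow> real \<Rightarrow> real \<Rightarrow> real \<Rightarrow> real \<Rightarrow> real \<Rightarrow>
   (real \<Rightarrow> real) \<Rightarrow> (real \<Rightarrow> real) \<Rightarrow> (real \<Rightarrow> real) \<Rightarrow>
   (real \<Rightarrow> real \<Rightarrow> real) \<Rightarrow> (real \<Rightarrow> real \<Rightarrow> real) \<Rightarrow> (real \<Rightarrow> real \<Rightarrow> real) \<Rightarrow> bool"
  where "global_solution \<rho> \<eta> lam G \<xi> \<nu> u\<^sub>0 \<tau>\<^sub>0 f\<^sub>0 u \<tau> f \<longleftrightarrow>
    (\<forall>y\<in>{0..1}. u 0 y = u\<^sub>0 y \<and> \<tau> 0 y = \<tau>\<^sub>0 y \<and> f 0 y = f\<^sub>0 y) \<and>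
    (\<forall>t\<ge>0. u t 0 = 0 \<and> u t 1 = 0) \<and>
    (\<exists>ut \<tau>t ft. \<forall>T>0.
       u \<in> C_time T H1 H1_norm \<inter> L2_time T H2 H2_norm \<and>
       \<tau> \<in> C_time T H1 H1_norm \<and>
       f \<in> C_time T H1 H1_norm \<and>
       has_weak_time_deriv T u ut \<and> ut \<in> L2_time T L2 L2_norm \<and>
       has_weak_time_deriv T \<tau> \<tau>t \<and> \<tau>t \<in> C_time T L2 L2_norm \<and>
       has_weak_time_deriv T f ft \<and> ft \<in> C_time T L2 L2_norm \<and>
       (AE t in lebesgue_on {0..T}. AE y in Omega.
          \<rho> * ut t y = \<eta> * wderiv (wderiv (u t)) y + wderiv (\<tau> t) y \<and>
          lam * \<tau>t t y = G * wderiv (u t) y - f t y * \<tau> t y \<and>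
          ft t y = (- 1 + \<xi> * \<bar>\<tau> t y\<bar>) * (f t y)\<^sup>2 - \<nu> * (f t y) ^ 3))"

end

theory Submission
  imports Defs
begin

text \<open>
Write \<open>\<lambda>\<close> for \<open>lam\<close>. Let \<open>w = \<eta> u\<^sub>y + \<tau>\<close> be the total stress, \<open>a = G / \<eta>\<close>, and let \<open>m(t)\<close> be the mean
of \<open>\<tau>(t)\<close> over the interval. The fluid comes to rest for the following reasons.

The energy \<open>(\<rho> G \<parallel>u\<parallel>\<^sup>2 + \<lambda> \<parallel>\<tau>\<parallel>\<^sup>2) / 2\<close> decreases at the rate \<open>\<eta> G \<parallel>u\<^sub>y\<parallel>\<^sup>2 + \<integral> f \<tau>\<^sup>2\<close>, where \<open>f \<ge> 0\<close>
because \<open>f\<close> solves a linear equation \<open>f' = b f\<close> at each point. This rate is therefore integrable in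
time (\<open>energy_deriv\<close>, \<open>f_nonneg\<close>).

The stress equation contains \<open>u\<^sub>y\<close>, which is only square-integrable in space. Since \<open>\<rho> u\<^sub>t = w\<^sub>y\<close>, the
oscillation of \<open>w\<close> is a time derivative: \<open>w - m = \<rho> \<partial>\<^sub>t P\<close>, with \<open>P\<close> the mean-free primitive of \<open>u\<close>.
Hence \<open>\<sigma> = \<lambda> \<tau> - a \<rho> P\<close> solves the ordinary differential equation \<open>\<sigma>' = a m - (a + f) \<tau>\<close> at every
single point (\<open>sigma_deriv\<close>). It is a relaxation equation with rate at least \<open>a / \<lambda>\<close>, so comparison
bounds \<open>\<tau>\<close>, and then \<open>f\<close>, uniformly (\<open>sigma_bounded\<close>, \<open>f_bounded\<close>).

The fluctuation \<open>Z = \<sigma> - \<lambda> m\<close> is damped linearly and forced by \<open>P\<close> and \<open>f \<tau>\<close>, both controlled by the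
dissipation rate. A Lyapunov argument gives \<open>Z \<rightarrow> 0\<close> and then \<open>u \<rightarrow> 0\<close> in \<open>L\<^sup>2\<close> (\<open>Z_tendsto_0\<close>,
\<open>u_tendsto_0\<close>). Consequently \<open>\<lambda> m\<^sup>2\<close> tends to twice the limit of the energy. If that limit were
positive, \<open>m\<close> would keep one sign, the relaxation equation would keep \<open>\<bar>\<tau>\<bar>\<close> above a positive
constant, and the energy would be dissipated at a rate at least a multiple of \<open>\<integral> f\<close>. But
\<open>f' \<ge> - C f\<^sup>2\<close> keeps \<open>f\<close> above a multiple of \<open>1 / (1 + t)\<close> where it is initially positive, and
\<open>1 / (1 + t)\<close> is not integrable. So the energy and \<open>m\<close> tend to zero (\<open>energy_tendsto_0\<close>). The
relaxation equation then sends \<open>\<tau>\<close> to zero uniformly; from then on \<open>f' \<le> - f\<^sup>2 / 2\<close>, so \<open>f\<close> decays at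
least like \<open>2 / t\<close>.

For the velocity gradient, the energy argument applied to the time increments of the equations shows
that \<open>(u(t + h) - u(t)) / h\<close> stays bounded in \<open>L\<^sup>2\<close>, uniformly in \<open>h = 1 / n\<close> and in \<open>t \<ge> 1\<close>
(\<open>u_difference_quotient_bounded\<close>). Therefore
\<open>\<eta> \<parallel>u\<^sub>y\<parallel>\<^sup>2 + \<integral> \<tau> u\<^sub>y = - \<rho> \<integral> u u\<^sub>t\<close> is of the order of \<open>\<parallel>u\<parallel>\<close>, which tends to zero, and so does \<open>u\<^sub>y\<close>.

Solutions are only weak, so these computations need a foundation. The du Bois-Reymond lemma in space
turns the momentum equation into an identity against primitives of mean-free functions, and in time
it shows that each tested quantity, such as \<open>\<integral> \<tau> \<psi>\<close> for fixed \<open>\<psi>\<close>, is classically differentiable.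
Squares of norms are then differentiable because their increments are tested quantities
(\<open>L2_energy_identity\<close>). The locale \<open>viscoelastic_flow\<close> records exactly these tested equations, and
\<open>global_solution_imp_flow\<close> derives them from the definition of a solution.
\<close>

section \<open>Primitives of integrable functions and the du Bois-Reymond lemma\<close>

text \<open>
Henstock's lemma bounds the sum of the \<open>\<bar>length K * h x - integral K h\<bar>\<close> over fine tagged divisions. All the integrals
vanish here, so what it bounds is a Riemann sum of \<open>\<bar>h\<bar>\<close>; hence \<open>\<bar>h\<bar>\<close> has integral zero.
\<close>

lemma integral_intervals_zero_imp_AE_zero:
  fixes h :: "real \<Rightarrow> real"
  assumes h: "integrable (lebesgue_on {a..b}) h"
    and zero: "\<And>s t. a \<le> s \<Longrightarrow> s \<le> t \<Longrightarrow> t \<le> b \<Longrightarrow> integral {s..t} h = 0"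
  shows "AE y in lebesgue_on {a..b}. h y = 0"
proof -
  have ho: "h integrable_on cbox a b"
    using h by (simp add: integrable_on_lebesgue_on)
  have "((\<lambda>x. \<bar>h x\<bar>) has_integral 0) (cbox a b)"
    unfolding has_integral real_scaleR_def
  proof (intro allI impI)
    fix e :: real assume e: "e > 0"
    obtain \<gamma> where \<gamma>: "gauge \<gamma>"
      "\<And>p. p tagged_partial_division_of cbox a b \<Longrightarrow> \<gamma> fine p \<Longrightarrow>
         (\<Sum>(x,k)\<in>p. norm (measure lborel k * h x - integral k h)) < e"
      using Henstock_lemma[OF ho e, unfolded real_scaleR_def] by blast
    have "norm ((\<Sum>(x,k)\<in>p. measure lborel k * \<bar>h x\<bar>) - 0) < e"
      if p: "p tagged_division_of cbox a b" "\<gamma> fine p" for p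
    proof -
      have "(\<Sum>(x,k)\<in>p. measure lborel k * \<bar>h x\<bar>) = (\<Sum>(x,k)\<in>p. norm (measure lborel k * h x - integral k h))"
      proof (rule sum.cong[OF refl], clarify)
        fix x k assume xk: "(x,k) \<in> p"
        then obtain s t where k: "k = cbox s t" using tagged_division_ofD(4)[OF p(1)] by blast
        have "x \<in> k" using xk tagged_division_ofD(2)[OF p(1)] by blast
        then have "s \<le> t" using k by auto
        moreover have "k \<subseteq> cbox a b" using xk tagged_division_ofD(3)[OF p(1)] by blast
        ultimately have "integral k h = 0" using k zero[of s t] by auto
        then show "measure lborel k * \<bar>h x\<bar> = norm (measure lborel k * h x - integral k h)"
          by (simp add: abs_mult)
      qed
      also have "\<dots> < e"
        by (rule \<gamma>(2)) (use p in \<open>auto simp: tagged_division_of_def\<close>)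
      moreover have "0 \<le> (\<Sum>(x,k)\<in>p. measure lborel k * \<bar>h x\<bar>)"
        by (intro sum_nonneg) auto
      ultimately show ?thesis by simp
    qed
    then show "\<exists>\<gamma>. gauge \<gamma> \<and> (\<forall>\<D>. \<D> tagged_division_of cbox a b \<and> \<gamma> fine \<D> \<longrightarrow>
       norm ((\<Sum>(x,k)\<in>\<D>. measure lborel k * \<bar>h x\<bar>) - 0) < e)"
      using \<gamma>(1) by blast
  qed
  then have "integral {a..b} (\<lambda>x. \<bar>h x\<bar>) = 0" by (simp add: integral_unique)
  moreover have "(LINT x|lebesgue_on {a..b}. \<bar>h x\<bar>) = integral {a..b} (\<lambda>x. \<bar>h x\<bar>)"
    using h by (intro lebesgue_integral_eq_integral) auto
  ultimately show ?thesis
    using integral_nonneg_eq_0_iff_AE[of "lebesgue_on {a..b}" "\<lambda>x. \<bar>h x\<bar>"] h by simp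
qed

text \<open>
Both terms on the left are integrals of \<open>f(x) g(y)\<close>, over the two triangles into which the diagonal
cuts the square \<open>[a,b]\<^sup>2\<close>. No differentiability is involved, only Fubini's theorem.
\<close>

lemma integration_by_parts_indefinite:
  fixes f g :: "real \<Rightarrow> real"
  assumes f: "integrable (lebesgue_on {a..b}) f" and g: "integrable (lebesgue_on {a..b}) g"
  shows "(LINT x|lebesgue_on {a..b}. f x * integral {a..x} g)
       + (LINT x|lebesgue_on {a..b}. integral {a..x} f * g x)
       = (LINT x|lebesgue_on {a..b}. f x) * (LINT x|lebesgue_on {a..b}. g x)"
proof -
  let ?M = "lebesgue_on {a..b}"
  interpret M: finite_measure ?M by (rule finite_measure_lebesgue_on) simp
  interpret P: pair_sigma_finite ?M ?M ..

  have [measurable]: "f \<in> borel_measurable ?M" "g \<in> borel_measurable ?M" using f g by auto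
  have idm: "(\<lambda>x. x) \<in> borel_measurable ?M"
    by (simp add: measurable_restrict_space1 measurable_completion)
  have [measurable]: "fst \<in> borel_measurable (?M \<Otimes>\<^sub>M ?M)" "snd \<in> borel_measurable (?M \<Otimes>\<^sub>M ?M)"
    using measurable_compose[OF measurable_fst idm, of ?M] measurable_compose[OF measurable_snd idm, of ?M]
    by simp_all
  let ?p = "\<lambda>x y. f x * g y"
  let ?l = "\<lambda>x y. if y \<le> x then f x * g y else 0"
  let ?u = "\<lambda>x y. if x < y then f x * g y else 0"
  have p: "integrable (?M \<Otimes>\<^sub>M ?M) (\<lambda>z. f (fst z) * g (snd z))"
    by (rule P.Fubini_integrable) (use f g in \<open>auto simp: abs_mult\<close>)
  have l: "integrable (?M \<Otimes>\<^sub>M ?M) (case_prod ?l)"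
    unfolding case_prod_unfold by (rule Bochner_Integration.integrable_bound[OF p]) auto
  have u: "integrable (?M \<Otimes>\<^sub>M ?M) (case_prod ?u)"
    unfolding case_prod_unfold by (rule Bochner_Integration.integrable_bound[OF p]) auto
  have lower: "(LINT y|?M. (if y \<le> x then h y else 0)) = integral {a..x} h"
    if "integrable ?M h" "x \<in> {a..b}" for h :: "real \<Rightarrow> real" and x
  proof -
    have [measurable]: "h \<in> borel_measurable ?M" using that by auto
    have "integrable ?M (\<lambda>y. if y \<le> x then h y else 0)"
      by (rule Bochner_Integration.integrable_bound[OF that(1)]) (use idm in auto)
    then have "(LINT y|?M. (if y \<le> x then h y else 0)) = integral {a..b} (\<lambda>y. if y \<in> {..x} then h y else 0)"
      by (subst lebesgue_integral_eq_integral) auto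
    also have "\<dots> = integral ({a..b} \<inter> {..x}) h" using integral_restrict_Int[of "{a..b}" "{..x}" h] by (simp add: Int_commute)
    also have "{a..b} \<inter> {..x} = {a..x}" using that by auto
    finally show ?thesis .
  qed
  have upper: "(LINT y|?M. (if y < x then h y else 0)) = integral {a..x} h"
    if "integrable ?M h" "x \<in> {a..b}" for h :: "real \<Rightarrow> real" and x
  proof -
    have "(LINT y|?M. (if y < x then h y else 0)) = (LINT y|?M. (if y \<le> x then h y else 0))"
    proof (rule integral_cong_AE)
      have [measurable]: "h \<in> borel_measurable ?M" using that by auto
      show "(\<lambda>y. if y < x then h y else 0) \<in> borel_measurable ?M"
        "(\<lambda>y. if y \<le> x then h y else 0) \<in> borel_measurable ?M" using idm by auto
      have "AE y in lebesgue. y \<noteq> x"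
        by (metis AE_completion AE_lborel_singleton)
      then have "AE y in ?M. y \<noteq> x" by (auto simp: AE_restrict_space_iff elim: eventually_mono)
      then show "AE y in ?M. (if y < x then h y else 0) = (if y \<le> x then h y else 0)"
        by (rule AE_mp) auto
    qed
    then show ?thesis using lower[OF that] by simp
  qed
  have L: "(LINT x|?M. LINT y|?M. (?l x y)) = (LINT x|?M. f x * integral {a..x} g)"
  proof (rule Bochner_Integration.integral_cong[OF refl])
    fix x assume "x \<in> space ?M"
    then have x: "x \<in> {a..b}" by simp
    have "(LINT y|?M. (?l x y)) = (LINT y|?M. f x * (if y \<le> x then g y else 0))"
      by (rule Bochner_Integration.integral_cong) auto
    then show "(LINT y|?M. (?l x y)) = f x * integral {a..x} g" using lower[OF g x] by simp
  qed
  have U: "(LINT y|?M. LINT x|?M. (?u x y)) = (LINT y|?M. integral {a..y} f * g y)"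
  proof (rule Bochner_Integration.integral_cong[OF refl])
    fix y assume "y \<in> space ?M"
    then have y: "y \<in> {a..b}" by simp
    have "(LINT x|?M. (?u x y)) = (LINT x|?M. (if x < y then f x else 0) * g y)"
      by (rule Bochner_Integration.integral_cong) auto
    then show "(LINT x|?M. (?u x y)) = integral {a..y} f * g y" using upper[OF f y] by simp
  qed
  have "(LINT x|?M. LINT y|?M. (?l x y)) + (LINT x|?M. LINT y|?M. (?u x y))
      = (LINT z|(?M \<Otimes>\<^sub>M ?M). case_prod ?l z) + (LINT z|(?M \<Otimes>\<^sub>M ?M). case_prod ?u z)"
    using P.integral_fst'[OF l] P.integral_fst'[OF u] by simp
  also have "\<dots> = (LINT z|(?M \<Otimes>\<^sub>M ?M). case_prod ?l z + case_prod ?u z)"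
    using l u by simp
  also have "\<dots> = (LINT z|(?M \<Otimes>\<^sub>M ?M). f (fst z) * g (snd z))"
    by (rule Bochner_Integration.integral_cong) auto
  also have "\<dots> = (LINT x|?M. LINT y|?M. f x * g y)"
    using P.integral_fst'[OF p] by simp
  also have "\<dots> = (LINT x|?M. f x) * (LINT x|?M. g x)" by simp
  finally show ?thesis using L U P.Fubini_integral[OF u] by simp
qed

text \<open>
A primitive of a mean-free \<open>\<psi>\<close> is constant on either side of the support of \<open>\<psi>\<close>, with the same
constant on both sides; subtracting it leaves a test function.
\<close>

lemma test_function_primitive:
  assumes ab: "a < c" "d < b" "c \<le> d" and cont: "continuous_on UNIV \<psi>"
    and supp: "\<And>x. x \<notin> {c..d} \<Longrightarrow> \<psi> x = 0" and mean: "integral {a..b} \<psi> = 0"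
  obtains \<phi> where "test_function a b \<phi> \<psi>"
proof -
  have "isCont \<psi> x" for x using cont by (simp add: continuous_on_eq_continuous_at)
  then have "\<exists>F. \<forall>x::real. -\<infinity> < ereal x \<longrightarrow> ereal x < \<infinity> \<longrightarrow> (F has_vector_derivative \<psi> x) (at x)"
    by (intro einterval_antiderivative) auto
  then obtain F where F: "\<And>x. (F has_vector_derivative \<psi> x) (at x)" by auto
  have FTC: "integral {x..y} \<psi> = F y - F x" if "x \<le> y" for x y
    by (intro integral_unique fundamental_theorem_of_calculus that has_vector_derivative_at_within[OF F])
  have zero: "integral {x..y} \<psi> = 0" if "y < c \<or> d < x" for x y
    proof -
    have "integral {x..y} \<psi> = integral {x..y} (\<lambda>_. 0)"
      by (rule Henstock_Kurzweil_Integration.integral_cong) (use that supp in auto)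
    then show ?thesis by simp
  qed
  have F_const: "F x = F a" if x: "x \<notin> {c..d}" for x
  proof (cases "x < c")
    case True
    then show ?thesis
      using FTC[of x a] FTC[of a x] zero[of a x] zero[of x a] ab by (cases "x \<le> a") auto
  next
    case False
    then have "x > d" using x by auto
    then have "F x = F b"
      using FTC[of x b] FTC[of b x] zero[of b x] zero[of x b] ab by (cases "x \<le> b") auto
    then show ?thesis using mean FTC[of a b] ab by simp
  qed
  have "F x - F a = 0" if "x \<notin> {c..d}" for x
    using F_const[OF that] by simp
  moreover have "{c..d} \<subseteq> {a<..<b}" using ab by auto
  ultimately have supp_F: "\<exists>K. compact K \<and> K \<subseteq> {a<..<b} \<and> (\<forall>x. x \<notin> K \<longrightarrow> F x - F a = 0)"
    by (intro exI[of _ "{c..d}"] conjI allI impI) (simp, assumption, blast)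
  have deriv_F: "((\<lambda>x. F x - F a) has_real_derivative \<psi> x) (at x)" for x
    using F[of x] by (auto simp: has_real_derivative_iff_has_vector_derivative[symmetric] intro!: derivative_eq_intros)
  have "test_function a b (\<lambda>x. F x - F a) \<psi>"
    unfolding test_function_def
    by (intro conjI allI deriv_F cont supp_F)
  then show ?thesis using that by blast
qed

lemma test_function_eq_integral:
  assumes tf: "test_function a b \<phi> \<phi>'" and x: "a \<le> x"
  shows "\<phi> x = integral {a..x} \<phi>'"
proof -
  have d: "(\<phi> has_vector_derivative \<phi>' y) (at y)" for y
    using tf by (simp add: test_function_def has_real_derivative_iff_has_vector_derivative)
  have "\<phi> a = 0" using tf by (force simp: test_function_def)
  moreover have "integral {a..x} \<phi>' = \<phi> x - \<phi> a"
    by (intro integral_unique fundamental_theorem_of_calculus x has_vector_derivative_at_within[OF d])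
  ultimately show ?thesis by simp
qed

lemma integrable_continuous_mult:
  fixes f g :: "real \<Rightarrow> real"
  assumes "continuous_on {a..b} f" "integrable (lebesgue_on {a..b}) g"
  shows "integrable (lebesgue_on {a..b}) (\<lambda>x. f x * g x)"
proof -
  have "f \<in> borel_measurable (lebesgue_on {a..b})"
    using assms(1) continuous_imp_measurable_on_sets_lebesgue by force
  moreover have "bounded (f ` {a..b})"
    using assms(1) compact_continuous_image compact_imp_bounded by blast
  moreover have "g absolutely_integrable_on {a..b}"
    using assms(2) by (simp add: absolutely_integrable_on_def set_integrable_def integrable_restrict_space)
  ultimately have "(\<lambda>x. f x * g x) absolutely_integrable_on {a..b}"
    by (intro absolutely_integrable_bounded_measurable_product_real) auto
  then show ?thesis by (rule absolutely_integrable_imp_integrable) simp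
qed

lemma continuous_indefinite_integral:
  fixes g :: "real \<Rightarrow> real"
  assumes "integrable (lebesgue_on {a..b}) g"
  shows "continuous_on {a..b} (\<lambda>x. integral {a..x} g)"
  using assms by (intro indefinite_integral_continuous_1 integrable_on_lebesgue_on) auto

text \<open>
The difference \<open>D\<close> of \<open>v\<close> and the primitive of \<open>g\<close> annihilates every mean-free continuous function of
compact support. Subtracting a multiple of a fixed bump makes any such function mean-free, so
\<open>D - c\<close> annihilates all of them for a suitable constant \<open>c\<close>. Trapezoids converging to the indicator
of an interval show that \<open>D - c\<close> has integral zero over every interval, so it vanishes almost
everywhere.
\<close>

theorem du_Bois_Reymond:
  fixes v g :: "real \<Rightarrow> real"
  assumes ab: "a < b"
    and v: "integrable (lebesgue_on {a..b}) v" and g: "integrable (lebesgue_on {a..b}) g"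
    and weak: "\<And>\<phi> \<phi>'. test_function a b \<phi> \<phi>' \<Longrightarrow>
       (LINT x|lebesgue_on {a..b}. v x * \<phi>' x) = - (LINT x|lebesgue_on {a..b}. g x * \<phi> x)"
  shows "\<exists>c. AE y in lebesgue_on {a..b}. v y = c + integral {a..y} g"
proof -
  let ?M = "lebesgue_on {a..b}"
  define D where "D = (\<lambda>y. v y - integral {a..y} g)"
  have D: "integrable ?M D"
    unfolding D_def using v continuous_indefinite_integral[OF g] continuous_imp_integrable_real
    by (intro Bochner_Integration.integrable_diff) auto
  have orth: "(LINT x|?M. D x * \<psi> x) = 0"
    if c: "a < c" "d < b" "c \<le> d" and cont: "continuous_on UNIV \<psi>"
      and supp: "\<And>x. x \<notin> {c..d} \<Longrightarrow> \<psi> x = 0" and mean: "integral {a..b} \<psi> = 0" for c d \<psi>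
  proof -
    obtain \<phi> where \<phi>: "test_function a b \<phi> \<psi>"
      using test_function_primitive[OF c cont supp mean] by blast
    have cont': "continuous_on {a..b} \<psi>" using cont continuous_on_subset by blast
    have \<psi>: "integrable ?M \<psi>" using cont' by (rule continuous_imp_integrable_real)
    have "(LINT x|?M. v x * \<psi> x) = - (LINT x|?M. g x * integral {a..x} \<psi>)"
      unfolding weak[OF \<phi>]
      by (intro arg_cong[where f=uminus] Bochner_Integration.integral_cong)
         (auto simp: test_function_eq_integral[OF \<phi>])
    moreover have "(LINT x|?M. g x * integral {a..x} \<psi>) + (LINT x|?M. integral {a..x} g * \<psi> x) = 0"
      using integration_by_parts_indefinite[OF g \<psi>] mean lebesgue_integral_eq_integral[OF \<psi>] by simp
    moreover have "integrable ?M (\<lambda>x. v x * \<psi> x)" "integrable ?M (\<lambda>x. integral {a..x} g * \<psi> x)"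
      using integrable_continuous_mult[OF cont' v] integrable_continuous_mult[OF continuous_indefinite_integral[OF g] \<psi>]
      by (simp_all add: mult.commute)
    ultimately show ?thesis
      by (simp add: D_def left_diff_distrib)
  qed
  \<comment> \<open>A fixed bump, supported in the middle third, which corrects the mean.\<close>
  define s0 t0 where "s0 = (2*a+b)/3" and "t0 = (a+2*b)/3"
  have st0: "a < s0" "s0 < t0" "t0 < b" using ab by (auto simp: s0_def t0_def)
  define \<chi>0 where "\<chi>0 = (\<lambda>x. max 0 (min (x - s0) (t0 - x)))"
  define I0 where "I0 = integral {a..b} \<chi>0"
  have cont\<chi>0: "continuous_on A \<chi>0" for A by (auto simp: \<chi>0_def intro!: continuous_intros)
  have "I0 \<noteq> 0"
  proof
    assume "I0 = 0"
    then have "\<forall>x\<in>{a..b}. \<chi>0 x = 0"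
      using integral_eq_0_iff[of a b \<chi>0] cont\<chi>0 ab by (auto simp: I0_def \<chi>0_def)
    moreover have "\<chi>0 ((s0+t0)/2) \<noteq> 0" "(s0+t0)/2 \<in> {a..b}" using st0 by (auto simp: \<chi>0_def field_simps)
    ultimately show False by blast
  qed
  define c where "c = (LINT x|?M. D x * \<chi>0 x) / I0"
  have interval: "integral {s..t} (\<lambda>x. D x - c) = 0" if st: "a \<le> s" "s \<le> t" "t \<le> b" for s t
  proof -
    \<comment> \<open>Trapezoids; the shift by 1 keeps their support away from the ends of the interval.\<close>
    define T where "T = (\<lambda>n x. max 0 (min 1 (real (Suc n) * min (x - s) (t - x) - 1)))"
    have contT: "continuous_on A (T n)" for A n by (auto simp: T_def intro!: continuous_intros)
    have DT: "(LINT x|?M. (D x - c) * T n x) = 0" for n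
    proof -
      define \<psi> where "\<psi> = (\<lambda>x. T n x - integral {a..b} (T n) / I0 * \<chi>0 x)"
      have cT: "continuous_on {a..b} (T n)" "continuous_on {a..b} \<chi>0" by (rule contT, rule cont\<chi>0)
      have intT: "integrable ?M (T n)" by (rule continuous_imp_integrable_real[OF cT(1)])
      have "(LINT x|?M. D x * \<psi> x) = 0"
      proof (rule orth)
        let ?c = "min (s + 1 / real (Suc n)) s0" and ?d = "max (t - 1 / real (Suc n)) t0"
        have pos: "1 / real (Suc n) > 0" by simp
        show "a < ?c" "?d < b" "?c \<le> ?d"
        proof -
          have "a < s + 1 / real (Suc n)" "t - 1 / real (Suc n) < b" using pos st by linarith+
          then show "a < ?c" "?d < b" "?c \<le> ?d" using st0 by (auto simp: min_def max_def)
        qed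
        show "continuous_on UNIV \<psi>" unfolding \<psi>_def by (intro continuous_intros contT cont\<chi>0)
        show "\<psi> x = 0" if "x \<notin> {?c..?d}" for x
        proof -
          have "x - s < 1 / real (Suc n) \<or> t - x < 1 / real (Suc n)" and x0: "x < s0 \<or> x > t0"
            using that by auto
          then have "min (x - s) (t - x) < 1 / real (Suc n)" by auto
          then have "real (Suc n) * min (x - s) (t - x) < 1" by (simp add: field_simps)
          then have "T n x = 0" unfolding T_def by auto
          then show ?thesis using x0 by (auto simp: \<psi>_def \<chi>0_def)
        qed
        show "integral {a..b} \<psi> = 0"
        proof -
          have "integral {a..b} \<psi> = integral {a..b} (T n) - integral {a..b} (\<lambda>x. integral {a..b} (T n) / I0 * \<chi>0 x)"
            unfolding \<psi>_def
            by (intro Henstock_Kurzweil_Integration.integral_diff integrable_continuous_real continuous_intros cT)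
          then show ?thesis using \<open>I0 \<noteq> 0\<close> by (simp add: I0_def)
        qed
      qed
      moreover have "integrable ?M (\<lambda>x. D x * T n x)" "integrable ?M (\<lambda>x. D x * \<chi>0 x)"
        using integrable_continuous_mult[OF cT(1) D] integrable_continuous_mult[OF cT(2) D]
        by (simp_all add: mult.commute)
      moreover have "D x * \<psi> x = D x * T n x - integral {a..b} (T n) / I0 * (D x * \<chi>0 x)" for x
        by (simp add: \<psi>_def algebra_simps)
      ultimately have "(LINT x|?M. D x * T n x) = c * integral {a..b} (T n)"
        by (simp add: c_def)
      moreover have "integral {a..b} (T n) = (LINT x|?M. T n x)"
        using lebesgue_integral_eq_integral[OF intT] by simp
      ultimately show ?thesis
        using intT \<open>integrable ?M (\<lambda>x. D x * T n x)\<close> by (simp add: left_diff_distrib)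
    qed
    have Dc: "integrable ?M (\<lambda>x. D x - c)" using D by (intro Bochner_Integration.integrable_diff) auto
    have "(\<lambda>n. LINT x|?M. (D x - c) * T n x) \<longlonglongrightarrow> (LINT x|?M. (D x - c) * indicator {s<..<t} x)"
    proof (rule integral_dominated_convergence[where w="\<lambda>x. \<bar>D x - c\<bar>"])
      have [measurable]: "D \<in> borel_measurable ?M" using D by auto
      show "(\<lambda>x. (D x - c) * indicator {s<..<t} x) \<in> borel_measurable ?M"
        by (intro borel_measurable_times borel_measurable_indicator' borel_measurable_diff)
           (auto intro!: borel_measurable_indicator simp: sets_restrict_space_iff)
      show "(\<lambda>x. (D x - c) * T n x) \<in> borel_measurable ?M" for n
        using integrable_continuous_mult[OF contT Dc] by (auto simp: mult.commute dest: borel_measurable_integrable)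
      show "integrable ?M (\<lambda>x. \<bar>D x - c\<bar>)" using Dc by simp
      show "AE x in ?M. (\<lambda>n. (D x - c) * T n x) \<longlonglongrightarrow> (D x - c) * indicator {s<..<t} x"
      proof (intro AE_I2 tendsto_intros tendsto_eventually)
        fix x
        show "\<forall>\<^sub>F n in sequentially. T n x = indicator {s<..<t} x"
        proof (cases "x \<in> {s<..<t}")
          case True
          then have m: "min (x - s) (t - x) > 0" by auto
          obtain N where N: "real N * min (x - s) (t - x) > 2" using reals_Archimedean3[OF m] by blast
          have "T n x = indicator {s<..<t} x" if "n \<ge> N" for n
          proof -
            have "real (Suc n) * min (x - s) (t - x) \<ge> real N * min (x - s) (t - x)"
              using m that by (intro mult_right_mono) auto
            then have "real (Suc n) * min (x - s) (t - x) - 1 \<ge> 1" using N by linarith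
            then show ?thesis using True by (simp add: T_def)
          qed
          then show ?thesis using eventually_sequentially by blast
        next
          case False
          have "T n x = 0" for n
          proof -
            have "min (x - s) (t - x) \<le> 0" using False by auto
            then have "real (Suc n) * min (x - s) (t - x) \<le> 0" by (simp add: mult_le_0_iff)
            then show ?thesis by (auto simp: T_def)
          qed
          then show ?thesis using False by simp
        qed
      qed
      show "AE x in ?M. norm ((D x - c) * T n x) \<le> \<bar>D x - c\<bar>" for n
        by (intro AE_I2) (auto simp: T_def abs_mult intro!: mult_left_le)
    qed
    then have "(LINT x|?M. (D x - c) * indicator {s<..<t} x) = 0"
      using DT LIMSEQ_unique[OF _ tendsto_const[of 0]] by simp
    moreover have "(LINT x|?M. (D x - c) * indicator {s<..<t} x) = integral {a..b} (\<lambda>x. if x \<in> {s<..<t} then D x - c else 0)"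
    proof -
      have "(\<lambda>x. (D x - c) * indicator {s<..<t} x) = (\<lambda>x. if x \<in> {s<..<t} then D x - c else 0)"
        by (auto simp: indicator_def)
      moreover have "integrable ?M (\<lambda>x. (D x - c) * indicator {s<..<t} x)"
        using Dc by (intro integrable_real_mult_indicator) (use st in \<open>auto simp: sets_restrict_space_iff\<close>)
      ultimately show ?thesis
        using lebesgue_integral_eq_integral[of "{a..b}" "\<lambda>x. (D x - c) * indicator {s<..<t} x"] by simp
    qed
    moreover have "integral {a..b} (\<lambda>x. if x \<in> {s<..<t} then D x - c else 0) = integral {s<..<t} (\<lambda>x. D x - c)"
    proof -
      have "{s<..<t} \<inter> {a..b} = {s<..<t}" using st by auto
      then show ?thesis by (simp only: integral_restrict_Int)
    qed
    moreover have "integral {s<..<t} (\<lambda>x. D x - c) = integral {s..t} (\<lambda>x. D x - c)"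
      using integral_open_interval[of s t "\<lambda>x. D x - c"] by (simp add: box_real)
    ultimately show ?thesis by simp
  qed
  have "AE y in ?M. D y - c = 0"
    by (rule integral_intervals_zero_imp_AE_zero[OF _ interval]) (use D in auto)
  then show ?thesis by (intro exI[of _ c]) (auto simp: D_def elim!: eventually_mono)
qed

section \<open>The Hilbert space of square-integrable profiles\<close>

lemma integrable_Omega_const [simp]: "integrable Omega (\<lambda>y. c::real)"
  using finite_measure.integrable_const[OF finite_measure_lebesgue_on] by auto

lemma measure_Omega [simp]: "measure Omega {0..1} = 1"
  by (simp add: measure_restrict_space)

lemma L2_measurable: "v \<in> L2 \<Longrightarrow> v \<in> borel_measurable Omega"
  by (simp add: L2_def)

lemma L2_mult_integrable:
  assumes "v \<in> L2" "w \<in> L2"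
  shows "integrable Omega (\<lambda>y. v y * w y)"
proof (rule Bochner_Integration.integrable_bound)
  show "integrable Omega (\<lambda>y. (v y)\<^sup>2 + (w y)\<^sup>2)" using assms by (auto simp: L2_def)
  show "(\<lambda>y. v y * w y) \<in> borel_measurable Omega" using assms by (auto simp: L2_def)
  have "\<bar>v y * w y\<bar> \<le> (v y)\<^sup>2 + (w y)\<^sup>2" for y
    using sum_squares_bound[of "v y" "w y"] sum_squares_bound[of "- v y" "w y"]
      zero_le_power2[of "v y"] zero_le_power2[of "w y"] by (auto simp: abs_if)
  then show "AE y in Omega. norm (v y * w y) \<le> norm ((v y)\<^sup>2 + (w y)\<^sup>2)" by auto
qed

lemma continuous_L2: "continuous_on {0..1} v \<Longrightarrow> v \<in> L2"
  unfolding L2_def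
  by (auto intro!: continuous_imp_integrable_real continuous_intros borel_measurable_integrable)

lemma L2_const [simp]: "(\<lambda>y. c) \<in> L2"
  by (rule continuous_L2) auto

lemma L2_integrable: "v \<in> L2 \<Longrightarrow> integrable Omega v"
  using L2_mult_integrable[OF _ L2_const[of 1]] by simp

lemma L2_integrable_on: "v \<in> L2 \<Longrightarrow> v integrable_on {0..1}"
  by (intro integrable_on_lebesgue_on L2_integrable) auto

lemma L2_add [intro]: "v \<in> L2 \<Longrightarrow> w \<in> L2 \<Longrightarrow> (\<lambda>y. v y + w y) \<in> L2"
  using L2_mult_integrable[of v w] by (auto simp: L2_def power2_sum mult.assoc)

lemma L2_cmult [intro]: "v \<in> L2 \<Longrightarrow> (\<lambda>y. c * v y) \<in> L2"
  by (auto simp: L2_def power_mult_distrib)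

lemma L2_diff [intro]: "v \<in> L2 \<Longrightarrow> w \<in> L2 \<Longrightarrow> (\<lambda>y. v y - w y) \<in> L2"
  using L2_add[of v "\<lambda>y. - 1 * w y"] L2_cmult[of w "-1"] by simp

lemma L2_uminus [intro]: "v \<in> L2 \<Longrightarrow> (\<lambda>y. - v y) \<in> L2"
  using L2_cmult[of v "-1"] by simp

lemma L2_inner_commute: "L2_inner v w = L2_inner w v"
  by (simp add: L2_inner_def mult.commute)

lemma L2_inner_add_left: "v \<in> L2 \<Longrightarrow> w \<in> L2 \<Longrightarrow> z \<in> L2 \<Longrightarrow>
    L2_inner (\<lambda>y. v y + w y) z = L2_inner v z + L2_inner w z"
  by (simp add: L2_inner_def distrib_right L2_mult_integrable)

lemma L2_inner_diff_left: "v \<in> L2 \<Longrightarrow> w \<in> L2 \<Longrightarrow> z \<in> L2 \<Longrightarrow>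
    L2_inner (\<lambda>y. v y - w y) z = L2_inner v z - L2_inner w z"
  by (simp add: L2_inner_def left_diff_distrib L2_mult_integrable)

lemma L2_inner_cmult_left: "L2_inner (\<lambda>y. c * v y) z = c * L2_inner v z"
  by (simp add: L2_inner_def mult.assoc)

lemma L2_inner_add_right: "v \<in> L2 \<Longrightarrow> w \<in> L2 \<Longrightarrow> z \<in> L2 \<Longrightarrow>
    L2_inner z (\<lambda>y. v y + w y) = L2_inner z v + L2_inner z w"
  by (simp add: L2_inner_def distrib_left L2_mult_integrable)

lemma L2_inner_diff_right: "v \<in> L2 \<Longrightarrow> w \<in> L2 \<Longrightarrow> z \<in> L2 \<Longrightarrow>
    L2_inner z (\<lambda>y. v y - w y) = L2_inner z v - L2_inner z w"
  by (simp add: L2_inner_def right_diff_distrib L2_mult_integrable)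

lemma L2_inner_cmult_right: "L2_inner z (\<lambda>y. c * v y) = c * L2_inner z v"
  by (simp add: L2_inner_def mult.left_commute)

lemma L2_inner_cong_AE:
  assumes "AE y in Omega. v y = v' y" "AE y in Omega. w y = w' y"
    "v \<in> L2" "v' \<in> L2" "w \<in> L2" "w' \<in> L2"
  shows "L2_inner v w = L2_inner v' w'"
  unfolding L2_inner_def
  by (rule integral_cong_AE) (use assms in \<open>auto simp: L2_def elim: eventually_elim2\<close>)

lemma L2_inner_cong:
  assumes "\<And>y. y \<in> {0..1} \<Longrightarrow> v y = v' y" "\<And>y. y \<in> {0..1} \<Longrightarrow> w y = w' y"
  shows "L2_inner v w = L2_inner v' w'"
  unfolding L2_inner_def by (rule Bochner_Integration.integral_cong) (use assms in auto)

lemma L2_inner_self_nonneg [simp]: "0 \<le> L2_inner v v"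
  unfolding L2_inner_def by (rule integral_nonneg_AE) auto

lemma L2_norm_nonneg [simp]: "0 \<le> L2_norm v"
  unfolding L2_norm_def by (simp add: integral_nonneg_AE)

lemma L2_norm_eq: "L2_norm v = sqrt (L2_inner v v)"
  by (simp add: L2_norm_def L2_inner_def power2_eq_square)

lemma L2_norm_square: "(L2_norm v)\<^sup>2 = L2_inner v v"
  by (simp add: L2_norm_eq)

lemma L2_inner_self_add:
  assumes "v \<in> L2" "w \<in> L2"
  shows "L2_inner (\<lambda>y. v y + w y) (\<lambda>y. v y + w y) = L2_inner v v + 2 * L2_inner v w + L2_inner w w"
  using assms by (simp add: L2_inner_add_left L2_inner_add_right L2_add L2_inner_commute[of w v])

lemma L2_inner_self_diff:
  assumes "v \<in> L2" "w \<in> L2"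
  shows "L2_inner (\<lambda>y. v y - w y) (\<lambda>y. v y - w y) = L2_inner v v - 2 * L2_inner v w + L2_inner w w"
  using assms by (simp add: L2_inner_diff_left L2_inner_diff_right L2_diff L2_inner_commute[of w v])

text \<open>
Expand \<open>0 \<le> \<parallel>c v - w\<parallel>\<^sup>2\<close> and divide by \<open>c\<close>. In this form the inequality serves to absorb mixed terms
in all the energy estimates.
\<close>

lemma L2_Young:
  assumes "v \<in> L2" "w \<in> L2" "c > 0"
  shows "2 * L2_inner v w \<le> c * L2_inner v v + L2_inner w w / c"
proof -
  have "0 \<le> L2_inner (\<lambda>y. c * v y - w y) (\<lambda>y. c * v y - w y)" by simp
  also have "\<dots> = c * (c * L2_inner v v) - 2 * (c * L2_inner v w) + L2_inner w w"
    using assms by (simp add: L2_inner_self_diff L2_cmult L2_inner_cmult_left L2_inner_cmult_right)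
  finally have "c * (2 * L2_inner v w) \<le> c * (c * L2_inner v v + L2_inner w w / c)"
    using assms(3) by (simp add: distrib_left)
  then show ?thesis using assms(3) mult_le_cancel_left_pos by blast
qed

lemma L2_Young_abs:
  assumes "v \<in> L2" "w \<in> L2" "c > 0"
  shows "\<bar>2 * L2_inner v w\<bar> \<le> c * L2_inner v v + L2_inner w w / c"
proof -
  have "2 * L2_inner (\<lambda>y. -1 * v y) w \<le> c * L2_inner (\<lambda>y. -1 * v y) (\<lambda>y. -1 * v y) + L2_inner w w / c"
    by (rule L2_Young[OF L2_cmult[OF assms(1)] assms(2,3)])
  then have "- (2 * L2_inner v w) \<le> c * L2_inner v v + L2_inner w w / c"
    unfolding L2_inner_cmult_left L2_inner_cmult_right by simp
  then show ?thesis using L2_Young[OF assms] by (simp only: abs_le_iff)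
qed

lemma L2_Cauchy_Schwarz:
  assumes "v \<in> L2" "w \<in> L2"
  shows "\<bar>L2_inner v w\<bar> \<le> L2_norm v * L2_norm w"
proof -
  have *: "L2_inner v w \<le> L2_norm v * L2_norm w" if v: "v \<in> L2" and w: "w \<in> L2" for v w
  proof (cases "L2_norm v = 0")
    case True
    have "L2_inner v w \<le> 0"
    proof (rule ccontr)
      assume "\<not> L2_inner v w \<le> 0"
      then have p: "L2_inner v w > 0" by simp
      have "2 * L2_inner v w \<le> L2_inner w w / c" if "c > 0" for c
        using L2_Young[OF v w that] True by (simp add: L2_norm_square[symmetric])
      from this[of "(L2_inner w w + 1) / L2_inner v w"] p show False
        by (simp add: field_simps add_nonneg_pos)
           (smt (verit) L2_inner_self_nonneg mult_nonneg_nonneg)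
    qed
    then show ?thesis using True by simp
  next
    case False
    then have a: "L2_norm v > 0" using L2_norm_nonneg[of v] by linarith
    show ?thesis
    proof (cases "L2_norm w = 0")
      case True
      have "L2_inner v w \<le> e" if e: "e > 0" for e
      proof -
        have "2 * L2_inner v w \<le> (e / (L2_norm v)\<^sup>2) * L2_inner v v + L2_inner w w / (e / (L2_norm v)\<^sup>2)"
          using a e by (intro L2_Young v w) auto
        then show ?thesis using a e True by (simp add: L2_norm_square[symmetric])
      qed
      then show ?thesis using True by (metis field_le_epsilon add_0 mult_zero_right)
    next
      case False
      then have b: "L2_norm w > 0" using L2_norm_nonneg[of w] by linarith
      have "2 * L2_inner v w \<le> (L2_norm w / L2_norm v) * L2_inner v v + L2_inner w w / (L2_norm w / L2_norm v)"
        using a b by (intro L2_Young v w) auto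
      then show ?thesis using a b by (simp add: L2_norm_square[symmetric] power2_eq_square)
    qed
  qed
  from *[OF assms] *[OF L2_uminus[OF assms(1)] assms(2)] show ?thesis
    using L2_inner_cmult_left[of "-1" v w] by (simp add: abs_le_iff L2_norm_def)
qed

lemma L2_triangle:
  assumes "v \<in> L2" "w \<in> L2"
  shows "L2_norm (\<lambda>y. v y + w y) \<le> L2_norm v + L2_norm w"
proof (rule power2_le_imp_le)
  show "(L2_norm (\<lambda>y. v y + w y))\<^sup>2 \<le> (L2_norm v + L2_norm w)\<^sup>2"
    using L2_Cauchy_Schwarz[OF assms] L2_inner_self_add[OF assms]
    by (simp add: L2_norm_square power2_sum)
qed simp

lemma L2_norm_cmult: "L2_norm (\<lambda>y. c * v y) = \<bar>c\<bar> * L2_norm v"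
  by (simp add: L2_norm_eq L2_inner_cmult_left L2_inner_cmult_right real_sqrt_mult flip: mult.assoc)

lemma L2_norm_le_sup:
  assumes v: "v \<in> L2" and b: "\<And>y. y \<in> {0..1} \<Longrightarrow> \<bar>v y\<bar> \<le> B"
  shows "L2_norm v \<le> B"
proof -
  have B: "0 \<le> B" using b[of 0] by auto
  have "(LINT y|Omega. (v y)\<^sup>2) \<le> (LINT y|Omega. B\<^sup>2)"
  proof (rule integral_mono_AE)
    show "AE y in Omega. (v y)\<^sup>2 \<le> B\<^sup>2"
      by (rule AE_I2) (use b B in \<open>auto simp: abs_le_square_iff[symmetric]\<close>)
  qed (use v in \<open>auto simp: L2_def\<close>)
  then show ?thesis using B by (simp add: L2_norm_def real_le_lsqrt)
qed

lemma L2_abs: "v \<in> L2 \<Longrightarrow> (\<lambda>y. \<bar>v y\<bar>) \<in> L2"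
  by (auto simp: L2_def)

lemma LINT_abs_le_L2_norm:
  assumes "v \<in> L2"
  shows "(LINT y|Omega. \<bar>v y\<bar>) \<le> L2_norm v"
proof -
  have "L2_norm (\<lambda>y. 1) = 1" by (simp add: L2_norm_def)
  then show ?thesis
    using L2_Cauchy_Schwarz[OF L2_abs[OF assms] L2_const[of 1]]
    by (simp add: L2_inner_def L2_norm_def abs_le_iff)
qed

lemma abs_indefinite_integral_le:
  assumes g: "g \<in> L2" and xy: "0 \<le> x" "x \<le> y" "y \<le> 1"
  shows "\<bar>integral {x..y} g\<bar> \<le> L2_norm g"
proof -
  have ag: "(\<lambda>y. \<bar>g y\<bar>) integrable_on {0..1}" "g integrable_on {0..1}" using L2_integrable_on[OF g] L2_integrable_on[OF L2_abs[OF g]] by auto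
  then have ag': "(\<lambda>y. \<bar>g y\<bar>) integrable_on {x..y}" "g integrable_on {x..y}"
    using xy by (auto elim!: integrable_on_subinterval)
  have "\<bar>integral {x..y} g\<bar> \<le> integral {x..y} (\<lambda>y. \<bar>g y\<bar>)"
    using integral_norm_bound_integral[OF ag'(2) ag'(1)] by simp
  also have "\<dots> \<le> integral {0..1} (\<lambda>y. \<bar>g y\<bar>)"
    using ag ag' xy by (intro integral_subset_le) auto
  also have "\<dots> = (LINT y|Omega. \<bar>g y\<bar>)"
    using lebesgue_integral_eq_integral[OF L2_integrable[OF L2_abs[OF g]]] by simp
  also have "\<dots> \<le> L2_norm g" by (rule LINT_abs_le_L2_norm[OF g])
  finally show ?thesis .
qed

text \<open>
Weak identities hold almost everywhere; for continuous profiles this upgrades them to every point.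
\<close>

lemma continuous_AE_zero:
  fixes q :: "real \<Rightarrow> real"
  assumes ab: "a < b" and q: "continuous_on {a..b} q" and AE: "AE y in lebesgue_on {a..b}. q y = 0" and y: "y \<in> {a..b}"
  shows "q y = 0"
proof -
  have c: "continuous_on {a..b} (\<lambda>y. \<bar>q y\<bar>)" using q by (intro continuous_intros)
  have "(LINT y|lebesgue_on {a..b}. \<bar>q y\<bar>) = 0" using AE by (intro integral_eq_zero_AE) auto
  then have "integral {a..b} (\<lambda>y. \<bar>q y\<bar>) = 0"
    using lebesgue_integral_eq_integral[OF continuous_imp_integrable_real[OF c]] by simp
  then show ?thesis using integral_eq_0_iff[of a b "\<lambda>y. \<bar>q y\<bar>"] c ab y by auto
qed

lemma continuous_L2_norm_zero:
  assumes q: "continuous_on {0..1} q" and z: "L2_inner q q = 0" and y: "y \<in> {0..1}"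
  shows "q y = 0"
proof -
  have c: "continuous_on {0..1} (\<lambda>y. q y * q y)" using q by (intro continuous_intros)
  have "integral {0..1} (\<lambda>y. q y * q y) = 0"
    using z lebesgue_integral_eq_integral[OF continuous_imp_integrable_real[OF c]]
    by (simp add: L2_inner_def)
  then show ?thesis using integral_eq_0_iff[of 0 1 "\<lambda>y. q y * q y"] c y by auto
qed

lemma L2_norm_one [simp]: "L2_norm (\<lambda>_. 1) = 1"
  by (simp add: L2_norm_def)

lemma L2_inner_const_left: "L2_inner (\<lambda>_. c) \<psi> = c * L2_inner \<psi> (\<lambda>_. 1)"
  by (simp add: L2_inner_def)

lemma mean_free_L2: "\<psi> \<in> L2 \<Longrightarrow> (\<lambda>y. \<psi> y - L2_inner \<psi> (\<lambda>_. 1)) \<in> L2"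
  by (intro L2_diff L2_const)

lemma mean_free_mean: "\<psi> \<in> L2 \<Longrightarrow> L2_inner (\<lambda>y. \<psi> y - L2_inner \<psi> (\<lambda>_. 1)) (\<lambda>_. 1) = 0"
  by (subst L2_inner_diff_left) (auto, simp add: L2_inner_def)

lemma L2_inner_mean_free:
  assumes "v \<in> L2" "\<psi> \<in> L2"
  shows "L2_inner v (\<lambda>y. \<psi> y - L2_inner \<psi> (\<lambda>_. 1)) = L2_inner v \<psi> - L2_inner v (\<lambda>_. 1) * L2_inner \<psi> (\<lambda>_. 1)"
proof -
  have "L2_inner v (\<lambda>_. L2_inner \<psi> (\<lambda>_. 1)) = L2_inner v (\<lambda>_. 1) * L2_inner \<psi> (\<lambda>_. 1)"
    by (simp add: L2_inner_def)
  then show ?thesis unfolding L2_inner_diff_right[OF assms(2) L2_const assms(1)] by simp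
qed

lemma Linf_norm_nonneg: "0 \<le> Linf_norm v"
proof -
  have "emeasure Omega (space Omega) \<noteq> 0"
    by (simp add: emeasure_restrict_space)
  then have "0 = esssup Omega (\<lambda>y. 0 :: ereal)" by (simp add: esssup_const)
  also have "\<dots> \<le> esssup Omega (\<lambda>y. ereal \<bar>v y\<bar>)"
    by (rule esssup_mono) auto
  finally show ?thesis by (simp add: Linf_norm_def)
qed

lemma Linf_norm_le:
  assumes "continuous_on {0..1} v" "\<And>y. y \<in> {0..1} \<Longrightarrow> \<bar>v y\<bar> \<le> e"
  shows "Linf_norm v \<le> ereal e"
  unfolding Linf_norm_def
proof (rule esssup_I)
  have "v \<in> borel_measurable Omega" using continuous_L2[OF assms(1)] by (rule L2_measurable)
  then show "(\<lambda>y. ereal \<bar>v y\<bar>) \<in> borel_measurable Omega" by auto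
  show "AE y in Omega. ereal \<bar>v y\<bar> \<le> ereal e" by (rule AE_I2) (use assms(2) in simp)
qed

section \<open>Weak derivatives on the unit interval\<close>

lemma test_function_continuous:
  assumes "test_function a b \<phi> \<phi>'"
  shows "continuous_on A \<phi>" "continuous_on A \<phi>'"
proof -
  have "continuous_on UNIV \<phi>"
    using assms by (auto simp: test_function_def continuous_on_eq_continuous_at intro: DERIV_isCont)
  moreover have "continuous_on UNIV \<phi>'" using assms by (simp add: test_function_def)
  ultimately show "continuous_on A \<phi>" "continuous_on A \<phi>'" by (auto elim: continuous_on_subset)
qed

lemma has_weak_deriv_iff:
  "has_weak_deriv v g \<longleftrightarrow> (\<forall>\<phi> \<phi>'. test_function 0 1 \<phi> \<phi>' \<longrightarrow> L2_inner v \<phi>' = - L2_inner g \<phi>)"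
  by (simp add: has_weak_deriv_def L2_inner_def)

lemma has_weak_deriv_lincomb:
  assumes "has_weak_deriv v g" "has_weak_deriv w h" "v \<in> L2" "w \<in> L2" "g \<in> L2" "h \<in> L2"
  shows "has_weak_deriv (\<lambda>y. c * v y + w y) (\<lambda>y. c * g y + h y)"
  unfolding has_weak_deriv_iff
proof (intro allI impI)
  fix \<phi> \<phi>' assume tf: "test_function 0 1 \<phi> \<phi>'"
  then have "\<phi> \<in> L2" "\<phi>' \<in> L2" by (auto intro: continuous_L2 test_function_continuous)
  moreover have "L2_inner v \<phi>' = - L2_inner g \<phi>" "L2_inner w \<phi>' = - L2_inner h \<phi>"
    using tf assms(1,2) by (auto simp: has_weak_deriv_iff)
  ultimately show "L2_inner (\<lambda>y. c * v y + w y) \<phi>' = - L2_inner (\<lambda>y. c * g y + h y) \<phi>"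
    using assms(3-) by (simp add: L2_inner_add_left L2_cmult L2_inner_cmult_left)
qed

lemma has_weak_deriv_cong_AE:
  assumes "has_weak_deriv v g" "AE y in Omega. g y = h y" "g \<in> L2" "h \<in> L2"
  shows "has_weak_deriv v h"
  unfolding has_weak_deriv_iff
proof (intro allI impI)
  fix \<phi> \<phi>' assume tf: "test_function 0 1 \<phi> \<phi>'"
  then have "\<phi> \<in> L2" by (auto intro: continuous_L2 test_function_continuous)
  then have "L2_inner g \<phi> = L2_inner h \<phi>" by (intro L2_inner_cong_AE assms) auto
  then show "L2_inner v \<phi>' = - L2_inner h \<phi>" using tf assms(1) by (simp add: has_weak_deriv_iff)
qed

lemma wderiv:
  assumes "g \<in> L2" "has_weak_deriv v g"
  shows "wderiv v \<in> L2" "has_weak_deriv v (wderiv v)"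
  unfolding wderiv_def using someI[of "\<lambda>g. g \<in> L2 \<and> has_weak_deriv v g" g] assms by auto

lemma H1_wderiv:
  assumes "v \<in> H1"
  shows "wderiv v \<in> L2" "has_weak_deriv v (wderiv v)" "v \<in> L2" "continuous_on {0..1} v"
  using assms wderiv by (auto simp: H1_def)

lemma weak_deriv_AE:
  assumes "v \<in> L2" "g \<in> L2" "has_weak_deriv v g"
  shows "\<exists>c. AE y in Omega. v y = c + integral {0..y} g"
  by (rule du_Bois_Reymond) (use assms in \<open>auto simp: L2_integrable has_weak_deriv_def\<close>)

lemma continuous_on_L2_primitive: "g \<in> L2 \<Longrightarrow> continuous_on {0..1} (\<lambda>y. integral {0..y} g)"
  by (intro continuous_indefinite_integral L2_integrable)

lemma du_Bois_Reymond_continuous: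
  fixes v g :: "real \<Rightarrow> real"
  assumes ab: "a < b" and v: "continuous_on {a..b} v" and g: "integrable (lebesgue_on {a..b}) g"
    and weak: "\<And>\<phi> \<phi>'. test_function a b \<phi> \<phi>' \<Longrightarrow>
       (LINT x|lebesgue_on {a..b}. v x * \<phi>' x) = - (LINT x|lebesgue_on {a..b}. g x * \<phi> x)"
    and y: "y \<in> {a..b}"
  shows "v y = v a + integral {a..y} g"
proof -
  obtain c where c: "AE y in lebesgue_on {a..b}. v y = c + integral {a..y} g"
    using du_Bois_Reymond[OF ab continuous_imp_integrable_real[OF v] g weak] by blast
  have c0: "AE y in lebesgue_on {a..b}. v y - (c + integral {a..y} g) = 0"
    using c by (rule AE_mp) simp
  have "continuous_on {a..b} (\<lambda>y. v y - (c + integral {a..y} g))"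
    by (intro continuous_intros v continuous_indefinite_integral g)
  from continuous_AE_zero[OF ab this c0] have *: "v y = c + integral {a..y} g" if "y \<in> {a..b}" for y
    using that by force
  have "v a = c" using *[of a] ab by simp
  then show ?thesis using *[OF y] by simp
qed

lemma weak_deriv_FTC:
  assumes v: "continuous_on {0..1} v" "g \<in> L2" "has_weak_deriv v g" and y: "y \<in> {0..1}"
  shows "v y = v 0 + integral {0..y} g"
  by (rule du_Bois_Reymond_continuous[OF _ v(1) L2_integrable[OF v(2)] _ y])
     (use v(3) in \<open>simp_all add: has_weak_deriv_def\<close>)

text \<open>
Both derivatives have the same primitive, because \<open>v\<close> determines it. The statement is needed since
\<open>wderiv\<close> is a choice among representatives and so is linear only up to null sets.
\<close>

lemma weak_deriv_unique:
  assumes "continuous_on {0..1} v" "g \<in> L2" "has_weak_deriv v g" "h \<in> L2" "has_weak_deriv v h"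
  shows "AE y in Omega. g y = h y"
proof -
  have eq: "integral {0..y} g = integral {0..y} h" if "y \<in> {0..1}" for y
    using weak_deriv_FTC[OF assms(1-3) that] weak_deriv_FTC[OF assms(1,4,5) that] by simp
  have "AE y in Omega. g y - h y = 0"
  proof (rule integral_intervals_zero_imp_AE_zero)
    show "integrable Omega (\<lambda>y. g y - h y)" using assms by (auto simp: L2_integrable)
    fix s t :: real assume st: "0 \<le> s" "s \<le> t" "t \<le> 1"
    have int: "g integrable_on {0..t}" "h integrable_on {0..t}" "g integrable_on {s..t}" "h integrable_on {s..t}"
      using L2_integrable_on[OF assms(2)] L2_integrable_on[OF assms(4)] st
      by (auto elim!: integrable_on_subinterval)
    have "integral {s..t} g = integral {s..t} h"
      using Henstock_Kurzweil_Integration.integral_combine[OF st(1,2) int(1)]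
        Henstock_Kurzweil_Integration.integral_combine[OF st(1,2) int(2)] eq[of s] eq[of t] st by simp
    then show "integral {s..t} (\<lambda>y. g y - h y) = 0"
      using int by (simp add: Henstock_Kurzweil_Integration.integral_diff)
  qed
  then show ?thesis by simp
qed

lemma H1_lincomb:
  assumes "v \<in> H1" "w \<in> H1"
  shows "(\<lambda>y. c * v y + w y) \<in> H1"
  using H1_wderiv[OF assms(1)] H1_wderiv[OF assms(2)]
  by (auto simp: H1_def intro!: continuous_intros has_weak_deriv_lincomb
      bexI[of _ "\<lambda>y. c * wderiv v y + wderiv w y"])

lemma wderiv_lincomb:
  assumes "v \<in> H1" "w \<in> H1"
  shows "AE y in Omega. wderiv (\<lambda>y. c * v y + w y) y = c * wderiv v y + wderiv w y"
  using H1_wderiv[OF assms(1)] H1_wderiv[OF assms(2)] H1_wderiv[OF H1_lincomb[OF assms, of c]]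
  by (intro weak_deriv_unique[where v="\<lambda>y. c * v y + w y"])
     (auto intro!: has_weak_deriv_lincomb)

lemma H1_diff:
  assumes "v \<in> H1" "w \<in> H1"
  shows "(\<lambda>y. v y - w y) \<in> H1" "AE y in Omega. wderiv (\<lambda>y. v y - w y) y = wderiv v y - wderiv w y"
  using H1_lincomb[OF assms(2,1), of "-1"] wderiv_lincomb[OF assms(2,1), of "-1"] by simp_all

lemma H1_norm_bounds:
  "L2_norm v \<le> H1_norm v" "L2_norm (wderiv v) \<le> H1_norm v" "0 \<le> H1_norm v"
  by (auto simp: H1_norm_def intro!: real_le_rsqrt)

lemma H1_norm_diff_bounds:
  assumes "v \<in> H1" "w \<in> H1"
  shows "L2_norm (\<lambda>y. wderiv v y - wderiv w y) \<le> H1_norm (\<lambda>y. v y - w y)"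
proof -
  note AE = AE_symmetric[OF H1_diff(2)[OF assms]]
  note mem = L2_diff[OF H1_wderiv(1)[OF assms(1)] H1_wderiv(1)[OF assms(2)]] H1_wderiv(1)[OF H1_diff(1)[OF assms]]
  have "L2_norm (\<lambda>y. wderiv v y - wderiv w y) = L2_norm (wderiv (\<lambda>y. v y - w y))"
    unfolding L2_norm_eq L2_inner_cong_AE[OF AE AE mem mem] ..
  also have "\<dots> \<le> H1_norm (\<lambda>y. v y - w y)" by (rule H1_norm_bounds(2))
  finally show ?thesis .
qed

lemma integral_diff_indefinite:
  assumes g: "g \<in> L2" and xy: "0 \<le> x" "x \<le> y" "y \<le> 1"
  shows "integral {0..y} g - integral {0..x} g = integral {x..y} g"
proof -
  have "g integrable_on {0..y}"
    using L2_integrable_on[OF g] xy by (auto elim!: integrable_on_subinterval)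
  from Henstock_Kurzweil_Integration.integral_combine[OF xy(1,2) this] show ?thesis by simp
qed

text \<open>
The oscillation of \<open>v\<close> is at most the \<open>L\<^sup>1\<close> norm of its derivative; averaging
\<open>\<bar>v(y)\<bar> \<le> \<bar>v(x)\<bar> + \<parallel>v'\<parallel>\<close> over \<open>x\<close> removes the value at \<open>x\<close>. This is the embedding of \<open>H\<^sup>1\<close> into the
continuous functions.
\<close>

lemma H1_sup_bound:
  assumes v: "v \<in> H1" and y: "y \<in> {0..1}"
  shows "\<bar>v y\<bar> \<le> 2 * H1_norm v"
proof -
  note w = H1_wderiv[OF v]
  have diff: "\<bar>v y - v x\<bar> \<le> L2_norm (wderiv v)" if x: "x \<in> {0..1}" for x
  proof -
    have "v y - v x = integral {0..y} (wderiv v) - integral {0..x} (wderiv v)"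
      using weak_deriv_FTC[OF w(4,1,2) x] weak_deriv_FTC[OF w(4,1,2) y] by linarith
    moreover have *: "\<bar>integral {0..t} (wderiv v) - integral {0..s} (wderiv v)\<bar> \<le> L2_norm (wderiv v)"
      if "0 \<le> s" "s \<le> t" "t \<le> 1" for s t
      unfolding integral_diff_indefinite[OF w(1) that] by (rule abs_indefinite_integral_le[OF w(1) that])
    have "\<bar>integral {0..y} (wderiv v) - integral {0..x} (wderiv v)\<bar> \<le> L2_norm (wderiv v)"
    proof (cases "x \<le> y")
      case True
      then show ?thesis using *[of x y] x y by (simp only: atLeastAtMost_iff)
    next
      case False
      then show ?thesis using *[of y x] x y unfolding atLeastAtMost_iff by linarith
    qed
    ultimately show ?thesis by (simp only:)
  qed
  have "(LINT x|Omega. \<bar>v y\<bar>) \<le> (LINT x|Omega. \<bar>v x\<bar> + L2_norm (wderiv v))"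
  proof (rule integral_mono_AE)
    show "AE x in Omega. \<bar>v y\<bar> \<le> \<bar>v x\<bar> + L2_norm (wderiv v)"
    proof (rule AE_I2)
      fix x assume "x \<in> space Omega"
      then have "x \<in> {0..1}" by simp
      from diff[OF this] show "\<bar>v y\<bar> \<le> \<bar>v x\<bar> + L2_norm (wderiv v)" by linarith
    qed
  next
    show "integrable Omega (\<lambda>x. \<bar>v x\<bar> + L2_norm (wderiv v))"
      by (intro Bochner_Integration.integrable_add integrable_abs L2_integrable w(3) integrable_Omega_const)
  qed simp
  also have "\<dots> = (LINT x|Omega. \<bar>v x\<bar>) + L2_norm (wderiv v)"
    by (subst Bochner_Integration.integral_add) (simp_all add: L2_integrable w(3))
  finally have "\<bar>v y\<bar> \<le> (LINT x|Omega. \<bar>v x\<bar>) + L2_norm (wderiv v)" by simp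
  then show ?thesis
    using LINT_abs_le_L2_norm[OF w(3)] H1_norm_bounds[of v] by linarith
qed

text \<open>
Test functions are dense in the functions of \<open>H\<^sup>1\<close> vanishing at both ends, and those are the
primitives of mean-free functions of \<open>L\<^sup>2\<close>. Instead of the density, the proof uses that \<open>w\<close> is a
primitive of \<open>g\<close> up to a constant, and integrates by parts.
\<close>

lemma weak_deriv_test_primitive:
  assumes w: "w \<in> L2" "g \<in> L2" "has_weak_deriv w g" and k: "k \<in> L2" "L2_inner k (\<lambda>_. 1) = 0"
  shows "L2_inner w k = - L2_inner g (\<lambda>y. integral {0..y} k)"
proof -
  obtain c where c: "AE y in Omega. w y = c + integral {0..y} g"
    using weak_deriv_AE[OF w] by blast
  have cont: "continuous_on {0..1} (\<lambda>y. integral {0..y} g)" "continuous_on {0..1} (\<lambda>y. integral {0..y} k)"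
    by (rule continuous_on_L2_primitive[OF w(2)], rule continuous_on_L2_primitive[OF k(1)])
  have P: "(\<lambda>y. integral {0..y} g) \<in> L2" using cont(1) by (rule continuous_L2)
  have "L2_inner w k = L2_inner (\<lambda>y. c + integral {0..y} g) k"
    by (rule L2_inner_cong_AE[OF c _ w(1) L2_add[OF L2_const P] k(1) k(1)]) simp
  also have "\<dots> = L2_inner (\<lambda>y. c) k + L2_inner (\<lambda>y. integral {0..y} g) k"
    by (rule L2_inner_add_left[OF L2_const P k(1)])
  also have "\<dots> = L2_inner (\<lambda>y. integral {0..y} g) k" using k(2) by (simp add: L2_inner_def)
  also have "\<dots> = - L2_inner g (\<lambda>y. integral {0..y} k)"
  proof -
    have "(LINT y|Omega. k y) = 0" using k(2) by (simp only: L2_inner_def mult_1_right)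
    then have "(LINT y|Omega. g y * integral {0..y} k) + (LINT y|Omega. integral {0..y} g * k y) = 0"
      using integration_by_parts_indefinite[OF L2_integrable[OF w(2)] L2_integrable[OF k(1)]]
      by (simp only: mult_zero_right)
    then show ?thesis unfolding L2_inner_def by linarith
  qed
  finally show ?thesis .
qed

lemma H2_wderiv:
  assumes "v \<in> H2"
  shows "v \<in> H1" "wderiv (wderiv v) \<in> L2" "has_weak_deriv (wderiv v) (wderiv (wderiv v))"
  using assms wderiv[of _ "wderiv v"] by (auto simp: H2_def)

section \<open>Continuity in time\<close>

text \<open>
Continuity of a time-dependent profile as a map into \<open>L\<^sup>2\<close>. Working on an arbitrary set of times makes
it possible to pass from the intervals \<open>[0,T]\<close> of the solution concept to the half-line.
\<close>

definition L2_continuous_on :: "real set \<Rightarrow> (real \<Rightarrow> real \<Rightarrow> real) \<Rightarrow> bool"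
  where "L2_continuous_on S F \<longleftrightarrow> (\<forall>t\<in>S. F t \<in> L2) \<and>
    (\<forall>t\<in>S. ((\<lambda>s. L2_norm (\<lambda>y. F s y - F t y)) \<longlongrightarrow> 0) (at t within S))"

lemma L2_continuous_onD: "L2_continuous_on S F \<Longrightarrow> t \<in> S \<Longrightarrow> F t \<in> L2"
  by (simp add: L2_continuous_on_def)

lemma L2_continuous_on_subset: "L2_continuous_on S F \<Longrightarrow> R \<subseteq> S \<Longrightarrow> L2_continuous_on R F"
  unfolding L2_continuous_on_def by (meson subsetD tendsto_within_subset)

lemma at_within_atLeastAtMost_extend:
  fixes t T :: real
  assumes "0 \<le> t" "t < T"
  shows "at t within {0..T} = at t within {0..}"
  by (rule at_within_nhd[of _ "{..<T}"]) (use assms in auto)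

lemma L2_continuous_on_Ici:
  assumes "\<And>T. T > 0 \<Longrightarrow> L2_continuous_on {0..T} F"
  shows "L2_continuous_on {0..} F"
  unfolding L2_continuous_on_def
proof (intro conjI ballI)
  fix t :: real assume "t \<in> {0..}"
  then have t: "t \<in> {0..t+1}" "t + 1 > 0" "0 \<le> t" "t < t + 1" by auto
  from assms[OF t(2)] t(1) show "F t \<in> L2" by (simp add: L2_continuous_on_def)
  from assms[OF t(2)] t(1)
  show "((\<lambda>s. L2_norm (\<lambda>y. F s y - F t y)) \<longlongrightarrow> 0) (at t within {0..})"
    unfolding L2_continuous_on_def at_within_atLeastAtMost_extend[OF t(3,4), symmetric] by blast
qed

lemma L2_continuous_on_cmult:
  assumes "L2_continuous_on S F"
  shows "L2_continuous_on S (\<lambda>t y. c * F t y)"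
  unfolding L2_continuous_on_def
proof (intro conjI ballI)
  fix t assume t: "t \<in> S"
  show "(\<lambda>y. c * F t y) \<in> L2" using assms t by (auto simp: L2_continuous_on_def)
  have "((\<lambda>s. \<bar>c\<bar> * L2_norm (\<lambda>y. F s y - F t y)) \<longlongrightarrow> \<bar>c\<bar> * 0) (at t within S)"
    using assms t by (intro tendsto_intros) (auto simp: L2_continuous_on_def)
  then show "((\<lambda>s. L2_norm (\<lambda>y. c * F s y - c * F t y)) \<longlongrightarrow> 0) (at t within S)"
    by (simp add: L2_norm_cmult flip: right_diff_distrib)
qed

lemma L2_continuous_on_add:
  assumes "L2_continuous_on S F" "L2_continuous_on S H"
  shows "L2_continuous_on S (\<lambda>t y. F t y + H t y)"
  unfolding L2_continuous_on_def
proof (intro conjI ballI)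
  fix t assume t: "t \<in> S"
  show "(\<lambda>y. F t y + H t y) \<in> L2" using assms t by (auto simp: L2_continuous_on_def)
  show "((\<lambda>s. L2_norm (\<lambda>y. F s y + H s y - (F t y + H t y))) \<longlongrightarrow> 0) (at t within S)"
  proof (rule tendsto_sandwich[OF _ _ tendsto_const])
    show "\<forall>\<^sub>F s in at t within S. L2_norm (\<lambda>y. F s y + H s y - (F t y + H t y))
        \<le> L2_norm (\<lambda>y. F s y - F t y) + L2_norm (\<lambda>y. H s y - H t y)"
      unfolding eventually_at_filter
    proof (rule always_eventually, intro allI impI)
      fix s assume s: "s \<in> S"
      have "L2_norm (\<lambda>y. (F s y - F t y) + (H s y - H t y))
        \<le> L2_norm (\<lambda>y. F s y - F t y) + L2_norm (\<lambda>y. H s y - H t y)"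
        by (rule L2_triangle; rule L2_diff) (use assms s t in \<open>auto simp: L2_continuous_on_def\<close>)
      moreover have "(\<lambda>y. (F s y - F t y) + (H s y - H t y)) = (\<lambda>y. F s y + H s y - (F t y + H t y))"
        by auto
      ultimately show "L2_norm (\<lambda>y. F s y + H s y - (F t y + H t y))
        \<le> L2_norm (\<lambda>y. F s y - F t y) + L2_norm (\<lambda>y. H s y - H t y)" by simp
    qed
    have "((\<lambda>s. L2_norm (\<lambda>y. F s y - F t y) + L2_norm (\<lambda>y. H s y - H t y)) \<longlongrightarrow> 0 + 0) (at t within S)"
      using assms t by (intro tendsto_intros) (auto simp: L2_continuous_on_def)
    then show "((\<lambda>s. L2_norm (\<lambda>y. F s y - F t y) + L2_norm (\<lambda>y. H s y - H t y)) \<longlongrightarrow> 0) (at t within S)"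
      by simp
  qed simp
qed

lemma L2_continuous_on_diff:
  assumes "L2_continuous_on S F" "L2_continuous_on S H"
  shows "L2_continuous_on S (\<lambda>t y. F t y - H t y)"
  using L2_continuous_on_add[OF assms(1) L2_continuous_on_cmult[OF assms(2), of "-1"]] by simp

lemma L2_continuous_on_const:
  assumes "v \<in> L2"
  shows "L2_continuous_on S (\<lambda>t. v)"
  using assms by (simp add: L2_continuous_on_def L2_norm_def)

text \<open>
Stated for an arbitrary filter, because the energy identity evaluates the two factors at different
times that converge to a common limit.
\<close>

lemma L2_inner_tendsto:
  assumes v: "\<forall>\<^sub>F x in A. V x \<in> L2" "v \<in> L2" "((\<lambda>x. L2_norm (\<lambda>y. V x y - v y)) \<longlongrightarrow> 0) A"
    and w: "\<forall>\<^sub>F x in A. W x \<in> L2" "w \<in> L2" "((\<lambda>x. L2_norm (\<lambda>y. W x y - w y)) \<longlongrightarrow> 0) A"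
  shows "((\<lambda>x. L2_inner (V x) (W x)) \<longlongrightarrow> L2_inner v w) A"
proof -
  let ?p = "\<lambda>x. L2_norm (\<lambda>y. V x y - v y)" and ?q = "\<lambda>x. L2_norm (\<lambda>y. W x y - w y)"
  have "((\<lambda>x. L2_inner (V x) (W x) - L2_inner v w) \<longlongrightarrow> 0) A"
  proof (rule Lim_null_comparison)
    show "\<forall>\<^sub>F x in A. norm (L2_inner (V x) (W x) - L2_inner v w) \<le> ?p x * (?q x + L2_norm w) + L2_norm v * ?q x"
      using v(1) w(1)
    proof eventually_elim
      case (elim x)
      have dv: "(\<lambda>y. V x y - v y) \<in> L2" and dw: "(\<lambda>y. W x y - w y) \<in> L2"
        using elim v(2) w(2) by auto
      have "L2_inner (V x) (W x) - L2_inner v w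
          = L2_inner (\<lambda>y. V x y - v y) (\<lambda>y. W x y - w y) + L2_inner (\<lambda>y. V x y - v y) w
            + L2_inner v (\<lambda>y. W x y - w y)"
        using elim v(2) w(2) dv dw
        by (simp add: L2_inner_diff_left L2_inner_diff_right)
      moreover have "\<bar>L2_inner (\<lambda>y. V x y - v y) (\<lambda>y. W x y - w y)\<bar> \<le> ?p x * ?q x"
        by (rule L2_Cauchy_Schwarz[OF dv dw])
      moreover have "\<bar>L2_inner (\<lambda>y. V x y - v y) w\<bar> \<le> ?p x * L2_norm w"
        by (rule L2_Cauchy_Schwarz[OF dv w(2)])
      moreover have "\<bar>L2_inner v (\<lambda>y. W x y - w y)\<bar> \<le> L2_norm v * ?q x"
        by (rule L2_Cauchy_Schwarz[OF v(2) dw])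
      ultimately show ?case by (simp add: distrib_left)
    qed
    have "((\<lambda>x. ?p x * (?q x + L2_norm w) + L2_norm v * ?q x) \<longlongrightarrow> 0 * (0 + L2_norm w) + L2_norm v * 0) A"
      by (intro tendsto_intros v(3) w(3))
    then show "((\<lambda>x. ?p x * (?q x + L2_norm w) + L2_norm v * ?q x) \<longlongrightarrow> 0) A" by simp
  qed
  then show ?thesis by (rule LIM_zero_cancel)
qed

lemma continuous_on_L2_inner:
  assumes "L2_continuous_on S F" "L2_continuous_on S H"
  shows "continuous_on S (\<lambda>t. L2_inner (F t) (H t))"
  unfolding continuous_on_def
proof
  fix t assume t: "t \<in> S"
  have ev: "\<forall>\<^sub>F s in at t within S. s \<in> S" by (simp add: eventually_at_filter)
  show "((\<lambda>t. L2_inner (F t) (H t)) \<longlongrightarrow> L2_inner (F t) (H t)) (at t within S)"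
    by (rule L2_inner_tendsto)
       (use assms t in \<open>auto simp: L2_continuous_on_def intro: eventually_mono[OF ev]\<close>)
qed

lemma sup_continuous_imp_L2_continuous_on:
  fixes F :: "real \<Rightarrow> real \<Rightarrow> real"
  assumes cont: "\<And>t. t \<in> S \<Longrightarrow> continuous_on {0..1} (F t)"
    and unif: "\<And>t e. t \<in> S \<Longrightarrow> e > 0 \<Longrightarrow> \<forall>\<^sub>F s in at t within S. \<forall>y\<in>{0..1}. \<bar>F s y - F t y\<bar> < e"
  shows "L2_continuous_on S F"
  unfolding L2_continuous_on_def
proof (intro conjI ballI)
  fix t assume t: "t \<in> S"
  show "F t \<in> L2" using cont[OF t] by (rule continuous_L2)
  show "((\<lambda>s. L2_norm (\<lambda>y. F s y - F t y)) \<longlongrightarrow> 0) (at t within S)"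
  proof (rule tendstoI)
    fix e :: real assume e: "e > 0"
    have "\<forall>\<^sub>F s in at t within S. s \<in> S" by (simp add: eventually_at_filter)
    with unif[OF t half_gt_zero[OF e]]
    show "\<forall>\<^sub>F s in at t within S. dist (L2_norm (\<lambda>y. F s y - F t y)) 0 < e"
    proof eventually_elim
      case (elim s)
      have "L2_norm (\<lambda>y. F s y - F t y) \<le> e/2"
        using elim cont[OF t] cont[of s]
        by (intro L2_norm_le_sup L2_diff continuous_L2) (auto intro: less_imp_le)
      then show ?case using e by (simp add: dist_real_def)
    qed
  qed
qed

lemma joint_continuous_imp_unif:
  fixes F :: "real \<Rightarrow> real \<Rightarrow> real"
  assumes F: "continuous_on ({0..} \<times> {0..1}) (\<lambda>(t,y). F t y)" and t: "t \<ge> 0" and e: "e > 0"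
  shows "\<forall>\<^sub>F s in at t within {0..}. \<forall>y\<in>{0..1}. \<bar>F s y - F t y\<bar> < e"
proof -
  have "continuous_on ({0..t+1} \<times> {0..1}) (\<lambda>(t,y). F t y)"
    by (rule continuous_on_subset[OF F]) auto
  then have "uniformly_continuous_on ({0..t+1} \<times> {0..1}) (\<lambda>(t,y). F t y)"
    by (intro compact_uniformly_continuous compact_Times compact_Icc)
  then obtain d where d: "d > 0" "\<And>p q. p \<in> {0..t+1} \<times> {0..1} \<Longrightarrow> q \<in> {0..t+1} \<times> {0..1} \<Longrightarrow> dist q p < d \<Longrightarrow>
      dist ((\<lambda>(t,y). F t y) q) ((\<lambda>(t,y). F t y) p) < e"
    unfolding uniformly_continuous_on_def using e by metis
  have "\<forall>s\<in>{0..}. s \<noteq> t \<and> dist s t < min d 1 \<longrightarrow> (\<forall>y\<in>{0..1}. \<bar>F s y - F t y\<bar> < e)"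
  proof (intro ballI impI)
    fix s y :: real assume s: "s \<in> {0..}" "s \<noteq> t \<and> dist s t < min d 1" and y: "y \<in> {0..1}"
    have "dist (s,y) (t,y) < d" using s by (simp add: dist_Pair_Pair)
    moreover have "(s,y) \<in> {0..t+1} \<times> {0..1}" "(t,y) \<in> {0..t+1} \<times> {0..1}"
      using s y t by (auto simp: dist_real_def)
    ultimately show "\<bar>F s y - F t y\<bar> < e" using d(2)[of "(t,y)" "(s,y)"] by (simp add: dist_real_def)
  qed
  then show ?thesis unfolding eventually_at using d(1) by (intro exI[of _ "min d 1"]) auto
qed

lemma joint_continuous_slice:
  assumes F: "continuous_on ({0..} \<times> {0..1}) (\<lambda>(t,y). F t y)" and t: "t \<ge> (0::real)"
  shows "continuous_on {0..1::real} (F t)"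
proof -
  have "continuous_on {0..1} (\<lambda>y. (t, y))" by (rule continuous_on_Pair[OF continuous_on_const continuous_on_id])
  from continuous_on_compose2[OF F this] t show ?thesis by auto
qed

lemma joint_continuous_slice_time:
  assumes F: "continuous_on ({0..} \<times> {0..1}) (\<lambda>(t,y). F t y)" and y: "y \<in> {0..1::real}"
  shows "continuous_on {0::real..} (\<lambda>t. F t y)"
proof -
  have "continuous_on {0..} (\<lambda>t. (t, y))" by (rule continuous_on_Pair[OF continuous_on_id continuous_on_const])
  moreover have "(\<lambda>t. (t, y)) ` {0..} \<subseteq> {0..} \<times> {0..1}" using y by blast
  ultimately show ?thesis using continuous_on_compose2[OF F, of "{0..}" "\<lambda>t. (t, y)"] by simp
qed

lemma joint_continuous_imp_L2_continuous_on:
  fixes F :: "real \<Rightarrow> real \<Rightarrow> real"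
  assumes F: "continuous_on ({0..} \<times> {0..1}) (\<lambda>(t,y). F t y)"
  shows "L2_continuous_on {0..} F"
  by (rule sup_continuous_imp_L2_continuous_on)
     (use joint_continuous_slice[OF F] joint_continuous_imp_unif[OF F] in auto)

text \<open>
This is how joint continuity in \<open>(t,y)\<close> arises: from continuity into \<open>H\<^sup>1\<close> through the sup bound, and
for primitives from continuity into \<open>L\<^sup>2\<close>.
\<close>

lemma uniform_slices_imp_joint_continuous:
  fixes F :: "real \<Rightarrow> real \<Rightarrow> real"
  assumes cont: "\<And>t. t \<ge> 0 \<Longrightarrow> continuous_on {0..1} (F t)"
    and unif: "\<And>t e. t \<ge> 0 \<Longrightarrow> e > 0 \<Longrightarrow> \<forall>\<^sub>F s in at t within {0..}. \<forall>y\<in>{0..1}. \<bar>F s y - F t y\<bar> < e"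
  shows "continuous_on ({0..} \<times> {0..1}) (\<lambda>(t,y). F t y)"
  unfolding continuous_on_iff
proof (intro ballI allI impI)
  fix p :: "real \<times> real" and e :: real assume p: "p \<in> {0..} \<times> {0..1}" and e: "e > 0"
  obtain t y where ty: "p = (t,y)" "t \<ge> 0" "y \<in> {0..1}" using p by auto
  obtain d1 where d1: "d1 > 0" "\<And>s. s \<ge> 0 \<Longrightarrow> s \<noteq> t \<Longrightarrow> dist s t < d1 \<Longrightarrow> \<forall>y\<in>{0..1}. \<bar>F s y - F t y\<bar> < e/2"
    using unif[OF ty(2) half_gt_zero[OF e]] unfolding eventually_at by auto
  obtain d2 where d2: "d2 > 0" "\<And>x. x \<in> {0..1} \<Longrightarrow> dist x y < d2 \<Longrightarrow> dist (F t x) (F t y) < e/2"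
    using cont[OF ty(2)] ty(3) half_gt_zero[OF e] unfolding continuous_on_iff by blast
  show "\<exists>d>0. \<forall>q\<in>{0..} \<times> {0..1}. dist q p < d \<longrightarrow> dist (case q of (t,y) \<Rightarrow> F t y) (case p of (t,y) \<Rightarrow> F t y) < e"
  proof (intro exI[of _ "min d1 d2"] conjI ballI impI)
    fix q assume q: "q \<in> {0..} \<times> {0..1::real}" and d: "dist q p < min d1 d2"
    obtain s x where sx: "q = (s,x)" "s \<ge> 0" "x \<in> {0..1}" using q by auto
    have "dist s t < d1" "dist x y < d2"
      using d dist_fst_le[of q p] dist_snd_le[of q p] by (auto simp: sx ty)
    then have "\<bar>F s x - F t x\<bar> < e/2" "dist (F t x) (F t y) < e/2"
      using d1(2)[OF sx(2)] d2(2)[OF sx(3)] sx(3) e by (cases "s = t", auto)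
    then show "dist (case q of (t,y) \<Rightarrow> F t y) (case p of (t,y) \<Rightarrow> F t y) < e"
      unfolding sx ty dist_real_def by (simp, linarith)
  qed (use d1 d2 in auto)
qed

lemma joint_bounded_slice:
  assumes "continuous_on ({0..} \<times> {0..1}) (\<lambda>(t,y). F t y)" "t \<ge> (0::real)"
  obtains B :: real where "B \<ge> 0" "\<And>y::real. y \<in> {0..1} \<Longrightarrow> \<bar>F t y\<bar> \<le> B"
proof -
  have "bounded (F t ` {0..1})"
    by (intro compact_imp_bounded compact_continuous_image joint_continuous_slice[OF assms(1)] assms(2)) simp
  then obtain B where "\<And>x. x \<in> F t ` {0..1} \<Longrightarrow> norm x \<le> B" unfolding bounded_iff by blast
  then have B: "\<bar>F t y\<bar> \<le> B" if "y \<in> {0..1}" for y using that by force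
  moreover have "B \<ge> 0" using B[of 0] by simp
  ultimately show ?thesis using that by blast
qed

lemma comp_fst_continuous:
  fixes h :: "real \<Rightarrow> real"
  shows "continuous_on {0..} h \<Longrightarrow> continuous_on ({0..} \<times> {0..1::real}) (\<lambda>p. h (fst p))"
  by (rule continuous_on_compose2) (auto intro!: continuous_intros)

lemma L2_continuous_on_shift:
  assumes F: "L2_continuous_on {0..} F" and h: "h \<ge> 0"
  shows "L2_continuous_on {0..} (\<lambda>t. F (h + t))"
  unfolding L2_continuous_on_def
proof (intro conjI ballI)
  fix t :: real assume t: "t \<in> {0..}"
  show "F (h + t) \<in> L2" using F t h by (auto simp: L2_continuous_on_def)
  have "((\<lambda>s. h + s) \<longlongrightarrow> h + t) (at t within {0..})" by (intro tendsto_intros)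
  then have "filterlim (\<lambda>s. h + s) (at (h + t) within {0..}) (at t within {0..})"
    using h by (auto simp: filterlim_at eventually_at_filter)
  moreover have "((\<lambda>s. L2_norm (\<lambda>y. F s y - F (h + t) y)) \<longlongrightarrow> 0) (at (h + t) within {0..})"
    using F t h by (auto simp: L2_continuous_on_def)
  ultimately show "((\<lambda>s. L2_norm (\<lambda>y. F (h + s) y - F (h + t) y)) \<longlongrightarrow> 0) (at t within {0..})"
    by (rule filterlim_compose[rotated])
qed

lemma C_time_H1_L2_continuous_on:
  assumes "F \<in> C_time T H1 H1_norm"
  shows "L2_continuous_on {0..T} F" "L2_continuous_on {0..T} (\<lambda>t. wderiv (F t))"
proof -
  have F: "F t \<in> H1" if "t \<in> {0..T}" for t using assms that by (simp add: C_time_def)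
  have lim: "((\<lambda>s. H1_norm (\<lambda>y. F s y - F t y)) \<longlongrightarrow> 0) (at t within {0..T})" if "t \<in> {0..T}" for t
    using assms that by (simp add: C_time_def)
  have ev: "\<forall>\<^sub>F s in at t within {0..T}. s \<in> {0..T}" for t by (simp add: eventually_at_filter)
  show "L2_continuous_on {0..T} F"
    unfolding L2_continuous_on_def
  proof (intro conjI ballI)
    fix t assume t: "t \<in> {0..T}"
    show "F t \<in> L2" using F[OF t] by (rule H1_wderiv)
    show "((\<lambda>s. L2_norm (\<lambda>y. F s y - F t y)) \<longlongrightarrow> 0) (at t within {0..T})"
      by (rule tendsto_sandwich[OF _ _ tendsto_const lim[OF t]])
         (simp_all add: H1_norm_bounds(1))
  qed
  show "L2_continuous_on {0..T} (\<lambda>t. wderiv (F t))"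
    unfolding L2_continuous_on_def
  proof (intro conjI ballI)
    fix t assume t: "t \<in> {0..T}"
    show "wderiv (F t) \<in> L2" using F[OF t] by (rule H1_wderiv)
    show "((\<lambda>s. L2_norm (\<lambda>y. wderiv (F s) y - wderiv (F t) y)) \<longlongrightarrow> 0) (at t within {0..T})"
    proof (rule tendsto_sandwich[OF _ _ tendsto_const lim[OF t]])
      show "\<forall>\<^sub>F s in at t within {0..T}. L2_norm (\<lambda>y. wderiv (F s) y - wderiv (F t) y) \<le> H1_norm (\<lambda>y. F s y - F t y)"
        by (rule eventually_mono[OF ev]) (rule H1_norm_diff_bounds[OF F F[OF t]])
    qed simp
  qed
qed

lemma C_time_H1_joint_continuous:
  assumes F: "\<And>T. T > 0 \<Longrightarrow> F \<in> C_time T H1 H1_norm"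
  shows "continuous_on ({0..} \<times> {0..1}) (\<lambda>(t,y). F t y)"
proof (rule uniform_slices_imp_joint_continuous)
  have F1: "F t \<in> H1" if "t \<ge> 0" for t
    using F[of "t+1"] that by (simp add: C_time_def)
  fix t :: real assume t: "t \<ge> 0"
  show "continuous_on {0..1} (F t)" using F1[OF t] by (rule H1_wderiv)
  fix e :: real assume e: "e > 0"
  have "((\<lambda>s. H1_norm (\<lambda>y. F s y - F t y)) \<longlongrightarrow> 0) (at t within {0..})"
    using F[of "t+1"] t unfolding at_within_atLeastAtMost_extend[OF t, of "t+1", simplified, symmetric]
    by (auto simp: C_time_def)
  then have "\<forall>\<^sub>F s in at t within {0..}. H1_norm (\<lambda>y. F s y - F t y) < e/2"
    using e by (intro order_tendstoD(2)[of _ 0]) auto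
  moreover have "\<forall>\<^sub>F s in at t within {0..}. s \<in> {0..}" by (simp add: eventually_at_filter)
  ultimately show "\<forall>\<^sub>F s in at t within {0..}. \<forall>y\<in>{0..1}. \<bar>F s y - F t y\<bar> < e"
  proof eventually_elim
    case (elim s)
    show ?case
    proof
      fix y :: real assume y: "y \<in> {0..1}"
      have "(\<lambda>y. F s y - F t y) \<in> H1" using elim(2) by (intro H1_diff F1 t) simp
      from H1_sup_bound[OF this y] elim(1) show "\<bar>F s y - F t y\<bar> < e" by linarith
    qed
  qed
qed

lemma Linf_norm_tendsto_0:
  assumes cont: "\<And>t. t \<ge> 0 \<Longrightarrow> continuous_on {0..1} (F t)"
    and unif: "\<And>e. e > 0 \<Longrightarrow> \<forall>\<^sub>F t in at_top. \<forall>y\<in>{0..1}. \<bar>F t y\<bar> \<le> e"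
  shows "((\<lambda>t::real. Linf_norm (F t)) \<longlongrightarrow> 0) at_top"
proof (rule order_tendstoI)
  fix b :: ereal assume "b < 0"
  then show "\<forall>\<^sub>F t in at_top. b < Linf_norm (F t)"
    by (intro always_eventually allI less_le_trans[OF _ Linf_norm_nonneg])
next
  fix b :: ereal assume "0 < b"
  then obtain e :: real where e: "0 < ereal e" "ereal e < b" using ereal_dense2 by blast
  from e(1) have "e > 0" by simp
  from unif[OF this] eventually_ge_at_top[of 0]
  show "\<forall>\<^sub>F t in at_top. Linf_norm (F t) < b"
  proof eventually_elim
    case (elim t)
    have "Linf_norm (F t) \<le> ereal e" by (rule Linf_norm_le[OF cont[OF elim(2)]]) (use elim(1) in blast)
    then show ?case using e(2) by (rule le_less_trans)
  qed
qed

section \<open>Weak derivatives in time\<close>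

lemma borel_measurable_lebesgue_on_AE:
  fixes f g :: "real \<Rightarrow> real"
  assumes f: "f \<in> borel_measurable (lebesgue_on S)" and S: "S \<in> sets lebesgue"
    and AE: "AE x in lebesgue_on S. f x = g x"
  shows "g \<in> borel_measurable (lebesgue_on S)"
proof -
  have "(\<lambda>x. if x \<in> S then f x else 0) \<in> borel_measurable lebesgue"
    using f S by (simp add: borel_measurable_if)
  moreover have "AE x in lebesgue. (if x \<in> S then f x else 0) = (if x \<in> S then g x else 0)"
    using AE S by (auto simp: AE_restrict_space_iff elim: eventually_mono)
  ultimately have "(\<lambda>x. if x \<in> S then g x else 0) \<in> borel_measurable lebesgue"
    by (rule borel_measurable_AE)
  then show ?thesis using S by (simp add: borel_measurable_if)
qed

text \<open>
The weak time derivative tested with \<open>\<psi>\<close> agrees almost everywhere with the continuous function \<open>c\<close>,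
so the du Bois-Reymond lemma in time exhibits the tested quantity as a primitive of \<open>c\<close>. The function
\<open>c\<close> is what the differential equation provides, even where \<open>F'\<close> itself is only square-integrable.
\<close>

lemma weak_time_deriv_imp_deriv:
  assumes F: "L2_continuous_on {0..} F" and \<psi>: "\<psi> \<in> L2"
    and weak: "\<And>T. T > 0 \<Longrightarrow> has_weak_time_deriv T F F'"
    and c: "continuous_on {0..} c"
    and AE: "\<And>T. T > 0 \<Longrightarrow> AE t in lebesgue_on {0..T}. L2_inner (F' t) \<psi> = c t"
    and t: "t \<ge> 0"
  shows "((\<lambda>t. L2_inner (F t) \<psi>) has_real_derivative c t) (at t within {0..})"
proof -
  define T where "T = t + 1"
  have T: "T > 0" "t < T" "t \<in> {0..T}" using t by (auto simp: T_def)
  have cT: "continuous_on {0..T} c" by (rule continuous_on_subset[OF c]) auto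
  have FT: "continuous_on {0..T} (\<lambda>t. L2_inner (F t) \<psi>)"
    by (rule continuous_on_subset[OF continuous_on_L2_inner[OF F L2_continuous_on_const[OF \<psi>]]]) auto
  have AE': "AE t in lebesgue_on {0..T}. c t = L2_inner (F' t) \<psi>" using AE[OF T(1)] by (rule AE_mp) simp
  have ci: "integrable (lebesgue_on {0..T}) c" by (rule continuous_imp_integrable_real[OF cT])
  have F'm: "(\<lambda>t. L2_inner (F' t) \<psi>) \<in> borel_measurable (lebesgue_on {0..T})"
    by (rule borel_measurable_lebesgue_on_AE[OF borel_measurable_integrable[OF ci] _ AE']) simp
  have eq: "L2_inner (F s) \<psi> = L2_inner (F 0) \<psi> + integral {0..s} c" if s: "s \<in> {0..T}" for s
  proof (rule du_Bois_Reymond_continuous[OF T(1) FT ci _ s])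
    fix \<phi> \<phi>' assume tf: "test_function 0 T \<phi> \<phi>'"
    have \<phi>m: "\<phi> \<in> borel_measurable (lebesgue_on {0..T})"
      using continuous_imp_integrable_real[OF test_function_continuous(1)[OF tf]] by (rule borel_measurable_integrable)
    have "(LINT x|lebesgue_on {0..T}. L2_inner (F x) \<psi> * \<phi>' x) = (LINT x|lebesgue_on {0..T}. \<phi>' x * L2_inner (F x) \<psi>)"
      by (simp only: mult.commute)
    also have "\<dots> = - (LINT x|lebesgue_on {0..T}. \<phi> x * L2_inner (F' x) \<psi>)"
      using weak[OF T(1)] tf \<psi> unfolding has_weak_time_deriv_def by blast
    also have "(LINT x|lebesgue_on {0..T}. \<phi> x * L2_inner (F' x) \<psi>) = (LINT x|lebesgue_on {0..T}. c x * \<phi> x)"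
      by (rule integral_cong_AE)
         (use F'm \<phi>m borel_measurable_integrable[OF ci] AE[OF T(1)] in \<open>auto elim: eventually_mono\<close>)
    finally show "(LINT x|lebesgue_on {0..T}. L2_inner (F x) \<psi> * \<phi>' x) = - (LINT x|lebesgue_on {0..T}. c x * \<phi> x)" .
  qed
  have "((\<lambda>s. integral {0..s} c) has_real_derivative c t) (at t within {0..T})"
    using integral_has_vector_derivative[OF cT T(3)] by (simp add: has_real_derivative_iff_has_vector_derivative)
  then have "((\<lambda>s. L2_inner (F 0) \<psi> + integral {0..s} c) has_real_derivative c t) (at t within {0..T})"
    by (auto intro!: derivative_eq_intros)
  then have "((\<lambda>s. L2_inner (F s) \<psi>) has_real_derivative c t) (at t within {0..T})"
    by (rule has_field_derivative_transform_within[OF _ zero_less_one T(3)]) (simp add: eq[symmetric])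
  then show ?thesis unfolding at_within_atLeastAtMost_extend[OF t T(2)] .
qed

text \<open>
Strong measurability supplies simple functions converging in \<open>L\<^sup>2\<close>; their inner products with \<open>\<psi>\<close> are
simple scalar functions converging almost everywhere.
\<close>

lemma L2_time_inner_measurable:
  assumes F: "F \<in> L2_time T L2 L2_norm" and \<psi>: "\<psi> \<in> L2"
  shows "(\<lambda>t. L2_inner (F t) \<psi>) \<in> borel_measurable (lebesgue_on {0..T})"
proof -
  let ?M = "lebesgue_on {0..T}"
  obtain S :: "nat \<Rightarrow> real \<Rightarrow> real \<Rightarrow> real" where
    S: "\<And>n. simple_function ?M (S n)" "\<And>n t. t \<in> {0..T} \<Longrightarrow> S n t \<in> L2"
    and lim: "AE t in ?M. (\<lambda>n. L2_norm (\<lambda>y. F t y - S n t y)) \<longlonglongrightarrow> 0"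
    using F unfolding L2_time_def strongly_measurable_def by blast
  have FL2: "AE t in ?M. F t \<in> L2" using F by (simp add: L2_time_def)
  have Sm: "(\<lambda>t. L2_inner (S n t) \<psi>) \<in> borel_measurable ?M" for n
    using simple_function_compose1[OF S(1), of "\<lambda>v. L2_inner v \<psi>" n] by (rule borel_measurable_simple_function)
  have mlim: "(\<lambda>t. lim (\<lambda>n. L2_inner (S n t) \<psi>)) \<in> borel_measurable ?M"
    by (rule borel_measurable_lim_metric) (rule Sm)
  have "AE t in ?M. lim (\<lambda>n. L2_inner (S n t) \<psi>) = L2_inner (F t) \<psi>"
    using lim FL2 AE_space
  proof eventually_elim
    case (elim t)
    have t: "t \<in> {0..T}" using elim by simp
    have "(\<lambda>n. L2_norm (\<lambda>y. S n t y - F t y)) \<longlonglongrightarrow> 0"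
    proof -
      have "L2_norm (\<lambda>y. S n t y - F t y) = L2_norm (\<lambda>y. F t y - S n t y)" for n
        using L2_norm_cmult[of "-1" "\<lambda>y. F t y - S n t y"] by simp
      then show ?thesis using elim(1) by simp
    qed
    then have "(\<lambda>n. L2_inner (S n t) \<psi>) \<longlonglongrightarrow> L2_inner (F t) \<psi>"
      using S(2)[OF t] elim(2) \<psi> by (intro L2_inner_tendsto) (auto simp: L2_norm_def)
    then show ?case by (rule limI)
  qed
  from borel_measurable_lebesgue_on_AE[OF mlim _ this] show ?thesis by simp
qed

text \<open>
The increment is tested with itself, \<open>\<parallel>F(t) - F(s)\<parallel>\<^sup>2 = \<integral> \<langle>F'(r), F(t) - F(s)\<rangle> dr\<close>, and Young's
inequality with the weight \<open>t - s\<close> absorbs half of the left-hand side.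
\<close>

lemma Cauchy_Schwarz_time_increment:
  assumes F: "L2_continuous_on {0..T} F" and T: "T > 0"
    and weak: "has_weak_time_deriv T F F'" and F': "F' \<in> L2_time T L2 L2_norm"
    and st: "0 \<le> s" "s \<le> t" "t \<le> T"
  shows "L2_inner (\<lambda>y. F t y - F s y) (\<lambda>y. F t y - F s y) \<le> (t - s) * integral {s..t} (\<lambda>r. (L2_norm (F' r))\<^sup>2)"
proof (cases "s = t")
  case True
  then show ?thesis by (simp add: L2_inner_def)
next
  case False
  let ?M = "lebesgue_on {0..T}"
  define \<psi> where "\<psi> = (\<lambda>y. F t y - F s y)"
  define q where "q = L2_inner \<psi> \<psi>"
  define h where "h = t - s"
  have h: "h > 0" using st False by (simp add: h_def)
  have FL2: "F r \<in> L2" if "r \<in> {0..T}" for r using F that by (simp add: L2_continuous_on_def)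
  have \<psi>: "\<psi> \<in> L2" unfolding \<psi>_def using st by (intro L2_diff FL2) auto
  have N: "integrable ?M (\<lambda>r. (L2_norm (F' r))\<^sup>2)" and F'L2: "AE r in ?M. F' r \<in> L2"
    using F' by (auto simp: L2_time_def)
  let ?b = "\<lambda>r. h / 2 * (L2_norm (F' r))\<^sup>2 + q / (2 * h)"
  have bi: "integrable ?M ?b"
    using N by (intro Bochner_Integration.integrable_add integrable_mult_right finite_measure.integrable_const
        finite_measure_lebesgue_on) auto
  have bound: "AE r in ?M. \<bar>L2_inner (F' r) \<psi>\<bar> \<le> ?b r"
    using F'L2
  proof eventually_elim
    case (elim r)
    have "2 * L2_inner (F' r) \<psi> \<le> h * L2_inner (F' r) (F' r) + q / h"
      unfolding q_def by (rule L2_Young[OF elim \<psi> h])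
    moreover have "2 * L2_inner (\<lambda>y. - F' r y) \<psi> \<le> h * L2_inner (\<lambda>y. - F' r y) (\<lambda>y. - F' r y) + q / h"
      unfolding q_def by (rule L2_Young[OF L2_uminus[OF elim] \<psi> h])
    moreover have "L2_inner (\<lambda>y. - F' r y) z = - L2_inner (F' r) z" for z
      by (simp add: L2_inner_def)
    moreover have "L2_inner (F' r) (\<lambda>y. - F' r y) = - L2_inner (F' r) (F' r)"
      by (simp add: L2_inner_def)
    ultimately show ?case by (simp add: L2_norm_square abs_le_iff field_simps)
  qed
  have gi: "integrable ?M (\<lambda>r. L2_inner (F' r) \<psi>)"
    by (rule Bochner_Integration.integrable_bound[OF bi L2_time_inner_measurable[OF F' \<psi>]])
       (use bound in \<open>auto elim: eventually_mono\<close>)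
  have FT: "continuous_on {0..T} (\<lambda>t. L2_inner (F t) \<psi>)"
    by (rule continuous_on_L2_inner[OF F L2_continuous_on_const[OF \<psi>]])
  have eq: "L2_inner (F r) \<psi> = L2_inner (F 0) \<psi> + integral {0..r} (\<lambda>r. L2_inner (F' r) \<psi>)" if r: "r \<in> {0..T}" for r
  proof (rule du_Bois_Reymond_continuous[OF T FT gi _ r])
    fix \<phi> \<phi>' assume tf: "test_function 0 T \<phi> \<phi>'"
    show "(LINT x|?M. L2_inner (F x) \<psi> * \<phi>' x) = - (LINT x|?M. L2_inner (F' x) \<psi> * \<phi> x)"
      using weak tf \<psi> unfolding has_weak_time_deriv_def by (simp add: mult.commute)
  qed
  have sub: "w integrable_on {s..t}" "w integrable_on {0..t}" if "integrable ?M w" for w :: "real \<Rightarrow> real"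
    using integrable_on_lebesgue_on[OF that] st by (auto elim!: integrable_on_subinterval)
  have "q = L2_inner (F t) \<psi> - L2_inner (F s) \<psi>"
    unfolding q_def using st by (subst (1) \<psi>_def) (intro L2_inner_diff_left FL2 \<psi>, auto)
  also have "\<dots> = integral {s..t} (\<lambda>r. L2_inner (F' r) \<psi>)"
    using eq[of s] eq[of t] st
      Henstock_Kurzweil_Integration.integral_combine[OF st(1,2) sub(2)[OF gi]] by simp
  also have "\<dots> \<le> integral {s..t} ?b"
  proof -
    have "AE r in lebesgue_on {s..t}. \<bar>L2_inner (F' r) \<psi>\<bar> \<le> ?b r"
      using bound st by (auto simp: AE_restrict_space_iff elim: eventually_mono)
    moreover have "integrable (lebesgue_on {s..t}) ?b" "integrable (lebesgue_on {s..t}) (\<lambda>r. L2_inner (F' r) \<psi>)"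
      using integrable_subinterval[OF bi] integrable_subinterval[OF gi] st by auto
    ultimately have "(LINT r|lebesgue_on {s..t}. L2_inner (F' r) \<psi>) \<le> (LINT r|lebesgue_on {s..t}. ?b r)"
      by (intro integral_mono_AE) (auto elim: eventually_mono)
    then show ?thesis
      using lebesgue_integral_eq_integral[OF \<open>integrable (lebesgue_on {s..t}) ?b\<close>]
        lebesgue_integral_eq_integral[OF \<open>integrable (lebesgue_on {s..t}) (\<lambda>r. L2_inner (F' r) \<psi>)\<close>] by simp
  qed
  also have "\<dots> = h / 2 * integral {s..t} (\<lambda>r. (L2_norm (F' r))\<^sup>2) + integral {s..t} (\<lambda>r. q / (2 * h))"
    using integrable_on_cmult_left[OF sub(1)[OF N], of "h / 2"]
    by (subst Henstock_Kurzweil_Integration.integral_add) auto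
  also have "integral {s..t} (\<lambda>r. q / (2 * h)) = q / 2"
  proof -
    have "integral {s..t} (\<lambda>r. q / (2 * h)) = h * (q / (2 * h))" using st by (simp add: h_def)
    then show ?thesis using h by simp
  qed
  finally show ?thesis by (simp add: q_def h_def \<psi>_def)
qed

section \<open>Differential inequalities on the half-line\<close>

lemma mean_value_Ici:
  assumes der: "\<And>t. t \<ge> 0 \<Longrightarrow> (f has_real_derivative f' t) (at t within {0..})"
    and st: "0 \<le> s" "s < t"
  shows "\<exists>r. s < r \<and> r < t \<and> f t - f s = (t - s) * f' r"
proof -
  have "continuous_on {s..t} f"
    using der st by (intro DERIV_continuous_on[where D=f'] DERIV_subset[OF der]) auto
  moreover have "(f has_derivative (\<lambda>h. h * f' r)) (at r)" if "s < r" "r < t" for r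
  proof -
    have "at r within {0..} = at r" using that st by (intro at_within_interior) auto
    then show ?thesis using der[of r] that st by (simp add: has_field_derivative_def mult_commute_abs)
  qed
  ultimately show ?thesis using mvt[OF st(2), of f "\<lambda>r h. h * f' r"] by (auto simp: mult.commute)
qed

lemma nonpos_deriv_imp_antimono:
  assumes der: "\<And>t. t \<ge> 0 \<Longrightarrow> (f has_real_derivative f' t) (at t within {0..})"
    and neg: "\<And>r. s < r \<Longrightarrow> r < t \<Longrightarrow> f' r \<le> 0" and st: "0 \<le> s" "s \<le> t"
  shows "f t \<le> f s"
proof (cases "s = t")
  case False
  then obtain r where "s < r" "r < t" "f t - f s = (t - s) * f' r"
    using mean_value_Ici[OF der st(1)] st(2) by (metis order_le_less)
  then show ?thesis using neg[of r] st mult_nonneg_nonpos[of "t - s" "f' r"] by simp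
qed simp

text \<open>
At the last time before \<open>t\<close> at which \<open>x \<le> Q\<close>, the function would have to increase while it lies
above \<open>Q\<close>.
\<close>

lemma barrier:
  assumes der: "\<And>t. t \<ge> 0 \<Longrightarrow> (x has_real_derivative x' t) (at t within {0..})"
    and S: "0 \<le> S" "x S \<le> Q" and out: "\<And>t. t \<ge> S \<Longrightarrow> x t > Q \<Longrightarrow> x' t \<le> 0" and t: "t \<ge> S"
  shows "x t \<le> Q"
proof (rule ccontr)
  assume "\<not> x t \<le> Q"
  then have xt: "x t > Q" by simp
  define A where "A = {r \<in> {S..t}. x r \<le> Q}"
  have cont: "continuous_on {S..t} x"
    using S by (intro DERIV_continuous_on[where D=x'] DERIV_subset[OF der]) auto
  have "A = {S..t} \<inter> x -` {..Q}" by (auto simp: A_def)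
  then have "closed A"
    using continuous_closed_preimage[OF cont closed_atLeastAtMost closed_atMost] by simp
  moreover have "S \<in> A" using S t by (simp add: A_def)
  moreover have bdd: "bdd_above A" by (rule bdd_aboveI[of _ t]) (simp add: A_def)
  ultimately have "Sup A \<in> A" by (intro closed_contains_Sup) auto
  then have s: "S \<le> Sup A" "Sup A \<le> t" "x (Sup A) \<le> Q" by (auto simp: A_def)
  have "x' r \<le> 0" if "Sup A < r" "r < t" for r
  proof (rule out)
    have "r \<notin> A" using that(1) cSup_upper[OF _ bdd, of r] by linarith
    then show "x r > Q" using that s by (simp add: A_def)
    show "S \<le> r" using that s by linarith
  qed
  then have "x t \<le> x (Sup A)" using S s by (intro nonpos_deriv_imp_antimono[OF der]) simp_all
  then show False using s(3) xt by linarith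
qed

text \<open>
The barrier lemma applies to \<open>(x - Q) exp (p0 (t - S))\<close>: while this is positive, \<open>x\<close> exceeds its
target \<open>q\<close> and relaxes at a rate at least \<open>p0\<close>.
\<close>

lemma relaxation_upper_bound:
  assumes der: "\<And>t. t \<ge> 0 \<Longrightarrow> (x has_real_derivative - p t * (x t - q t)) (at t within {0..})"
    and S: "0 \<le> S" and p: "\<And>t. t \<ge> S \<Longrightarrow> p0 \<le> p t" "0 \<le> p0" and q: "\<And>t. t \<ge> S \<Longrightarrow> q t \<le> Q"
    and t: "t \<ge> S"
  shows "x t \<le> Q + max 0 (x S - Q) * exp (- p0 * (t - S))"
proof -
  let ?z = "\<lambda>t. (x t - Q) * exp (p0 * (t - S))"
  have "?z t \<le> max 0 (x S - Q)"
  proof (rule barrier[where x' = "\<lambda>t. (- p t * (x t - q t) + p0 * (x t - Q)) * exp (p0 * (t - S))", OF _ S _ _ t])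
    show "((\<lambda>t. ?z t) has_real_derivative (- p t * (x t - q t) + p0 * (x t - Q)) * exp (p0 * (t - S))) (at t within {0..})"
      if "t \<ge> 0" for t
      using der[OF that] by (auto intro!: derivative_eq_intros simp: algebra_simps)
    show "?z S \<le> max 0 (x S - Q)" by simp
    show "(- p t * (x t - q t) + p0 * (x t - Q)) * exp (p0 * (t - S)) \<le> 0"
      if t: "t \<ge> S" and z: "?z t > max 0 (x S - Q)" for t
    proof -
      have "?z t > 0" using z by simp
      then have pos: "x t - Q > 0" by (simp add: zero_less_mult_iff)
      have "p0 * (x t - Q) \<le> p t * (x t - Q)" using p(1)[OF t] pos by simp
      also have "\<dots> \<le> p t * (x t - q t)" using p(1)[OF t] p(2) q[OF t] by (intro mult_left_mono) auto
      finally have "- p t * (x t - q t) + p0 * (x t - Q) \<le> 0" by simp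
      then show ?thesis by (simp add: mult_nonpos_nonneg)
    qed
  qed
  then have "?z t * exp (- p0 * (t - S)) \<le> max 0 (x S - Q) * exp (- p0 * (t - S))"
    by (rule mult_right_mono) simp
  moreover have "?z t * exp (- p0 * (t - S)) = x t - Q"
    by (simp add: mult.assoc flip: exp_add)
  ultimately show ?thesis by linarith
qed

lemma relaxation_lower_bound:
  assumes der: "\<And>t. t \<ge> 0 \<Longrightarrow> (x has_real_derivative - p t * (x t - q t)) (at t within {0..})"
    and S: "0 \<le> S" and p: "\<And>t. t \<ge> S \<Longrightarrow> p0 \<le> p t" "0 \<le> p0" and q: "\<And>t. t \<ge> S \<Longrightarrow> Q \<le> q t"
    and t: "t \<ge> S"
  shows "Q - max 0 (Q - x S) * exp (- p0 * (t - S)) \<le> x t"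
proof -
  have "- x t \<le> - Q + max 0 (- x S - - Q) * exp (- p0 * (t - S))"
  proof (rule relaxation_upper_bound[where x = "\<lambda>t. - x t" and q = "\<lambda>t. - q t" and p = p, OF _ S p _ t])
    show "((\<lambda>t. - x t) has_real_derivative - p t * (- x t - - q t)) (at t within {0..})" if "t \<ge> 0" for t
      using DERIV_minus[OF der[OF that]] by (simp add: algebra_simps)
  qed (use q in auto)
  then show ?thesis by (simp add: add.commute)
qed

lemma nonneg_antimono_converges:
  fixes w :: "real \<Rightarrow> real"
  assumes anti: "\<And>s t. 0 \<le> s \<Longrightarrow> s \<le> t \<Longrightarrow> w t \<le> w s" and nonneg: "\<And>t. t \<ge> 0 \<Longrightarrow> 0 \<le> w t"
  obtains l where "l \<ge> 0" "(w \<longlongrightarrow> l) at_top" "\<And>t. t \<ge> 0 \<Longrightarrow> l \<le> w t"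
proof -
  define l where "l = Inf (w ` {0..})"
  have bdd: "bdd_below (w ` {0..})" using nonneg by (intro bdd_belowI[of _ 0]) auto
  have le: "l \<le> w t" if "t \<ge> 0" for t
    unfolding l_def using that by (intro cInf_lower bdd) auto
  have "(w \<longlongrightarrow> l) at_top"
  proof (rule tendstoI)
    fix e :: real assume e: "e > 0"
    then obtain s where s: "s \<ge> 0" "w s < l + e"
      using cInf_lessD[of "w ` {0..}" "l + e"] by (auto simp: l_def)
    have "dist (w t) l < e" if "t \<ge> s" for t
      using anti[OF s(1) that] s le[of t] that by (simp add: dist_real_def)
    then show "\<forall>\<^sub>F t in at_top. dist (w t) l < e" using eventually_at_top_linorder by blast
  qed
  moreover have "l \<ge> 0" unfolding l_def using nonneg by (intro cInf_greatest) auto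
  ultimately show ?thesis using that le by blast
qed

text \<open>
Both \<open>V\<close> and \<open>h + V\<close> are nonincreasing and nonnegative, hence converge, and so does \<open>h\<close>. A positive
limit of \<open>h\<close> would make \<open>h + V\<close> decrease at least linearly. The function \<open>V\<close> pays for forcing terms
that are integrable in time without a pointwise bound.
\<close>

lemma Lyapunov_tendsto_0:
  assumes h: "\<And>t. t \<ge> 0 \<Longrightarrow> (h has_real_derivative h' t) (at t within {0..})" "\<And>t. t \<ge> 0 \<Longrightarrow> 0 \<le> h t"
    and V: "\<And>t. t \<ge> 0 \<Longrightarrow> (V has_real_derivative V' t) (at t within {0..})" "\<And>t. t \<ge> 0 \<Longrightarrow> 0 \<le> V t"
      "\<And>t. t \<ge> 0 \<Longrightarrow> V' t \<le> 0"
    and c: "c > 0" and hV: "\<And>t. t \<ge> 0 \<Longrightarrow> h' t + V' t \<le> - c * h t"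
  shows "(h \<longlongrightarrow> 0) at_top"
proof -
  have lim: "\<exists>l. (w \<longlongrightarrow> l) at_top"
    if w: "\<And>t. t \<ge> 0 \<Longrightarrow> (w has_real_derivative w' t) (at t within {0..})" "\<And>t. t \<ge> 0 \<Longrightarrow> 0 \<le> w t"
      "\<And>t. t \<ge> 0 \<Longrightarrow> w' t \<le> 0" for w w' :: "real \<Rightarrow> real"
  proof (rule nonneg_antimono_converges[of w])
    show "w t \<le> w s" if "0 \<le> s" "s \<le> t" for s t
      by (rule nonpos_deriv_imp_antimono[OF w(1) w(3)]) (use that in auto)
  qed (use w(2) in blast)+
  have "\<exists>l. (V \<longlongrightarrow> l) at_top" by (rule lim[OF V])
  then obtain lV where lV: "(V \<longlongrightarrow> lV) at_top" ..
  have dhV: "((\<lambda>t. h t + V t) has_real_derivative h' t + V' t) (at t within {0..})" if "t \<ge> 0" for t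
    using h(1)[OF that] V(1)[OF that] by (rule DERIV_add)
  have neg: "h' t + V' t \<le> 0" if "t \<ge> 0" for t
    using hV[OF that] mult_nonneg_nonneg[OF less_imp_le[OF c] h(2)[OF that]] by linarith
  have "\<exists>l. ((\<lambda>t. h t + V t) \<longlongrightarrow> l) at_top"
    by (rule lim[OF dhV]) (simp_all add: neg h(2) V(2))
  then obtain lh where lh: "((\<lambda>t. h t + V t) \<longlongrightarrow> lh) at_top" ..
  define l where "l = lh - lV"
  have hl: "(h \<longlongrightarrow> l) at_top" using tendsto_diff[OF lh lV] by (simp add: l_def)
  have "l \<ge> 0"
    by (rule tendsto_lowerbound[OF hl eventually_mono[OF eventually_ge_at_top[of 0] h(2)] trivial_limit_at_top_linorder])
  moreover have False if "l > 0"
  proof -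
    have "\<forall>\<^sub>F t in at_top. h t > l/2" using that by (intro order_tendstoD(1)[OF hl]) auto
    then obtain S0 where S0: "\<And>t. t \<ge> S0 \<Longrightarrow> h t > l/2" unfolding eventually_at_top_linorder by blast
    define S where "S = max 0 S0"
    define T where "T = S + (h S + V S + 1) / (c * l / 2)"
    have S: "S \<ge> 0" "\<And>t. t \<ge> S \<Longrightarrow> h t > l/2" using S0 by (auto simp: S_def)
    have "(h S + V S + 1) / (c * l / 2) > 0" using h(2)[OF S(1)] V(2)[OF S(1)] c that by simp
    then have T: "S < T" by (simp add: T_def)
    obtain r where r: "S < r" "r < T" "(h T + V T) - (h S + V S) = (T - S) * (h' r + V' r)"
      using mean_value_Ici[OF dhV S(1) T] by auto
    have "h' r + V' r \<le> - c * h r" using hV r S by auto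
    also have "\<dots> \<le> - (c * l / 2)" using S(2)[of r] r c by (simp add: field_simps)
    finally have "(T - S) * (h' r + V' r) \<le> (T - S) * (- (c * l / 2))" using T by (intro mult_left_mono) auto
    also have "\<dots> = - (h S + V S + 1)" using c that by (simp add: T_def field_simps)
    finally have "h T + V T \<le> -1" using r by linarith
    then show False using h(2)[of T] V(2)[of T] S T by auto
  qed
  ultimately have "l = 0" by force
  then show ?thesis using hl by simp
qed

lemma linear_ODE_solution:
  assumes der: "\<And>t. t \<ge> 0 \<Longrightarrow> (x has_real_derivative x t * b t) (at t within {0..})"
    and b: "continuous_on {0..} b" and t: "t \<ge> 0"
  shows "x t = x 0 * exp (integral {0..t} b)"
proof -
  let ?B = "\<lambda>t. integral {0..t} b"
  have B: "(?B has_real_derivative b t) (at t within {0..})" if "t \<ge> 0" for t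
  proof -
    have "(?B has_real_derivative b t) (at t within {0..t+1})"
      using integral_has_vector_derivative[OF continuous_on_subset[OF b], of 0 "t+1" t] that
      by (simp add: has_real_derivative_iff_has_vector_derivative)
    then show ?thesis using at_within_atLeastAtMost_extend[of t "t+1"] that by simp
  qed
  define z where "z = (\<lambda>t. x t * exp (- ?B t))"
  have d: "(z has_real_derivative 0) (at t within {0..})" if "t \<ge> 0" for t
  proof -
    have e: "((\<lambda>t. exp (- ?B t)) has_real_derivative exp (- ?B t) * - b t) (at t within {0..})"
      using B[OF that] by (auto intro!: derivative_eq_intros)
    have "(z has_real_derivative x t * b t * exp (- ?B t) + exp (- ?B t) * - b t * x t) (at t within {0..})"
      unfolding z_def by (rule DERIV_mult[OF der[OF that] e])
    then show ?thesis by (simp add: algebra_simps)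
  qed
  have "z t = z 0"
  proof (cases "t = 0")
    case False
    then have "0 < t" using t by simp
    from mean_value_Ici[of z "\<lambda>_. 0", OF d order_refl this]
    show ?thesis by auto
  qed simp
  then have "z t * exp (?B t) = x 0 * exp (?B t)" by (simp add: z_def)
  moreover have "z t * exp (?B t) = x t" by (simp add: z_def mult.assoc flip: exp_add)
  ultimately show ?thesis by simp
qed

lemma exp_decay:
  fixes c R :: real
  assumes "c > 0"
  shows "((\<lambda>t. exp (- c * (t - R))) \<longlongrightarrow> 0) at_top"
proof -
  have "filterlim (\<lambda>t. - R + t) at_top at_top"
    by (rule filterlim_tendsto_add_at_top[OF tendsto_const filterlim_ident])
  then have "filterlim (\<lambda>t. c * (- R + t)) at_top at_top"
    by (intro filterlim_tendsto_pos_mult_at_top[OF tendsto_const assms])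
  then have "filterlim (\<lambda>t. - (c * (t - R))) at_bot at_top"
    by (simp add: filterlim_uminus_at_top)
  then show ?thesis using filterlim_compose[OF exp_at_bot] by simp
qed

lemma DERIV_reciprocal:
  fixes h :: "real \<Rightarrow> real"
  assumes "(h has_real_derivative d) (at t within A)" "h t \<noteq> 0"
  shows "((\<lambda>t. 1 / h t) has_real_derivative - (d / (h t)\<^sup>2)) (at t within A)"
  using assms by (auto intro!: derivative_eq_intros simp: power2_eq_square)

lemma DERIV_shift_Ici:
  fixes \<phi> :: "real \<Rightarrow> real"
  assumes "(\<phi> has_real_derivative d) (at (h + t) within {0..})" "h \<ge> 0"
  shows "((\<lambda>t. \<phi> (h + t)) has_real_derivative d) (at t within {0..})"
proof -
  have "(+) h ` {0..} \<subseteq> {0..}" using assms(2) by auto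
  then have "(\<phi> has_real_derivative d) (at (h + t) within (+) h ` {0..})"
    by (rule DERIV_subset[OF assms(1)])
  then show ?thesis by (simp only: DERIV_at_within_shift)
qed

text \<open>
The \<open>n\<close> increments add up to \<open>g 1 - g 0\<close>. This stands in for a point at which a monotone \<open>g\<close> has a
difference quotient bounded independently of the step.
\<close>

lemma pigeonhole_increment:
  fixes g :: "real \<Rightarrow> real"
  assumes n: "n > 0"
  obtains j where "j < n" "g (real (Suc j) / real n) - g (real j / real n) \<le> (g 1 - g 0) / real n"
proof -
  have "\<exists>j<n. g (real (Suc j) / real n) - g (real j / real n) \<le> (g 1 - g 0) / real n"
  proof (rule ccontr)
    assume "\<not> ?thesis"
    then have *: "\<And>j. j \<in> {..<n} \<Longrightarrow> (g 1 - g 0) / real n < g (real (Suc j) / real n) - g (real j / real n)"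
      by force
    have "(\<Sum>j<n. (g 1 - g 0) / real n) < (\<Sum>j<n. g (real (Suc j) / real n) - g (real j / real n))"
      using n by (intro sum_strict_mono *) auto
    also have "\<dots> = g 1 - g 0"
      using sum_lessThan_telescope[of "\<lambda>j. g (real j / real n)" n] n by simp
    finally show False using n by simp
  qed
  then show ?thesis using that by blast
qed

section \<open>From tested equations to energies and pointwise equations\<close>

text \<open>
The increment \<open>\<parallel>v(t)\<parallel>\<^sup>2 - \<parallel>v(s)\<parallel>\<^sup>2 = \<langle>v(t) - v(s), v(s) + v(t)\<rangle>\<close> is an increment of \<open>v\<close> tested with
the fixed profile \<open>v(s) + v(t)\<close>. The mean value theorem evaluates it at an intermediate time, and
continuity of \<open>V\<close> and \<open>W\<close> gives the limit. The pair \<open>V\<close>, \<open>W\<close> replaces a time derivative of \<open>v\<close> in \<open>L\<^sup>2\<close>: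
for the velocity, \<open>V\<close> is its gradient and \<open>W\<close> a multiple of the total stress.
\<close>

lemma L2_energy_identity:
  assumes v: "\<And>t. t \<ge> 0 \<Longrightarrow> v t \<in> L2"
    and V: "L2_continuous_on {0..} V" and W: "L2_continuous_on {0..} W"
    and der: "\<And>t s0 s1. t \<ge> 0 \<Longrightarrow> s0 \<ge> 0 \<Longrightarrow> s1 \<ge> 0 \<Longrightarrow>
      ((\<lambda>t. L2_inner (v t) (\<lambda>y. v s0 y + v s1 y)) has_real_derivative
        L2_inner (W t) (\<lambda>y. V s0 y + V s1 y)) (at t within {0..})"
    and t: "t \<ge> 0"
  shows "((\<lambda>t. L2_inner (v t) (v t)) has_real_derivative 2 * L2_inner (W t) (V t)) (at t within {0..})"
proof -
  let ?q = "\<lambda>t. L2_inner (v t) (v t)"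
  have q: "?q s - ?q t = L2_inner (v s) (\<lambda>y. v s y + v t y) - L2_inner (v t) (\<lambda>y. v s y + v t y)"
    if "s \<ge> 0" for s
    using v[OF that] v[OF t] by (simp add: L2_inner_add_right L2_inner_commute[of "v s" "v t"])
  have "\<exists>r\<ge>0. \<bar>r - t\<bar> \<le> \<bar>s - t\<bar> \<and> ?q s - ?q t = (s - t) * L2_inner (W r) (\<lambda>y. V s y + V t y)"
    if s: "s \<ge> 0" for s
  proof -
    consider "s = t" | "s < t" | "t < s" by linarith
    then show ?thesis
    proof cases
      case 1
      then show ?thesis using t by auto
    next
      case 2
      obtain r where "s < r" "r < t"
        "L2_inner (v t) (\<lambda>y. v s y + v t y) - L2_inner (v s) (\<lambda>y. v s y + v t y) = (t - s) * L2_inner (W r) (\<lambda>y. V s y + V t y)"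
        using mean_value_Ici[OF der[OF _ s t] s 2] by auto
      then show ?thesis using q[OF s] s by (intro exI[of _ r]) (auto simp: algebra_simps)
    next
      case 3
      obtain r where "t < r" "r < s"
        "L2_inner (v s) (\<lambda>y. v s y + v t y) - L2_inner (v t) (\<lambda>y. v s y + v t y) = (s - t) * L2_inner (W r) (\<lambda>y. V s y + V t y)"
        using mean_value_Ici[OF der[OF _ s t] t 3] by auto
      then show ?thesis using q[OF s] t by (intro exI[of _ r]) auto
    qed
  qed
  then obtain R where R: "\<And>s. s \<ge> 0 \<Longrightarrow> R s \<ge> 0" "\<And>s. s \<ge> 0 \<Longrightarrow> \<bar>R s - t\<bar> \<le> \<bar>s - t\<bar>"
    "\<And>s. s \<ge> 0 \<Longrightarrow> ?q s - ?q t = (s - t) * L2_inner (W (R s)) (\<lambda>y. V s y + V t y)"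
    by metis
  let ?A = "at t within {0..}"
  have ev: "\<forall>\<^sub>F s in ?A. s \<ge> 0" "\<forall>\<^sub>F s in ?A. s \<noteq> t" by (auto simp: eventually_at_filter)
  have Rt: "(R \<longlongrightarrow> t) ?A"
  proof -
    have "((\<lambda>s. R s - t) \<longlongrightarrow> 0) ?A"
    proof (rule Lim_null_comparison)
      show "\<forall>\<^sub>F s in ?A. norm (R s - t) \<le> \<bar>s - t\<bar>" using ev(1) by eventually_elim (simp add: R(2))
      have "((\<lambda>s. \<bar>s - t\<bar>) \<longlongrightarrow> \<bar>t - t\<bar>) ?A" by (intro tendsto_intros)
      then show "((\<lambda>s. \<bar>s - t\<bar>) \<longlongrightarrow> 0) ?A" by simp
    qed
    then show ?thesis by (rule LIM_zero_cancel)
  qed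
  have W0: "((\<lambda>s. L2_norm (\<lambda>y. W s y - W t y)) \<longlongrightarrow> 0) ?A"
    and V0: "((\<lambda>s. L2_norm (\<lambda>y. V s y - V t y)) \<longlongrightarrow> 0) ?A"
    using V W t by (auto simp: L2_continuous_on_def)
  have VL2: "V s \<in> L2" and WL2: "W s \<in> L2" if "s \<ge> 0" for s
    using V W that by (auto simp: L2_continuous_on_def)
  have "((\<lambda>s. L2_inner (W (R s)) (\<lambda>y. V s y + V t y)) \<longlongrightarrow> L2_inner (W t) (\<lambda>y. V t y + V t y)) ?A"
  proof (rule L2_inner_tendsto)
    show "\<forall>\<^sub>F s in ?A. W (R s) \<in> L2" using ev(1) by eventually_elim (simp add: R(1) WL2)
    show "\<forall>\<^sub>F s in ?A. (\<lambda>y. V s y + V t y) \<in> L2" using ev(1) by eventually_elim (intro L2_add VL2 t)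
    have c: "continuous ?A (\<lambda>s. L2_norm (\<lambda>y. W s y - W t y))"
      using W0 by (simp add: continuous_within L2_norm_def)
    show "((\<lambda>s. L2_norm (\<lambda>y. W (R s) y - W t y)) \<longlongrightarrow> 0) ?A"
    proof (rule tendstoI)
      fix e :: real assume "e > 0"
      then obtain d where d: "d > 0" "\<And>r. r \<ge> 0 \<Longrightarrow> \<bar>r - t\<bar> < d \<Longrightarrow> L2_norm (\<lambda>y. W r y - W t y) < e"
        using c unfolding continuous_within_eps_delta by (force simp: dist_real_def L2_norm_def)
      have "\<forall>\<^sub>F s in ?A. dist (R s) t < d" using Rt d(1) by (rule tendstoD)
      then show "\<forall>\<^sub>F s in ?A. dist (L2_norm (\<lambda>y. W (R s) y - W t y)) 0 < e"
        using ev(1) by eventually_elim (simp add: dist_real_def d(2) R(1))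
    qed
    show "((\<lambda>s. L2_norm (\<lambda>y. V s y + V t y - (V t y + V t y))) \<longlongrightarrow> 0) ?A"
      using V0 by (simp add: algebra_simps)
  qed (auto intro: VL2 WL2 t)
  moreover have "L2_inner (W t) (\<lambda>y. V t y + V t y) = 2 * L2_inner (W t) (V t)"
    using VL2[OF t] WL2[OF t] by (simp add: L2_inner_cmult_right)
  moreover have "\<forall>\<^sub>F s in ?A. L2_inner (W (R s)) (\<lambda>y. V s y + V t y) = (?q s - ?q t) / (s - t)"
    using ev by eventually_elim (simp add: R(3))
  ultimately have "((\<lambda>s. (?q s - ?q t) / (s - t)) \<longlongrightarrow> 2 * L2_inner (W t) (V t)) ?A"
    by (simp add: filterlim_cong[OF refl refl])
  then show ?thesis by (simp add: has_field_derivative_iff)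
qed

lemma L2_inner_continuous_eq_integral:
  assumes "continuous_on {0..1} v" "continuous_on {0..1} w"
  shows "L2_inner v w = integral {0..1} (\<lambda>y. v y * w y)"
  unfolding L2_inner_def
  by (intro lebesgue_integral_eq_integral continuous_imp_integrable_real continuous_intros assms) simp

text \<open>
The defect \<open>Q\<close> of the integrated equation over \<open>[0,T]\<close> is a continuous profile. Testing the equation
with \<open>Q\<close> itself and exchanging the integrals gives \<open>\<parallel>Q\<parallel> = 0\<close>.
\<close>

lemma weak_ODE_imp_pointwise:
  assumes F: "continuous_on ({0..} \<times> {0..1}) (\<lambda>(t,y). F t y)"
    and R: "continuous_on ({0..} \<times> {0..1}) (\<lambda>(t,y). R t y)"
    and der: "\<And>\<psi> t. \<psi> \<in> L2 \<Longrightarrow> t \<ge> 0 \<Longrightarrow>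
      ((\<lambda>t. L2_inner (F t) \<psi>) has_real_derivative L2_inner (R t) \<psi>) (at t within {0..})"
    and y: "y \<in> {0..1}" and t: "t \<ge> 0"
  shows "((\<lambda>t. F t y) has_real_derivative R t y) (at t within {0..})"
proof -
  note Fc = joint_continuous_slice[OF F] and Rc = joint_continuous_slice[OF R]
  have eq: "F T y - F 0 y - integral {0..T} (\<lambda>r. R r y) = 0" if T: "T \<ge> 0" and y: "y \<in> {0..1}" for T y
  proof -
    define H where "H = (\<lambda>y. integral {0..T} (\<lambda>r. R r y))"
    define Q where "Q = (\<lambda>y. F T y - F 0 y - H y)"
    have R': "continuous_on (cbox (0,0) (T,1)) (\<lambda>(r,y). R r y)"
      by (rule continuous_on_subset[OF R]) (auto simp: cbox_Pair_eq)
    have swapped: "continuous_on ({0..1} \<times> {0..T}) (\<lambda>(y,r). R r y)"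
    proof -
      have "continuous_on ({0..1} \<times> {0..T}) (\<lambda>p. (\<lambda>(r,y). R r y) (snd p, fst p))"
        by (rule continuous_on_compose2[OF R]) (auto intro!: continuous_intros)
      then show ?thesis by (simp add: case_prod_unfold)
    qed
    have Hc: "continuous_on {0..1} H"
      unfolding H_def using integral_continuous_on_param[of "{0..1}" 0 T "\<lambda>y r. R r y"] swapped by simp
    have Qc: "continuous_on {0..1} Q" unfolding Q_def by (intro continuous_intros Fc Hc T) simp
    have QL2: "Q \<in> L2" by (rule continuous_L2[OF Qc])
    have "((\<lambda>r. L2_inner (R r) Q) has_integral L2_inner (F T) Q - L2_inner (F 0) Q) {0..T}"
    proof (rule fundamental_theorem_of_calculus[OF T])
      fix r assume "r \<in> {0..T}"
      then show "((\<lambda>t. L2_inner (F t) Q) has_vector_derivative L2_inner (R r) Q) (at r within {0..T})"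
        using DERIV_subset[OF der[OF QL2, of r], of "{0..T}"]
        by (auto simp: has_real_derivative_iff_has_vector_derivative)
    qed
    then have "L2_inner (F T) Q - L2_inner (F 0) Q = integral {0..T} (\<lambda>r. L2_inner (R r) Q)"
      by (simp add: integral_unique)
    also have "\<dots> = integral {0..T} (\<lambda>r. integral {0..1} (\<lambda>y. R r y * Q y))"
      by (rule Henstock_Kurzweil_Integration.integral_cong) (use Rc Qc in \<open>auto simp: L2_inner_continuous_eq_integral\<close>)
    also have "\<dots> = integral {0..1} (\<lambda>y. integral {0..T} (\<lambda>r. R r y * Q y))"
    proof -
      have "continuous_on (cbox (0,0) (T,1)) (\<lambda>p. (\<lambda>(r,y). R r y) p * Q (snd p))"
        by (intro continuous_on_mult R' continuous_on_compose2[OF Qc] continuous_on_snd continuous_on_id)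
           (auto simp: cbox_Pair_eq)
      then have "continuous_on (cbox (0,0) (T,1)) (\<lambda>(r,y). R r y * Q y)"
        by (simp add: case_prod_unfold)
      from integral_swap_continuous[OF this] show ?thesis by simp
    qed
    also have "\<dots> = integral {0..1} (\<lambda>y. H y * Q y)" by (simp add: H_def)
    also have "\<dots> = L2_inner H Q" by (rule L2_inner_continuous_eq_integral[symmetric, OF Hc Qc])
    finally have orth: "L2_inner (F T) Q - L2_inner (F 0) Q = L2_inner H Q" .
    have "L2_inner Q Q = L2_inner (\<lambda>y. F T y - F 0 y - H y) Q" by (simp only: Q_def)
    also have "\<dots> = L2_inner (F T) Q - L2_inner (F 0) Q - L2_inner H Q"
      using continuous_L2[OF Fc[OF T]] continuous_L2[OF Fc[of 0]] continuous_L2[OF Hc] QL2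
      by (simp add: L2_inner_diff_left L2_diff)
    finally have "L2_inner Q Q = 0" using orth by linarith
    then have "Q y = 0" using continuous_L2_norm_zero[OF Qc _ y] by simp
    then show ?thesis by (simp add: Q_def H_def)
  qed
  have Ry: "continuous_on {0..t+1} (\<lambda>r. R r y)"
    by (rule continuous_on_subset[OF joint_continuous_slice_time[OF R y]]) auto
  have "((\<lambda>T. integral {0..T} (\<lambda>r. R r y)) has_real_derivative R t y) (at t within {0..t+1})"
    using integral_has_vector_derivative[OF Ry, of t] t by (simp add: has_real_derivative_iff_has_vector_derivative)
  then have "((\<lambda>T. F 0 y + integral {0..T} (\<lambda>r. R r y)) has_real_derivative R t y) (at t within {0..t+1})"
    by (auto intro!: derivative_eq_intros)
  then have "((\<lambda>T. F 0 y + integral {0..T} (\<lambda>r. R r y)) has_real_derivative R t y) (at t within {0..})"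
    using at_within_atLeastAtMost_extend[OF t, of "t+1"] by simp
  then show ?thesis
  proof (rule has_field_derivative_transform_within[OF _ zero_less_one])
    show "F 0 y + integral {0..s} (\<lambda>r. R r y) = F s y" if "s \<in> {0..}" for s
      using eq[of s y] that y by simp
  qed (use t in simp)
qed

section \<open>The flow tested against fixed profiles, and its energy\<close>

text \<open>
The equations in the form in which they are used: \<open>ux\<close> is the velocity gradient, the momentum equation
is tested with primitives of mean-free profiles (so that the boundary terms vanish and only the
stress enters), and the other two with arbitrary profiles. All the tested quantities are
classically differentiable in time. The function \<open>g\<close> stands for the integral of
\<open>\<parallel>u\<^sub>t\<parallel>\<^sup>2\<close> over \<open>[0,t]\<close>; its increments bound those of \<open>u\<close>, which is all that is needed of the
acceleration.
\<close>

locale viscoelastic_flow =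
  fixes \<rho> \<eta> lam G \<xi> \<nu> :: real and u \<tau> f ux :: "real \<Rightarrow> real \<Rightarrow> real" and g :: "real \<Rightarrow> real"
  assumes pos: "\<rho> > 0" "\<eta> > 0" "lam > 0" "G > 0" "\<xi> > 0" "\<nu> > 0"
    and u_cont: "continuous_on ({0..} \<times> {0..1}) (\<lambda>(t,y). u t y)"
    and tau_cont: "continuous_on ({0..} \<times> {0..1}) (\<lambda>(t,y). \<tau> t y)"
    and f_cont: "continuous_on ({0..} \<times> {0..1}) (\<lambda>(t,y). f t y)"
    and ux_cont: "L2_continuous_on {0..} ux"
    and u_ux: "\<And>t y. t \<ge> 0 \<Longrightarrow> y \<in> {0..1} \<Longrightarrow> u t y = integral {0..y} (ux t)"
    and ux_mean: "\<And>t. t \<ge> 0 \<Longrightarrow> L2_inner (ux t) (\<lambda>_. 1) = 0"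
    and momentum: "\<And>k t. k \<in> L2 \<Longrightarrow> L2_inner k (\<lambda>_. 1) = 0 \<Longrightarrow> t \<ge> 0 \<Longrightarrow>
      ((\<lambda>t. L2_inner (u t) (\<lambda>y. integral {0..y} k)) has_real_derivative
        - L2_inner (\<lambda>y. \<eta> * ux t y + \<tau> t y) k / \<rho>) (at t within {0..})"
    and constitutive: "\<And>\<psi> t. \<psi> \<in> L2 \<Longrightarrow> t \<ge> 0 \<Longrightarrow>
      ((\<lambda>t. L2_inner (\<tau> t) \<psi>) has_real_derivative
        L2_inner (\<lambda>y. G * ux t y - f t y * \<tau> t y) \<psi> / lam) (at t within {0..})"
    and fluidity: "\<And>\<psi> t. \<psi> \<in> L2 \<Longrightarrow> t \<ge> 0 \<Longrightarrow>
      ((\<lambda>t. L2_inner (f t) \<psi>) has_real_derivative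
        L2_inner (\<lambda>y. (- 1 + \<xi> * \<bar>\<tau> t y\<bar>) * (f t y)\<^sup>2 - \<nu> * (f t y) ^ 3) \<psi>) (at t within {0..})"
    and f0_nonneg: "\<And>y. y \<in> {0..1} \<Longrightarrow> f 0 y \<ge> 0"
    and f0_nonzero: "\<exists>y\<in>{0..1}. f 0 y \<noteq> 0"
    and g_mono: "\<And>s t. 0 \<le> s \<Longrightarrow> s \<le> t \<Longrightarrow> g s \<le> g t"
    and u_increment: "\<And>s t. 0 \<le> s \<Longrightarrow> s \<le> t \<Longrightarrow>
      L2_inner (\<lambda>y. u t y - u s y) (\<lambda>y. u t y - u s y) \<le> (t - s) * (g t - g s)"
begin

definition energy :: "real \<Rightarrow> real"
  where "energy t = (\<rho> * G * L2_inner (u t) (u t) + lam * L2_inner (\<tau> t) (\<tau> t)) / 2"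

text \<open>
The rate at which the energy is lost, to viscosity and to relaxation of the stress.
\<close>

definition dissipation :: "real \<Rightarrow> real"
  where "dissipation t = \<eta> * G * L2_inner (ux t) (ux t) + L2_inner (\<lambda>y. f t y * \<tau> t y) (\<tau> t)"

lemmas u_slice = joint_continuous_slice[OF u_cont]

lemmas tau_slice = joint_continuous_slice[OF tau_cont]

lemmas f_slice = joint_continuous_slice[OF f_cont]

lemma u_L2: "t \<ge> 0 \<Longrightarrow> u t \<in> L2" by (rule continuous_L2[OF u_slice])

lemma tau_L2: "t \<ge> 0 \<Longrightarrow> \<tau> t \<in> L2" by (rule continuous_L2[OF tau_slice])

lemma f_L2: "t \<ge> 0 \<Longrightarrow> f t \<in> L2" by (rule continuous_L2[OF f_slice])

lemma ux_L2: "t \<ge> 0 \<Longrightarrow> ux t \<in> L2" using L2_continuous_onD[OF ux_cont] by simp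

lemma ftau_cont: "continuous_on ({0..} \<times> {0..1}) (\<lambda>(t,y). f t y * \<tau> t y)"
  using continuous_on_mult[OF f_cont tau_cont] by (simp add: case_prod_unfold)

lemma ftau_L2: "t \<ge> 0 \<Longrightarrow> (\<lambda>y. f t y * \<tau> t y) \<in> L2"
  by (rule continuous_L2[OF joint_continuous_slice[OF ftau_cont]])

lemmas u_L2cont = joint_continuous_imp_L2_continuous_on[OF u_cont]

lemmas tau_L2cont = joint_continuous_imp_L2_continuous_on[OF tau_cont]

lemmas ftau_L2cont = joint_continuous_imp_L2_continuous_on[OF ftau_cont]

lemma stress_L2cont: "L2_continuous_on {0..} (\<lambda>t y. \<eta> * ux t y + \<tau> t y)"
  by (intro L2_continuous_on_add L2_continuous_on_cmult ux_cont tau_L2cont)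

lemma stress_L2: "t \<ge> 0 \<Longrightarrow> (\<lambda>y. \<eta> * ux t y + \<tau> t y) \<in> L2"
  by (intro L2_add L2_cmult ux_L2 tau_L2)

lemma primitive_ux_add:
  assumes "s \<ge> 0" "t \<ge> 0" "y \<in> {0..1}"
  shows "integral {0..y} (\<lambda>y. ux s y + ux t y) = u s y + u t y"
proof -
  have "ux r integrable_on {0..y}" if "r \<ge> 0" for r
    using L2_integrable_on[OF ux_L2[OF that]] assms(3) by (auto elim!: integrable_on_subinterval)
  then show ?thesis using assms by (simp add: Henstock_Kurzweil_Integration.integral_add u_ux)
qed

lemma ux_add_mean: "s \<ge> 0 \<Longrightarrow> t \<ge> 0 \<Longrightarrow> L2_inner (\<lambda>y. ux s y + ux t y) (\<lambda>_. 1) = 0"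
  by (simp add: L2_inner_add_left ux_L2 ux_mean)

lemma momentum_ux:
  assumes "t \<ge> 0" "s0 \<ge> 0" "s1 \<ge> 0"
  shows "((\<lambda>t. L2_inner (u t) (\<lambda>y. u s0 y + u s1 y)) has_real_derivative
    - L2_inner (\<lambda>y. \<eta> * ux t y + \<tau> t y) (\<lambda>y. ux s0 y + ux s1 y) / \<rho>) (at t within {0..})"
proof -
  have "L2_inner (u t) (\<lambda>y. integral {0..y} (\<lambda>y. ux s0 y + ux s1 y)) = L2_inner (u t) (\<lambda>y. u s0 y + u s1 y)" for t
    by (rule L2_inner_cong) (use assms in \<open>simp_all add: primitive_ux_add\<close>)
  then show ?thesis
    using momentum[OF L2_add[OF ux_L2[OF assms(2)] ux_L2[OF assms(3)]] ux_add_mean[OF assms(2,3)] assms(1)] by simp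
qed

lemma u_square_deriv:
  assumes "t \<ge> 0"
  shows "((\<lambda>t. L2_inner (u t) (u t)) has_real_derivative
    - 2 / \<rho> * (\<eta> * L2_inner (ux t) (ux t) + L2_inner (\<tau> t) (ux t))) (at t within {0..})"
proof -
  have eq: "L2_inner (\<lambda>y. - (1 / \<rho>) * (\<eta> * ux t y + \<tau> t y)) z = - L2_inner (\<lambda>y. \<eta> * ux t y + \<tau> t y) z / \<rho>" for t z
    unfolding L2_inner_cmult_left by simp
  have "((\<lambda>t. L2_inner (u t) (u t)) has_real_derivative
    2 * L2_inner (\<lambda>y. - (1 / \<rho>) * (\<eta> * ux t y + \<tau> t y)) (ux t)) (at t within {0..})"
  proof (rule L2_energy_identity[OF u_L2 ux_cont _ _ assms])
    show "L2_continuous_on {0..} (\<lambda>t y. - (1 / \<rho>) * (\<eta> * ux t y + \<tau> t y))"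
      by (intro L2_continuous_on_cmult stress_L2cont)
  qed (simp_all only: eq momentum_ux)
  also have "2 * L2_inner (\<lambda>y. - (1 / \<rho>) * (\<eta> * ux t y + \<tau> t y)) (ux t)
      = - 2 / \<rho> * (\<eta> * L2_inner (ux t) (ux t) + L2_inner (\<tau> t) (ux t))"
    unfolding eq using assms by (simp add: L2_inner_add_left L2_cmult ux_L2 tau_L2 L2_inner_cmult_left add_divide_distrib diff_divide_distrib)
  finally show ?thesis .
qed

lemma tau_square_deriv:
  assumes "t \<ge> 0"
  shows "((\<lambda>t. L2_inner (\<tau> t) (\<tau> t)) has_real_derivative
    2 / lam * (G * L2_inner (\<tau> t) (ux t) - L2_inner (\<lambda>y. f t y * \<tau> t y) (\<tau> t))) (at t within {0..})"
proof -
  have eq: "L2_inner (\<lambda>y. (1 / lam) * (G * ux t y - f t y * \<tau> t y)) z = L2_inner (\<lambda>y. G * ux t y - f t y * \<tau> t y) z / lam" for t z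
    unfolding L2_inner_cmult_left by simp
  have "((\<lambda>t. L2_inner (\<tau> t) (\<tau> t)) has_real_derivative
    2 * L2_inner (\<lambda>y. (1 / lam) * (G * ux t y - f t y * \<tau> t y)) (\<tau> t)) (at t within {0..})"
  proof (rule L2_energy_identity[OF tau_L2 tau_L2cont _ _ assms])
    show "L2_continuous_on {0..} (\<lambda>t y. (1 / lam) * (G * ux t y - f t y * \<tau> t y))"
      by (intro L2_continuous_on_cmult L2_continuous_on_diff ux_cont ftau_L2cont)
  qed (simp_all only: eq constitutive L2_add tau_L2)
  also have "2 * L2_inner (\<lambda>y. (1 / lam) * (G * ux t y - f t y * \<tau> t y)) (\<tau> t)
      = 2 / lam * (G * L2_inner (\<tau> t) (ux t) - L2_inner (\<lambda>y. f t y * \<tau> t y) (\<tau> t))"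
    unfolding eq using assms
    by (simp add: L2_inner_diff_left L2_cmult ux_L2 tau_L2 ftau_L2 L2_inner_cmult_left L2_inner_commute[of "ux t"])
  finally show ?thesis .
qed

text \<open>
The factors \<open>\<rho> G\<close> and \<open>\<lambda>\<close> are chosen such that the two exchange terms \<open>\<plusminus> G \<langle>\<tau>, u\<^sub>y\<rangle>\<close> cancel.
\<close>

lemma energy_deriv:
  assumes "t \<ge> 0"
  shows "(energy has_real_derivative - dissipation t) (at t within {0..})"
proof -
  have "((\<lambda>t. (\<rho> * G * L2_inner (u t) (u t) + lam * L2_inner (\<tau> t) (\<tau> t)) / 2) has_real_derivative
     (\<rho> * G * (- 2 / \<rho> * (\<eta> * L2_inner (ux t) (ux t) + L2_inner (\<tau> t) (ux t)))
      + lam * (2 / lam * (G * L2_inner (\<tau> t) (ux t) - L2_inner (\<lambda>y. f t y * \<tau> t y) (\<tau> t)))) / 2) (at t within {0..})"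
    by (intro DERIV_cdivide DERIV_add DERIV_cmult u_square_deriv tau_square_deriv assms)
  moreover have "(\<rho> * G * (- 2 / \<rho> * (\<eta> * L2_inner (ux t) (ux t) + L2_inner (\<tau> t) (ux t)))
      + lam * (2 / lam * (G * L2_inner (\<tau> t) (ux t) - L2_inner (\<lambda>y. f t y * \<tau> t y) (\<tau> t)))) / 2 = - dissipation t"
    using pos by (simp add: dissipation_def field_simps)
  ultimately show ?thesis unfolding energy_def[abs_def] by simp
qed

section \<open>Positivity of the fluidity and energy bounds\<close>

lemma f_deriv:
  assumes "t \<ge> 0" "y \<in> {0..1}"
  shows "((\<lambda>t. f t y) has_real_derivative (- 1 + \<xi> * \<bar>\<tau> t y\<bar>) * (f t y)\<^sup>2 - \<nu> * (f t y) ^ 3) (at t within {0..})"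
proof (rule weak_ODE_imp_pointwise[OF f_cont _ fluidity assms(2,1)])
  show "continuous_on ({0..} \<times> {0..1}) (\<lambda>(t, y). (- 1 + \<xi> * \<bar>\<tau> t y\<bar>) * (f t y)\<^sup>2 - \<nu> * f t y ^ 3)"
    using tau_cont f_cont unfolding case_prod_unfold by (intro continuous_intros)
qed

text \<open>
The right-hand side has a factor \<open>f\<close>, so that \<open>f\<close> solves a linear equation with a continuous
coefficient. It follows that the sign and the zeros of the initial fluidity persist.
\<close>

lemma f_explicit:
  assumes "t \<ge> 0" "y \<in> {0..1}"
  shows "f t y = f 0 y * exp (integral {0..t} (\<lambda>t. (- 1 + \<xi> * \<bar>\<tau> t y\<bar>) * f t y - \<nu> * (f t y)\<^sup>2))"
proof (rule linear_ODE_solution[OF _ _ assms(1)])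
  fix t :: real assume "t \<ge> 0"
  then show "((\<lambda>t. f t y) has_real_derivative f t y * ((- 1 + \<xi> * \<bar>\<tau> t y\<bar>) * f t y - \<nu> * (f t y)\<^sup>2)) (at t within {0..})"
    using f_deriv[of t y] assms(2) by (simp add: algebra_simps power2_eq_square power3_eq_cube)
next
  show "continuous_on {0..} (\<lambda>t. (- 1 + \<xi> * \<bar>\<tau> t y\<bar>) * f t y - \<nu> * (f t y)\<^sup>2)"
    by (intro continuous_intros joint_continuous_slice_time[OF tau_cont assms(2)] joint_continuous_slice_time[OF f_cont assms(2)])
qed

lemma f_nonneg: "t \<ge> 0 \<Longrightarrow> y \<in> {0..1} \<Longrightarrow> f t y \<ge> 0"
  using f_explicit[of t y] f0_nonneg[of y] by simp

lemma f_pos: "t \<ge> 0 \<Longrightarrow> y \<in> {0..1} \<Longrightarrow> f 0 y > 0 \<Longrightarrow> f t y > 0"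
  using f_explicit[of t y] by simp

lemma ftau_tau_nonneg: "t \<ge> 0 \<Longrightarrow> 0 \<le> L2_inner (\<lambda>y. f t y * \<tau> t y) (\<tau> t)"
  unfolding L2_inner_def
  by (rule integral_nonneg_AE, rule AE_I2) (simp add: f_nonneg mult.assoc)

lemma dissipation_nonneg: "t \<ge> 0 \<Longrightarrow> 0 \<le> dissipation t"
  using ftau_tau_nonneg[of t] pos by (simp add: dissipation_def)

lemma energy_nonneg: "0 \<le> energy t"
  using pos by (simp add: energy_def)

lemma energy_antimono: "0 \<le> s \<Longrightarrow> s \<le> t \<Longrightarrow> energy t \<le> energy s"
  using nonpos_deriv_imp_antimono[OF energy_deriv, of s t] dissipation_nonneg by simp

lemma u_norm_le: "t \<ge> 0 \<Longrightarrow> L2_inner (u t) (u t) \<le> 2 * energy 0 / (\<rho> * G)"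
proof -
  assume t: "t \<ge> 0"
  have "\<rho> * G * L2_inner (u t) (u t) \<le> 2 * energy t" using pos by (simp add: energy_def)
  also have "\<dots> \<le> 2 * energy 0" using energy_antimono[of 0 t] t by simp
  finally show ?thesis using pos by (simp add: field_simps)
qed

lemma tau_norm_le: "t \<ge> 0 \<Longrightarrow> L2_inner (\<tau> t) (\<tau> t) \<le> 2 * energy 0 / lam"
proof -
  assume t: "t \<ge> 0"
  have "lam * L2_inner (\<tau> t) (\<tau> t) \<le> 2 * energy t" using pos by (simp add: energy_def)
  also have "\<dots> \<le> 2 * energy 0" using energy_antimono[of 0 t] t by simp
  finally show ?thesis using pos by (simp add: field_simps)
qed

text \<open>
Since \<open>u\<close> vanishes at \<open>0\<close>, it is controlled by its gradient.
\<close>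

lemma u_sup_le: "t \<ge> 0 \<Longrightarrow> y \<in> {0..1} \<Longrightarrow> \<bar>u t y\<bar> \<le> L2_norm (ux t)"
  using abs_indefinite_integral_le[OF ux_L2, of t 0 y] u_ux[of t y] by simp

lemma u_Poincare: "t \<ge> 0 \<Longrightarrow> L2_norm (u t) \<le> L2_norm (ux t)"
  by (rule L2_norm_le_sup[OF u_L2]) (auto intro: u_sup_le)

section \<open>Eliminating the velocity gradient\<close>

text \<open>
In terms of the total stress \<open>w = \<eta> u\<^sub>y + \<tau>\<close>, the constitutive law reads \<open>\<lambda> \<tau>' = a (w - \<tau>) - f \<tau>\<close>.
\<close>

definition a :: real
  where "a = G / \<eta>"

definition m :: "real \<Rightarrow> real"
  where "m t = L2_inner (\<tau> t) (\<lambda>_. 1)"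

definition U :: "real \<Rightarrow> real \<Rightarrow> real"
  where "U t y = integral {0..y} (u t)"

definition P :: "real \<Rightarrow> real \<Rightarrow> real"
  where "P t y = U t y - L2_inner (U t) (\<lambda>_. 1)"

text \<open>
The constant \<open>a \<rho>\<close> makes the time derivative of \<open>a \<rho> P\<close> equal to the oscillating part \<open>a (w - m)\<close> of
\<open>G u\<^sub>y + a \<tau>\<close>, so that no velocity gradient is left in the equation of \<open>\<sigma>\<close>.
\<close>

definition \<sigma> :: "real \<Rightarrow> real \<Rightarrow> real"
  where "\<sigma> t y = lam * \<tau> t y - a * \<rho> * P t y"

lemma a_pos: "a > 0"
  using pos by (simp add: a_def)

lemma U_cont: "continuous_on ({0..} \<times> {0..1}) (\<lambda>(t,y). U t y)"
proof (rule uniform_slices_imp_joint_continuous)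
  fix t :: real assume t: "t \<ge> 0"
  show "continuous_on {0..1} (U t)" unfolding U_def by (rule continuous_on_L2_primitive[OF u_L2[OF t]])
  fix e :: real assume e: "e > 0"
  have "((\<lambda>s. L2_norm (\<lambda>y. u s y - u t y)) \<longlongrightarrow> 0) (at t within {0..})"
    using u_L2cont t by (simp add: L2_continuous_on_def)
  then have "\<forall>\<^sub>F s in at t within {0..}. L2_norm (\<lambda>y. u s y - u t y) < e"
    using e by (rule order_tendstoD(2))
  moreover have "\<forall>\<^sub>F s in at t within {0..}. s \<in> {0..}" by (simp add: eventually_at_filter)
  ultimately show "\<forall>\<^sub>F s in at t within {0..}. \<forall>y\<in>{0..1}. \<bar>U s y - U t y\<bar> < e"
  proof eventually_elim
    case (elim s)
    show ?case
    proof
      fix y :: real assume y: "y \<in> {0..1}"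
      have s: "s \<ge> 0" using elim by simp
      have int: "u r integrable_on {0..y}" if "r \<ge> 0" for r
        using L2_integrable_on[OF u_L2[OF that]] y by (auto elim!: integrable_on_subinterval)
      have "U s y - U t y = integral {0..y} (\<lambda>y. u s y - u t y)"
        unfolding U_def by (rule Henstock_Kurzweil_Integration.integral_diff[symmetric, OF int[OF s] int[OF t]])
      also have "\<bar>\<dots>\<bar> \<le> L2_norm (\<lambda>y. u s y - u t y)"
        by (rule abs_indefinite_integral_le[OF L2_diff[OF u_L2[OF s] u_L2[OF t]]]) (use y in auto)
      finally show "\<bar>U s y - U t y\<bar> < e" using elim by simp
    qed
  qed
qed

lemmas U_slice = joint_continuous_slice[OF U_cont]

lemma U_L2: "t \<ge> 0 \<Longrightarrow> U t \<in> L2" by (rule continuous_L2[OF U_slice])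

lemma P_cont: "continuous_on ({0..} \<times> {0..1}) (\<lambda>(t,y). P t y)"
proof -
  have "continuous_on {0..} (\<lambda>t. L2_inner (U t) (\<lambda>_. 1))"
    by (rule continuous_on_L2_inner[OF joint_continuous_imp_L2_continuous_on[OF U_cont] L2_continuous_on_const]) simp
  then have "continuous_on ({0..} \<times> {0..1::real}) (\<lambda>p. L2_inner (U (fst p)) (\<lambda>_. 1))"
    by (rule continuous_on_compose2) (auto intro!: continuous_intros)
  then show ?thesis
    using continuous_on_diff[OF U_cont] by (simp add: P_def case_prod_unfold)
qed

lemmas P_slice = joint_continuous_slice[OF P_cont]

lemma P_L2: "t \<ge> 0 \<Longrightarrow> P t \<in> L2" by (rule continuous_L2[OF P_slice])

lemma P_mean: "t \<ge> 0 \<Longrightarrow> L2_inner (P t) (\<lambda>_. 1) = 0"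
  unfolding P_def by (subst L2_inner_diff_left) (auto simp: U_L2, simp add: L2_inner_def)

lemma P_sup_le:
  assumes t: "t \<ge> 0" and y: "y \<in> {0..1}"
  shows "\<bar>P t y\<bar> \<le> 2 * L2_norm (u t)"
proof -
  have U: "\<bar>U t y\<bar> \<le> L2_norm (u t)" if "y \<in> {0..1}" for y
    using abs_indefinite_integral_le[OF u_L2[OF t], of 0 y] that by (simp add: U_def)
  have "L2_norm (U t) \<le> L2_norm (u t)" by (rule L2_norm_le_sup[OF U_L2[OF t] U])
  moreover have "\<bar>L2_inner (U t) (\<lambda>_. 1)\<bar> \<le> L2_norm (U t) * 1"
    using L2_Cauchy_Schwarz[OF U_L2[OF t] L2_const[of 1]] by simp
  ultimately show ?thesis using U[OF y] unfolding P_def by linarith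
qed

lemma P_norm_le: "t \<ge> 0 \<Longrightarrow> L2_norm (P t) \<le> 2 * L2_norm (u t)"
  by (rule L2_norm_le_sup[OF P_L2 P_sup_le])

text \<open>
Integration by parts moves the primitive from the velocity onto the test profile. This is the form
in which the momentum equation yields the time derivative of \<open>P\<close>.
\<close>

lemma P_weak:
  assumes t: "t \<ge> 0" and \<psi>: "\<psi> \<in> L2"
  shows "L2_inner (P t) \<psi> = - L2_inner (u t) (\<lambda>y. integral {0..y} (\<lambda>y. \<psi> y - L2_inner \<psi> (\<lambda>_. 1)))"
proof -
  let ?k = "\<lambda>y. \<psi> y - L2_inner \<psi> (\<lambda>_. 1)"
  have "L2_inner (P t) \<psi> = L2_inner (U t) \<psi> - L2_inner (\<lambda>_. L2_inner (U t) (\<lambda>_. 1)) \<psi>"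
    unfolding P_def by (rule L2_inner_diff_left[OF U_L2[OF t] L2_const \<psi>])
  also have "L2_inner (\<lambda>_. L2_inner (U t) (\<lambda>_. 1)) \<psi> = L2_inner (U t) (\<lambda>_. 1) * L2_inner \<psi> (\<lambda>_. 1)"
    by (simp add: L2_inner_def)
  also have "L2_inner (U t) \<psi> - \<dots> = L2_inner (U t) ?k"
    by (rule L2_inner_mean_free[symmetric, OF U_L2[OF t] \<psi>])
  also have "\<dots> = - L2_inner (u t) (\<lambda>y. integral {0..y} ?k)"
  proof -
    have "(LINT y|Omega. ?k y) = 0" using mean_free_mean[OF \<psi>] by (simp only: L2_inner_def[of ?k] mult_1_right)
    then have "(LINT y|Omega. u t y * integral {0..y} ?k) + (LINT y|Omega. integral {0..y} (u t) * ?k y) = 0"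
      using integration_by_parts_indefinite[OF L2_integrable[OF u_L2[OF t]] L2_integrable[OF mean_free_L2[OF \<psi>]]]
      by (simp only: mult_zero_right)
    then show ?thesis unfolding L2_inner_def[of "U t" ?k] L2_inner_def[of "u t"] U_def by linarith
  qed
  finally show ?thesis .
qed

lemma sigma_cont: "continuous_on ({0..} \<times> {0..1}) (\<lambda>(t,y). \<sigma> t y)"
  using tau_cont P_cont unfolding \<sigma>_def case_prod_unfold by (intro continuous_intros)

lemma m_cont: "continuous_on {0..} m"
  unfolding m_def[abs_def] by (rule continuous_on_L2_inner[OF tau_L2cont L2_continuous_on_const]) simp

text \<open>
The constitutive law contributes \<open>G u\<^sub>y - f \<tau>\<close>. The momentum equation, tested with the primitive of the
mean-free part of \<open>\<psi>\<close>, removes \<open>a (w - m)\<close> from it, because \<open>w\<close> has the same mean \<open>m\<close> as \<open>\<tau>\<close>.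
\<close>

lemma sigma_weak_deriv:
  assumes \<psi>: "\<psi> \<in> L2" and t: "t \<ge> 0"
  shows "((\<lambda>t. L2_inner (\<sigma> t) \<psi>) has_real_derivative
    L2_inner (\<lambda>y. a * m t - (a + f t y) * \<tau> t y) \<psi>) (at t within {0..})"
proof -
  let ?k = "\<lambda>y. \<psi> y - L2_inner \<psi> (\<lambda>_. 1)"
  let ?K = "\<lambda>y. integral {0..y} ?k"
  have "((\<lambda>t. lam * L2_inner (\<tau> t) \<psi> + a * \<rho> * L2_inner (u t) ?K) has_real_derivative
      lam * (L2_inner (\<lambda>y. G * ux t y - f t y * \<tau> t y) \<psi> / lam)
      + a * \<rho> * (- L2_inner (\<lambda>y. \<eta> * ux t y + \<tau> t y) ?k / \<rho>)) (at t within {0..})"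
    by (intro DERIV_add DERIV_cmult constitutive momentum \<psi> t mean_free_L2 mean_free_mean)
  moreover have "lam * (L2_inner (\<lambda>y. G * ux t y - f t y * \<tau> t y) \<psi> / lam)
      + a * \<rho> * (- L2_inner (\<lambda>y. \<eta> * ux t y + \<tau> t y) ?k / \<rho>)
      = L2_inner (\<lambda>y. a * m t - (a + f t y) * \<tau> t y) \<psi>"
  proof -
    define X where "X = L2_inner (ux t) \<psi>"
    define T where "T = L2_inner (\<tau> t) \<psi>"
    define FT where "FT = L2_inner (\<lambda>y. f t y * \<tau> t y) \<psi>"
    define c where "c = L2_inner \<psi> (\<lambda>_. 1)"
    have split: "L2_inner (\<lambda>y. \<eta> * ux t y + \<tau> t y) z = \<eta> * L2_inner (ux t) z + L2_inner (\<tau> t) z" if "z \<in> L2" for z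
      using t that by (simp add: L2_inner_add_left L2_cmult ux_L2 tau_L2 L2_inner_cmult_left)
    have w: "L2_inner (\<lambda>y. \<eta> * ux t y + \<tau> t y) ?k = \<eta> * X + T - m t * c"
      unfolding L2_inner_mean_free[OF stress_L2[OF t] \<psi>] split[OF \<psi>] split[OF L2_const] ux_mean[OF t]
      by (simp add: X_def T_def m_def c_def)
    have A: "L2_inner (\<lambda>y. G * ux t y - f t y * \<tau> t y) \<psi> = G * X - FT"
      using t \<psi> unfolding X_def FT_def by (simp add: L2_inner_diff_left L2_cmult ux_L2 ftau_L2 L2_inner_cmult_left)
    have "(\<lambda>y. a * m t - (a + f t y) * \<tau> t y) = (\<lambda>y. a * m t - a * \<tau> t y - f t y * \<tau> t y)"
      by (auto simp: algebra_simps)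
    moreover have "L2_inner (\<lambda>y. a * m t) \<psi> = a * m t * c" by (simp add: L2_inner_def c_def)
    ultimately have R: "L2_inner (\<lambda>y. a * m t - (a + f t y) * \<tau> t y) \<psi> = a * m t * c - a * T - FT"
      using t \<psi> unfolding T_def FT_def
      by (simp add: L2_inner_diff_left L2_diff L2_cmult tau_L2 ftau_L2 L2_inner_cmult_left)
    have "a * \<rho> * (- z / \<rho>) = - (a * z)" for z using pos by simp
    then have c1: "a * \<rho> * (- (\<eta> * X + T - m t * c) / \<rho>) = - (a * (\<eta> * X + T - m t * c))" .
    have "lam * (z / lam) = z" for z using pos by simp
    then have c2: "lam * ((G * X - FT) / lam) = G * X - FT" .
    have aX: "a * (\<eta> * X) = G * X" using pos by (simp add: a_def)
    show ?thesis unfolding w A R c1 c2 by (simp add: right_diff_distrib distrib_left mult.assoc aX)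
  qed
  ultimately have "((\<lambda>t. lam * L2_inner (\<tau> t) \<psi> + a * \<rho> * L2_inner (u t) ?K) has_real_derivative
      L2_inner (\<lambda>y. a * m t - (a + f t y) * \<tau> t y) \<psi>) (at t within {0..})" by simp
  then show ?thesis
  proof (rule has_field_derivative_transform_within[OF _ zero_less_one])
    fix s :: real assume "s \<in> {0..}"
    then have s: "s \<ge> 0" by simp
    show "lam * L2_inner (\<tau> s) \<psi> + a * \<rho> * L2_inner (u s) ?K = L2_inner (\<sigma> s) \<psi>"
      unfolding \<sigma>_def L2_inner_diff_left[OF L2_cmult[OF tau_L2[OF s]] L2_cmult[OF P_L2[OF s]] \<psi>]
        L2_inner_cmult_left P_weak[OF s \<psi>] by simp
  qed (use t in simp)
qed

lemma sigma_deriv: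
  assumes "t \<ge> 0" "y \<in> {0..1}"
  shows "((\<lambda>t. \<sigma> t y) has_real_derivative a * m t - (a + f t y) * \<tau> t y) (at t within {0..})"
proof (rule weak_ODE_imp_pointwise[OF sigma_cont _ sigma_weak_deriv assms(2,1)])
  have "continuous_on ({0..} \<times> {0..1::real}) (\<lambda>p. m (fst p))"
    by (rule continuous_on_compose2[OF m_cont]) (auto intro!: continuous_intros)
  then show "continuous_on ({0..} \<times> {0..1}) (\<lambda>(t, y). a * m t - (a + f t y) * \<tau> t y)"
    using tau_cont f_cont unfolding case_prod_unfold by (intro continuous_intros)
qed

text \<open>
The equation of \<open>\<sigma>\<close> read as relaxation towards a moving target. The target is small as soon as \<open>m\<close>
and \<open>P\<close> are, and has the sign of \<open>m\<close> when \<open>P\<close> is small.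
\<close>

lemma sigma_relaxation:
  assumes "t \<ge> 0" "y \<in> {0..1}"
  shows "((\<lambda>t. \<sigma> t y) has_real_derivative
    - ((a + f t y) / lam) * (\<sigma> t y - (lam * a * m t / (a + f t y) - a * \<rho> * P t y))) (at t within {0..})"
proof -
  define A where "A = a + f t y"
  have A: "A > 0" using a_pos f_nonneg[OF assms] by (simp add: A_def)
  have "- (A / lam) * (\<sigma> t y - (lam * a * m t / A - a * \<rho> * P t y))
      = - (A / lam) * (lam * \<tau> t y) + (A / lam) * (lam * a * m t / A)"
    unfolding \<sigma>_def by (simp add: right_diff_distrib)
  also have "\<dots> = a * m t - A * \<tau> t y" using A pos by simp
  finally have "- ((a + f t y) / lam) * (\<sigma> t y - (lam * a * m t / (a + f t y) - a * \<rho> * P t y))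
      = a * m t - (a + f t y) * \<tau> t y" unfolding A_def .
  then show ?thesis using sigma_deriv[OF assms] by simp
qed

section \<open>Bounds uniform in space and time\<close>

lemma m_le_tau_norm: "t \<ge> 0 \<Longrightarrow> \<bar>m t\<bar> \<le> L2_norm (\<tau> t)"
  using L2_Cauchy_Schwarz[OF tau_L2 L2_const[of 1], of t] by (simp add: m_def)

lemma sigma_abs_bound:
  assumes S: "S \<ge> 0" and y: "y \<in> {0..1}"
    and Q: "\<And>t. t \<ge> S \<Longrightarrow> lam * \<bar>m t\<bar> + a * \<rho> * \<bar>P t y\<bar> \<le> Q" and t: "t \<ge> S"
  shows "\<bar>\<sigma> t y\<bar> \<le> Q + \<bar>\<sigma> S y\<bar> * exp (- (a / lam) * (t - S))"
proof -
  let ?q = "\<lambda>t. lam * a * m t / (a + f t y) - a * \<rho> * P t y"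
  have q: "\<bar>?q t\<bar> \<le> Q" if t: "t \<ge> S" for t
  proof -
    have f: "f t y \<ge> 0" using f_nonneg[OF _ y, of t] S t by simp
    have "\<bar>lam * a * m t / (a + f t y)\<bar> = lam * \<bar>m t\<bar> * (a / (a + f t y))"
      using f a_pos pos by (simp add: abs_mult)
    also have "\<dots> \<le> lam * \<bar>m t\<bar> * 1"
      using f a_pos pos by (intro mult_left_mono) auto
    finally have "\<bar>lam * a * m t / (a + f t y)\<bar> \<le> lam * \<bar>m t\<bar>" by simp
    moreover have "\<bar>a * \<rho> * P t y\<bar> = a * \<rho> * \<bar>P t y\<bar>" using a_pos pos by (simp add: abs_mult)
    ultimately show ?thesis using Q[OF t] by linarith
  qed
  have q1: "?q t \<le> Q" and q2: "- Q \<le> ?q t" if "t \<ge> S" for t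
    using q[OF that] unfolding abs_le_iff by linarith+
  have Q0: "Q \<ge> 0" using q[OF order_refl] by linarith
  have p: "a / lam \<le> (a + f t y) / lam" if "t \<ge> S" for t
    using f_nonneg[OF _ y, of t] S that pos by (simp add: divide_right_mono)
  have p0: "0 \<le> a / lam" using a_pos pos by simp
  have e: "exp (- (a / lam) * (t - S)) \<ge> 0" by simp
  have "\<sigma> t y \<le> Q + max 0 (\<sigma> S y - Q) * exp (- (a / lam) * (t - S))"
    by (rule relaxation_upper_bound[where q = ?q, OF sigma_relaxation[OF _ y] S p p0 _ t])
       (assumption | rule q1)+
  also have "\<dots> \<le> Q + \<bar>\<sigma> S y\<bar> * exp (- (a / lam) * (t - S))"
    using Q0 by (intro add_left_mono mult_right_mono e) auto
  finally have upper: "\<sigma> t y \<le> Q + \<bar>\<sigma> S y\<bar> * exp (- (a / lam) * (t - S))" .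
  have "- Q - max 0 (- Q - \<sigma> S y) * exp (- (a / lam) * (t - S)) \<le> \<sigma> t y"
    by (rule relaxation_lower_bound[where q = ?q, OF sigma_relaxation[OF _ y] S p p0 _ t])
       (assumption | rule q2)+
  moreover have "max 0 (- Q - \<sigma> S y) * exp (- (a / lam) * (t - S)) \<le> \<bar>\<sigma> S y\<bar> * exp (- (a / lam) * (t - S))"
    using Q0 by (intro mult_right_mono e) auto
  ultimately show ?thesis using upper by linarith
qed

text \<open>
The energy bounds \<open>m\<close> and \<open>P\<close>, hence the target of the relaxation.
\<close>

lemma sigma_bounded: "\<exists>B\<ge>0. \<forall>t\<ge>0. \<forall>y\<in>{0..1}. \<bar>\<sigma> t y\<bar> \<le> B \<and> \<bar>\<tau> t y\<bar> \<le> B"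
proof -
  define M0 where "M0 = sqrt (2 * energy 0 / lam)"
  define U0 where "U0 = sqrt (2 * energy 0 / (\<rho> * G))"
  have nonneg: "M0 \<ge> 0" "U0 \<ge> 0" using pos energy_nonneg[of 0] by (simp_all add: M0_def U0_def)
  have m: "\<bar>m t\<bar> \<le> M0" if "t \<ge> 0" for t
    using order_trans[OF m_le_tau_norm[OF that, unfolded L2_norm_eq] real_sqrt_le_mono[OF tau_norm_le[OF that]]]
    by (simp only: M0_def)
  have P: "\<bar>P t y\<bar> \<le> 2 * U0" if "t \<ge> 0" "y \<in> {0..1}" for t y
    using P_sup_le[OF that, unfolded L2_norm_eq] real_sqrt_le_mono[OF u_norm_le[OF that(1)]]
    unfolding U0_def by linarith
  define Q where "Q = lam * M0 + a * \<rho> * (2 * U0)"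
  obtain B0 where B0: "B0 \<ge> 0" "\<And>y. y \<in> {0..1} \<Longrightarrow> \<bar>\<sigma> 0 y\<bar> \<le> B0"
    using joint_bounded_slice[OF sigma_cont, of 0] by auto
  have Q0: "Q \<ge> 0" using nonneg pos a_pos by (simp add: Q_def)
  define B where "B = Q + B0"
  have sigma_le: "\<bar>\<sigma> t y\<bar> \<le> B" if t: "t \<ge> 0" and y: "y \<in> {0..1}" for t y
  proof -
    have "\<bar>\<sigma> t y\<bar> \<le> Q + \<bar>\<sigma> 0 y\<bar> * exp (- (a / lam) * (t - 0))"
    proof (rule sigma_abs_bound[OF order_refl y _ t])
      fix t :: real assume "t \<ge> 0"
      then show "lam * \<bar>m t\<bar> + a * \<rho> * \<bar>P t y\<bar> \<le> Q"
        unfolding Q_def using pos a_pos m P y by (intro add_mono mult_left_mono) auto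
    qed
    also have "\<bar>\<sigma> 0 y\<bar> * exp (- (a / lam) * (t - 0)) \<le> B0 * 1"
      using B0 y t a_pos pos by (intro mult_mono) auto
    finally show ?thesis by (simp add: B_def)
  qed
  have tau: "\<bar>\<tau> t y\<bar> \<le> (B + a * \<rho> * (2 * U0)) / lam" if t: "t \<ge> 0" and y: "y \<in> {0..1}" for t y
  proof -
    have "lam * \<tau> t y = \<sigma> t y + a * \<rho> * P t y" by (simp add: \<sigma>_def)
    then have "lam * \<bar>\<tau> t y\<bar> = \<bar>\<sigma> t y + a * \<rho> * P t y\<bar>" using pos by (metis abs_mult abs_of_pos)
    also have "\<dots> \<le> \<bar>\<sigma> t y\<bar> + a * \<rho> * \<bar>P t y\<bar>"
      using abs_triangle_ineq[of "\<sigma> t y" "a * \<rho> * P t y"] pos a_pos by (simp add: abs_mult)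
    also have "\<dots> \<le> B + a * \<rho> * (2 * U0)"
      using pos a_pos by (intro add_mono mult_left_mono sigma_le P t y) auto
    finally show ?thesis using pos by (simp add: field_simps)
  qed
  have "B \<ge> 0" using Q0 B0 by (simp add: B_def)
  show ?thesis
    by (rule exI[of _ "max B ((B + a * \<rho> * (2 * U0)) / lam)"])
       (use sigma_le tau \<open>B \<ge> 0\<close> in \<open>auto simp: le_max_iff_disj\<close>)
qed

text \<open>
Once \<open>\<nu> f\<close> exceeds \<open>\<xi> \<bar>\<tau>\<bar>\<close>, the cubic damping dominates and \<open>f\<close> decreases.
\<close>

lemma f_bounded: "\<exists>F0>0. \<forall>t\<ge>0. \<forall>y\<in>{0..1}. f t y \<le> F0"
proof -
  obtain B where B: "B \<ge> 0" "\<And>t y. t \<ge> 0 \<Longrightarrow> y \<in> {0..1} \<Longrightarrow> \<bar>\<tau> t y\<bar> \<le> B"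
    using sigma_bounded by blast
  obtain f1 where f1: "f1 \<ge> 0" "\<And>y. y \<in> {0..1} \<Longrightarrow> \<bar>f 0 y\<bar> \<le> f1"
    using joint_bounded_slice[OF f_cont, of 0] by auto
  define F0 where "F0 = 1 + f1 + \<xi> * B / \<nu>"
  have z: "\<xi> * B / \<nu> \<ge> 0" using pos B by simp
  have "f t y \<le> F0" if t: "t \<ge> 0" and y: "y \<in> {0..1}" for t y
  proof (rule barrier[OF f_deriv[OF _ y] order_refl _ _ t])
    show "f 0 y \<le> F0" using f1(2)[OF y] z by (simp add: F0_def)
    fix t :: real assume t: "t \<ge> 0" and big: "f t y > F0"
    have "\<xi> * B / \<nu> \<le> f t y" using big f1 z by (simp add: F0_def)
    then have "\<xi> * B \<le> \<nu> * f t y" using pos by (simp add: field_simps)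
    moreover have "\<xi> * \<bar>\<tau> t y\<bar> \<le> \<xi> * B" using pos B(2)[OF t y] by simp
    ultimately have "- 1 + \<xi> * \<bar>\<tau> t y\<bar> - \<nu> * f t y \<le> 0" by simp
    then have "(- 1 + \<xi> * \<bar>\<tau> t y\<bar> - \<nu> * f t y) * (f t y)\<^sup>2 \<le> 0" by (simp add: mult_nonpos_nonneg)
    then show "(- 1 + \<xi> * \<bar>\<tau> t y\<bar>) * (f t y)\<^sup>2 - \<nu> * f t y ^ 3 \<le> 0"
      by (simp add: algebra_simps power2_eq_square power3_eq_cube)
  qed
  moreover have "F0 > 0" using f1 z by (simp add: F0_def)
  ultimately show ?thesis by blast
qed

lemma ftau_norm_le:
  assumes F0: "\<And>t y. t \<ge> 0 \<Longrightarrow> y \<in> {0..1} \<Longrightarrow> f t y \<le> F0" and t: "t \<ge> 0"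
  shows "L2_inner (\<lambda>y. f t y * \<tau> t y) (\<lambda>y. f t y * \<tau> t y) \<le> F0 * L2_inner (\<lambda>y. f t y * \<tau> t y) (\<tau> t)"
proof -
  have "L2_inner (\<lambda>y. f t y * \<tau> t y) (\<lambda>y. f t y * \<tau> t y) \<le> (LINT y|Omega. F0 * (f t y * \<tau> t y * \<tau> t y))"
    unfolding L2_inner_def
  proof (rule integral_mono_AE)
    show "AE y in Omega. f t y * \<tau> t y * (f t y * \<tau> t y) \<le> F0 * (f t y * \<tau> t y * \<tau> t y)"
    proof (rule AE_I2)
      fix y assume "y \<in> space Omega"
      then have y: "y \<in> {0..1}" by simp
      have "f t y * (f t y * (\<tau> t y * \<tau> t y)) \<le> F0 * (f t y * (\<tau> t y * \<tau> t y))"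
        using F0[OF t y] f_nonneg[OF t y] by (intro mult_right_mono) auto
      then show "f t y * \<tau> t y * (f t y * \<tau> t y) \<le> F0 * (f t y * \<tau> t y * \<tau> t y)"
        by (simp only: mult.assoc mult.left_commute)
    qed
  qed (use L2_mult_integrable[OF ftau_L2[OF t] ftau_L2[OF t]] L2_mult_integrable[OF ftau_L2[OF t] tau_L2[OF t]] in auto)
  then show ?thesis by (simp add: L2_inner_def)
qed

section \<open>Decay of the velocity and of the stress fluctuations\<close>

text \<open>
The fluctuation of \<open>\<lambda> \<tau>\<close> about its mean, corrected by \<open>- a \<rho> P\<close>.
\<close>

definition Z :: "real \<Rightarrow> real \<Rightarrow> real"
  where "Z t y = \<sigma> t y - lam * m t"

lemma Z_cont: "continuous_on ({0..} \<times> {0..1}) (\<lambda>(t,y). Z t y)"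
  using sigma_cont comp_fst_continuous[OF m_cont] unfolding Z_def case_prod_unfold by (intro continuous_intros)

lemma Z_L2: "t \<ge> 0 \<Longrightarrow> Z t \<in> L2" by (rule continuous_L2[OF joint_continuous_slice[OF Z_cont]])

lemma sigma_L2: "t \<ge> 0 \<Longrightarrow> \<sigma> t \<in> L2" by (rule continuous_L2[OF joint_continuous_slice[OF sigma_cont]])

lemma Z_inner: "t \<ge> 0 \<Longrightarrow> \<psi> \<in> L2 \<Longrightarrow> L2_inner (Z t) \<psi> = L2_inner (\<sigma> t) \<psi> - lam * m t * L2_inner \<psi> (\<lambda>_. 1)"
  unfolding Z_def by (subst L2_inner_diff_left) (simp_all only: sigma_L2 L2_const L2_inner_const_left)

lemma sigma_inner: "t \<ge> 0 \<Longrightarrow> \<psi> \<in> L2 \<Longrightarrow> L2_inner (\<sigma> t) \<psi> = lam * L2_inner (\<tau> t) \<psi> - a * \<rho> * L2_inner (P t) \<psi>"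
  unfolding \<sigma>_def by (subst L2_inner_diff_left) (simp_all only: L2_cmult tau_L2 P_L2 L2_inner_cmult_left)

lemma one_one: "L2_inner (\<lambda>_. 1) (\<lambda>_. 1) = 1"
  by (simp add: L2_inner_def)

lemma Z_mean: "t \<ge> 0 \<Longrightarrow> L2_inner (Z t) (\<lambda>_. 1) = 0"
  by (simp add: Z_inner sigma_inner P_mean one_one m_def)

text \<open>
Averaging the constitutive law removes the velocity gradient: \<open>\<lambda> m' = - q\<close>.
\<close>

definition q :: "real \<Rightarrow> real"
  where "q t = L2_inner (\<lambda>y. f t y * \<tau> t y) (\<lambda>_. 1)"

lemma q_cont: "continuous_on {0..} q"
  unfolding q_def[abs_def] by (rule continuous_on_L2_inner[OF ftau_L2cont L2_continuous_on_const]) simp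

lemma m_deriv:
  assumes "t \<ge> 0"
  shows "(m has_real_derivative - q t / lam) (at t within {0..})"
proof -
  have "L2_inner (\<lambda>y. G * ux t y - f t y * \<tau> t y) (\<lambda>_. 1) = - q t"
    using assms by (simp add: L2_inner_diff_left L2_cmult ux_L2 ftau_L2 L2_inner_cmult_left ux_mean q_def)
  then show ?thesis using constitutive[OF L2_const[of 1] assms] by (simp add: m_def[abs_def])
qed

text \<open>
The time derivative of \<open>Z\<close>.
\<close>

definition Zt :: "real \<Rightarrow> real \<Rightarrow> real"
  where "Zt t y = (a * m t - (a + f t y) * \<tau> t y) + q t"

lemma Zt_cont: "continuous_on ({0..} \<times> {0..1}) (\<lambda>(t,y). Zt t y)"
  using tau_cont f_cont comp_fst_continuous[OF m_cont] comp_fst_continuous[OF q_cont]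
  unfolding Zt_def case_prod_unfold by (intro continuous_intros)

lemma Zt_inner:
  assumes t: "t \<ge> 0" and \<psi>: "\<psi> \<in> L2"
  shows "L2_inner (Zt t) \<psi> = L2_inner (\<lambda>y. a * m t - (a + f t y) * \<tau> t y) \<psi> + q t * L2_inner \<psi> (\<lambda>_. 1)"
proof -
  have "(\<lambda>y. a * m t - (a + f t y) * \<tau> t y) \<in> L2"
    by (intro continuous_L2 continuous_intros tau_slice f_slice t)
  then show ?thesis
    unfolding Zt_def by (subst L2_inner_add_left) (simp_all only: \<psi> L2_const L2_inner_const_left)
qed

lemma Z_weak_deriv:
  assumes \<psi>: "\<psi> \<in> L2" and t: "t \<ge> 0"
  shows "((\<lambda>t. L2_inner (Z t) \<psi>) has_real_derivative L2_inner (Zt t) \<psi>) (at t within {0..})"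
proof -
  have "((\<lambda>t. L2_inner (\<sigma> t) \<psi> - lam * m t * L2_inner \<psi> (\<lambda>_. 1)) has_real_derivative
      L2_inner (\<lambda>y. a * m t - (a + f t y) * \<tau> t y) \<psi> - lam * (- q t / lam) * L2_inner \<psi> (\<lambda>_. 1)) (at t within {0..})"
    by (intro DERIV_diff DERIV_cmult DERIV_cmult_right sigma_weak_deriv m_deriv \<psi> t)
  moreover have "lam * (- q t / lam) = - q t" using pos by simp
  ultimately have "((\<lambda>t. L2_inner (\<sigma> t) \<psi> - lam * m t * L2_inner \<psi> (\<lambda>_. 1)) has_real_derivative
      L2_inner (Zt t) \<psi>) (at t within {0..})"
    by (simp only: Zt_inner[OF t \<psi>] mult_minus_left diff_minus_eq_add)
  then show ?thesis
    by (rule has_field_derivative_transform_within[OF _ zero_less_one]) (use t \<psi> in \<open>simp_all add: Z_inner\<close>)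
qed

text \<open>
Only the damping and the forcing by \<open>P\<close> and \<open>f \<tau>\<close> survive: the terms that are constant in space are
orthogonal to \<open>Z\<close>, which has mean zero.
\<close>

lemma Z_square_deriv:
  assumes t: "t \<ge> 0"
  shows "((\<lambda>t. L2_inner (Z t) (Z t)) has_real_derivative
    - (2 * a / lam) * L2_inner (Z t) (Z t) - (2 * a\<^sup>2 * \<rho> / lam) * L2_inner (P t) (Z t)
      - 2 * L2_inner (\<lambda>y. f t y * \<tau> t y) (Z t)) (at t within {0..})"
proof -
  have "((\<lambda>t. L2_inner (Z t) (Z t)) has_real_derivative 2 * L2_inner (Zt t) (Z t)) (at t within {0..})"
  proof (rule L2_energy_identity[OF Z_L2 _ _ _ t])
    show "L2_continuous_on {0..} Z" "L2_continuous_on {0..} Zt"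
      using joint_continuous_imp_L2_continuous_on Z_cont Zt_cont by blast+
  qed (simp_all only: Z_weak_deriv L2_add Z_L2)
  moreover have "2 * L2_inner (Zt t) (Z t) = - (2 * a / lam) * L2_inner (Z t) (Z t)
      - (2 * a\<^sup>2 * \<rho> / lam) * L2_inner (P t) (Z t) - 2 * L2_inner (\<lambda>y. f t y * \<tau> t y) (Z t)"
  proof -
    define X where "X = L2_inner (\<tau> t) (Z t)"
    have "lam * X = L2_inner (Z t) (Z t) + a * \<rho> * L2_inner (P t) (Z t)"
      using Z_inner[OF t Z_L2[OF t]] sigma_inner[OF t Z_L2[OF t]] by (simp add: Z_mean[OF t] X_def)
    then have X: "X = (L2_inner (Z t) (Z t) + a * \<rho> * L2_inner (P t) (Z t)) / lam"
      using pos by (simp add: field_simps)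
    have "(\<lambda>y. a * m t - (a + f t y) * \<tau> t y) = (\<lambda>y. a * m t - a * \<tau> t y - f t y * \<tau> t y)"
      by (auto simp: algebra_simps)
    then have "L2_inner (Zt t) (Z t) = - a * X - L2_inner (\<lambda>y. f t y * \<tau> t y) (Z t)"
      using t unfolding Zt_inner[OF t Z_L2[OF t]] X_def
      by (simp add: L2_inner_diff_left L2_diff L2_cmult tau_L2 ftau_L2 Z_L2 L2_inner_cmult_left L2_inner_const_left Z_mean)
    then show ?thesis unfolding X using pos by (simp add: power2_eq_square add_divide_distrib distrib_left)
  qed
  ultimately show ?thesis by simp
qed

lemma P_square_le:
  assumes t: "t \<ge> 0"
  shows "L2_inner (P t) (P t) \<le> 4 * L2_inner (ux t) (ux t)"
proof -
  have "L2_norm (P t) \<le> 2 * L2_norm (ux t)" using P_norm_le[OF t] u_Poincare[OF t] by linarith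
  then have "(L2_norm (P t))\<^sup>2 \<le> (2 * L2_norm (ux t))\<^sup>2" by (intro power_mono) auto
  then show ?thesis by (simp add: power_mult_distrib L2_norm_square)
qed

lemma ux_square_le_dissipation:
  assumes t: "t \<ge> 0"
  shows "L2_inner (ux t) (ux t) \<le> dissipation t / (\<eta> * G)"
  using ftau_tau_nonneg[OF t] pos by (simp add: dissipation_def field_simps)

lemma ftau_tau_le_dissipation: "L2_inner (\<lambda>y. f t y * \<tau> t y) (\<tau> t) \<le> dissipation t"
  using pos by (simp add: dissipation_def)

text \<open>
Young's inequality spends half of the damping \<open>2 a / \<lambda>\<close> on the two mixed terms, a quarter on each.
The rest is dissipation, since \<open>\<parallel>P\<parallel> \<le> 2 \<parallel>u\<^sub>y\<parallel>\<close> and \<open>\<parallel>f \<tau>\<parallel>\<^sup>2 \<le> F0 \<langle>f \<tau>, \<tau>\<rangle>\<close> for a bound \<open>F0\<close> of \<open>f\<close>.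
\<close>

lemma Z_square_deriv_bound:
  obtains C where "C > 0" "\<And>t. t \<ge> 0 \<Longrightarrow>
    - (2 * a / lam) * L2_inner (Z t) (Z t) - (2 * a\<^sup>2 * \<rho> / lam) * L2_inner (P t) (Z t)
      - 2 * L2_inner (\<lambda>y. f t y * \<tau> t y) (Z t) \<le> - (a / lam) * L2_inner (Z t) (Z t) + C * dissipation t"
proof -
  obtain F0 where F0: "F0 > 0" "\<And>t y. t \<ge> 0 \<Longrightarrow> y \<in> {0..1} \<Longrightarrow> f t y \<le> F0" using f_bounded by blast
  \<comment> \<open>Young weights for the terms with \<open>P\<close> and with \<open>f \<tau>\<close>; each uses up \<open>a / (2 \<lambda>)\<close> of the damping.\<close>
  define c1 where "c1 = 1 / (2 * a * \<rho>)"
  define c2 where "c2 = 2 * lam / a"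
  have c: "c1 > 0" "c2 > 0" using a_pos pos by (simp_all add: c1_def c2_def)
  define k where "k = a\<^sup>2 * \<rho> / lam"
  have k: "k > 0" using a_pos pos by (simp add: k_def)
  define C where "C = k / c1 * (4 / (\<eta> * G)) + c2 * F0"
  have "C > 0" unfolding C_def using k c pos F0 by (intro add_pos_pos mult_pos_pos divide_pos_pos) auto
  moreover have "- (2 * a / lam) * L2_inner (Z t) (Z t) - (2 * a\<^sup>2 * \<rho> / lam) * L2_inner (P t) (Z t)
      - 2 * L2_inner (\<lambda>y. f t y * \<tau> t y) (Z t) \<le> - (a / lam) * L2_inner (Z t) (Z t) + C * dissipation t"
    if t: "t \<ge> 0" for t
  proof -
    define z where "z = L2_inner (Z t) (Z t)"
    define p where "p = L2_inner (P t) (P t)"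
    define r where "r = L2_inner (\<lambda>y. f t y * \<tau> t y) (\<lambda>y. f t y * \<tau> t y)"
    define d where "d = dissipation t"
    have "\<bar>2 * L2_inner (Z t) (P t)\<bar> \<le> c1 * z + p / c1"
      unfolding z_def p_def by (rule L2_Young_abs[OF Z_L2[OF t] P_L2[OF t] c(1)])
    then have *: "k * - (2 * L2_inner (P t) (Z t)) \<le> k * (c1 * z + p / c1)"
      using k by (intro mult_left_mono) (auto simp: L2_inner_commute[of "P t"])
    have 1: "- (2 * a\<^sup>2 * \<rho> / lam) * L2_inner (P t) (Z t) \<le> k * c1 * z + k / c1 * p"
    proof -
      have "- (2 * a\<^sup>2 * \<rho> / lam) * L2_inner (P t) (Z t) = k * - (2 * L2_inner (P t) (Z t))"
        by (simp add: k_def)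
      also note *
      also have "k * (c1 * z + p / c1) = k * c1 * z + k / c1 * p" by (simp add: distrib_left)
      finally show ?thesis .
    qed
    have "\<bar>2 * L2_inner (\<lambda>y. f t y * \<tau> t y) (Z t)\<bar> \<le> c2 * r + z / c2"
      unfolding z_def r_def by (rule L2_Young_abs[OF ftau_L2[OF t] Z_L2[OF t] c(2)])
    then have 2: "- 2 * L2_inner (\<lambda>y. f t y * \<tau> t y) (Z t) \<le> c2 * r + z / c2" by simp
    have kc: "k * c1 = (a / lam) / 2" using a_pos pos by (simp add: k_def c1_def power2_eq_square)
    have zc: "z / c2 = (a / lam) / 2 * z" using a_pos pos by (simp add: c2_def mult.commute)
    have "p \<le> 4 / (\<eta> * G) * d"
      using P_square_le[OF t] ux_square_le_dissipation[OF t] by (simp add: p_def d_def)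
    then have 3: "k / c1 * p \<le> k / c1 * (4 / (\<eta> * G) * d)" using k c by (intro mult_left_mono) auto
    have "r \<le> F0 * L2_inner (\<lambda>y. f t y * \<tau> t y) (\<tau> t)" unfolding r_def by (rule ftau_norm_le[OF F0(2) t])
    also have "\<dots> \<le> F0 * d" using ftau_tau_le_dissipation[of t] F0(1) by (simp add: d_def)
    finally have 4: "c2 * r \<le> c2 * (F0 * d)" using c by (intro mult_left_mono) auto
    have "C * d = k / c1 * (4 / (\<eta> * G) * d) + c2 * (F0 * d)" by (simp add: C_def distrib_right)
    moreover have "- (2 * a / lam) * z = - (a / lam) * z - (a / lam) / 2 * z - (a / lam) / 2 * z" by simp
    ultimately show ?thesis using 1 2 3 4 unfolding kc zc z_def[symmetric] d_def[symmetric] by linarith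
  qed
  ultimately show ?thesis by (rule that)
qed

lemma Z_tendsto_0: "((\<lambda>t. L2_inner (Z t) (Z t)) \<longlongrightarrow> 0) at_top"
proof -
  obtain C where C: "C > 0" "\<And>t. t \<ge> 0 \<Longrightarrow>
    - (2 * a / lam) * L2_inner (Z t) (Z t) - (2 * a\<^sup>2 * \<rho> / lam) * L2_inner (P t) (Z t)
      - 2 * L2_inner (\<lambda>y. f t y * \<tau> t y) (Z t) \<le> - (a / lam) * L2_inner (Z t) (Z t) + C * dissipation t"
    using Z_square_deriv_bound by blast
  show ?thesis
  proof (rule Lyapunov_tendsto_0[where V = "\<lambda>t. C * energy t" and V' = "\<lambda>t. C * - dissipation t" and c = "a / lam", OF Z_square_deriv])
    show "((\<lambda>t. C * energy t) has_real_derivative C * - dissipation t) (at t within {0..})" if "t \<ge> 0" for t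
      by (intro DERIV_cmult energy_deriv that)
    show "C * - dissipation t \<le> 0" if "t \<ge> 0" for t using dissipation_nonneg[OF that] C(1) by simp
    show "0 \<le> C * energy t" for t using energy_nonneg[of t] C(1) by simp
    show "a / lam > 0" using a_pos pos by simp
  qed (use C(2) in force)+
qed

text \<open>
The stress fluctuation itself. It is what \<open>u\<close> feels, because \<open>u\<^sub>y\<close> has mean zero.
\<close>

definition D :: "real \<Rightarrow> real \<Rightarrow> real"
  where "D t y = \<tau> t y - m t"

lemma D_L2: "t \<ge> 0 \<Longrightarrow> D t \<in> L2"
  unfolding D_def by (intro L2_diff tau_L2 L2_const)

lemma D_square_le:
  assumes t: "t \<ge> 0"
  shows "lam\<^sup>2 * L2_inner (D t) (D t) \<le> 2 * L2_inner (Z t) (Z t) + 2 * (a * \<rho>)\<^sup>2 * L2_inner (P t) (P t)"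
proof -
  have eq: "(\<lambda>y. lam * D t y) = (\<lambda>y. Z t y + a * \<rho> * P t y)"
    by (auto simp: D_def Z_def \<sigma>_def algebra_simps)
  have aP: "(\<lambda>y. a * \<rho> * P t y) \<in> L2" by (intro L2_cmult P_L2 t)
  have "lam\<^sup>2 * L2_inner (D t) (D t) = L2_inner (\<lambda>y. lam * D t y) (\<lambda>y. lam * D t y)"
    by (simp add: L2_inner_cmult_left L2_inner_cmult_right power2_eq_square)
  also have "\<dots> = L2_inner (Z t) (Z t) + 2 * L2_inner (Z t) (\<lambda>y. a * \<rho> * P t y)
      + L2_inner (\<lambda>y. a * \<rho> * P t y) (\<lambda>y. a * \<rho> * P t y)"
    unfolding eq by (rule L2_inner_self_add[OF Z_L2[OF t] aP])
  also have "\<dots> \<le> 2 * L2_inner (Z t) (Z t) + 2 * L2_inner (\<lambda>y. a * \<rho> * P t y) (\<lambda>y. a * \<rho> * P t y)"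
    using L2_Young[OF Z_L2[OF t] aP zero_less_one] by simp
  also have "L2_inner (\<lambda>y. a * \<rho> * P t y) (\<lambda>y. a * \<rho> * P t y) = (a * \<rho>)\<^sup>2 * L2_inner (P t) (P t)"
    unfolding L2_inner_cmult_left L2_inner_cmult_right by (simp add: power2_eq_square)
  finally show ?thesis by simp
qed

lemma tau_ux: "t \<ge> 0 \<Longrightarrow> L2_inner (\<tau> t) (ux t) = L2_inner (D t) (ux t)"
  unfolding D_def by (subst L2_inner_diff_left) (simp_all add: tau_L2 ux_L2 L2_inner_const_left ux_mean)

text \<open>
Viscosity damps \<open>u\<close>, and the forcing \<open>\<parallel>D\<parallel>\<^sup>2\<close> is at most a combination of \<open>\<parallel>Z\<parallel>\<^sup>2\<close> and the dissipation.
Adding suitable multiples of \<open>\<parallel>Z\<parallel>\<^sup>2\<close> and of the energy to the Lyapunov function pays for both.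
\<close>

lemma u_tendsto_0: "((\<lambda>t. L2_inner (u t) (u t)) \<longlongrightarrow> 0) at_top"
proof -
  obtain C where C: "C > 0" "\<And>t. t \<ge> 0 \<Longrightarrow>
    - (2 * a / lam) * L2_inner (Z t) (Z t) - (2 * a\<^sup>2 * \<rho> / lam) * L2_inner (P t) (Z t)
      - 2 * L2_inner (\<lambda>y. f t y * \<tau> t y) (Z t) \<le> - (a / lam) * L2_inner (Z t) (Z t) + C * dissipation t"
    using Z_square_deriv_bound by blast
  let ?Z' = "\<lambda>t. - (2 * a / lam) * L2_inner (Z t) (Z t) - (2 * a\<^sup>2 * \<rho> / lam) * L2_inner (P t) (Z t)
      - 2 * L2_inner (\<lambda>y. f t y * \<tau> t y) (Z t)"
  let ?u' = "\<lambda>t. - 2 / \<rho> * (\<eta> * L2_inner (ux t) (ux t) + L2_inner (\<tau> t) (ux t))"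
  \<comment> \<open>\<open>k \<lambda>\<^sup>2\<close> is the coefficient of \<open>\<parallel>D\<parallel>\<^sup>2\<close> in the estimate of \<open>\<parallel>u\<parallel>\<^sup>2\<close>. The multiple \<open>C1\<close> makes the damping of \<open>Z\<close> pay
    for the part of \<open>\<parallel>D\<parallel>\<^sup>2\<close> in \<open>Z\<close>, and \<open>C2\<close> makes the dissipation pay for the rest.\<close>
  define k where "k = 1 / (\<eta> * \<rho> * lam\<^sup>2)"
  define C1 where "C1 = 2 * k * lam / a"
  define C2 where "C2 = C1 * C + 2 * k * (a * \<rho>)\<^sup>2 * (4 / (\<eta> * G))"
  have k: "k > 0" using pos by (simp add: k_def)
  have C1: "C1 > 0" using k pos a_pos by (simp add: C1_def)
  have C2: "C2 > 0" unfolding C2_def using k pos a_pos C1 C by (intro add_pos_pos mult_pos_pos) auto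
  have V'_le: "C1 * ?Z' t + C2 * - dissipation t
      \<le> - (2 * k * L2_inner (Z t) (Z t)) - 2 * k * (a * \<rho>)\<^sup>2 * (4 / (\<eta> * G)) * dissipation t" if t: "t \<ge> 0" for t
  proof -
    have "C1 * ?Z' t \<le> C1 * (- (a / lam) * L2_inner (Z t) (Z t) + C * dissipation t)"
      using C1 C(2)[OF t] by (intro mult_left_mono) auto
    also have "\<dots> = - (2 * k * L2_inner (Z t) (Z t)) + C1 * C * dissipation t"
      using pos a_pos by (simp add: C1_def field_simps)
    finally show ?thesis by (simp add: C2_def distrib_right)
  qed
  show ?thesis
  proof (rule Lyapunov_tendsto_0[where V = "\<lambda>t. C1 * L2_inner (Z t) (Z t) + C2 * energy t" and
        V' = "\<lambda>t. C1 * ?Z' t + C2 * - dissipation t" and c = "\<eta> / \<rho>", OF u_square_deriv])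
    fix t :: real assume t: "t \<ge> 0"
    show "((\<lambda>t. C1 * L2_inner (Z t) (Z t) + C2 * energy t) has_real_derivative C1 * ?Z' t + C2 * - dissipation t) (at t within {0..})"
      by (intro DERIV_add DERIV_cmult energy_deriv Z_square_deriv t)
    show "0 \<le> C1 * L2_inner (Z t) (Z t) + C2 * energy t" using C1 C2 energy_nonneg[of t] by simp
    have d: "dissipation t \<ge> 0" by (rule dissipation_nonneg[OF t])
    have "2 * k * L2_inner (Z t) (Z t) \<ge> 0" using k by simp
    moreover have "2 * k * (a * \<rho>)\<^sup>2 * (4 / (\<eta> * G)) * dissipation t \<ge> 0" using k pos d by simp
    ultimately show "C1 * ?Z' t + C2 * - dissipation t \<le> 0" using V'_le[OF t] by linarith
    define X where "X = L2_inner (ux t) (ux t)"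
    define DD where "DD = L2_inner (D t) (D t)"
    define UU where "UU = L2_inner (u t) (u t)"
    define TX where "TX = L2_inner (\<tau> t) (ux t)"
    have "\<bar>2 * L2_inner (D t) (ux t)\<bar> \<le> (1 / \<eta>) * DD + X / (1 / \<eta>)"
      unfolding DD_def X_def using pos by (intro L2_Young_abs D_L2 ux_L2 t) simp
    then have "- 2 * TX \<le> DD / \<eta> + \<eta> * X"
      using tau_ux[OF t] by (simp add: TX_def mult.commute add.commute)
    then have "- 2 * TX - 2 * \<eta> * X \<le> DD / \<eta> - \<eta> * X" by linarith
    then have "(1 / \<rho>) * (- 2 * TX - 2 * \<eta> * X) \<le> (1 / \<rho>) * (DD / \<eta> - \<eta> * X)"
      by (rule mult_left_mono) (use pos in simp)
    moreover have "- 2 / \<rho> * (\<eta> * X + TX) = (1 / \<rho>) * (- 2 * TX - 2 * \<eta> * X)"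
      by (simp add: algebra_simps add_divide_distrib)
    moreover have "(1 / \<rho>) * (DD / \<eta> - \<eta> * X) = k * (lam\<^sup>2 * DD) - \<eta> / \<rho> * X"
      using pos by (simp add: k_def diff_divide_distrib)
    ultimately have 1: "- 2 / \<rho> * (\<eta> * X + TX) \<le> k * (lam\<^sup>2 * DD) - \<eta> / \<rho> * X" by linarith
    have "k * (lam\<^sup>2 * DD) \<le> k * (2 * L2_inner (Z t) (Z t) + 2 * (a * \<rho>)\<^sup>2 * L2_inner (P t) (P t))"
      unfolding DD_def using k by (intro mult_left_mono D_square_le t) simp
    also have "\<dots> = 2 * k * L2_inner (Z t) (Z t) + 2 * k * (a * \<rho>)\<^sup>2 * L2_inner (P t) (P t)"
      by (simp add: distrib_left)
    also have "\<dots> \<le> 2 * k * L2_inner (Z t) (Z t) + 2 * k * (a * \<rho>)\<^sup>2 * (4 / (\<eta> * G) * dissipation t)"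
      using P_square_le[OF t] ux_square_le_dissipation[OF t] k pos a_pos
      by (intro add_left_mono mult_left_mono) auto
    finally have 2: "k * (lam\<^sup>2 * DD) \<le> 2 * k * L2_inner (Z t) (Z t) + 2 * k * (a * \<rho>)\<^sup>2 * (4 / (\<eta> * G)) * dissipation t"
      by (simp add: mult.assoc)
    have "UU \<le> X"
      using power_mono[OF u_Poincare[OF t], of 2] by (simp add: UU_def X_def L2_norm_square)
    then have 3: "\<eta> / \<rho> * UU \<le> \<eta> / \<rho> * X" using pos by (intro mult_left_mono) auto
    have "- 2 / \<rho> * (\<eta> * X + TX) + (C1 * ?Z' t + C2 * - dissipation t) \<le> - (\<eta> / \<rho>) * UU"
    proof -
      have "A + V \<le> - w" if "A \<le> B - e" "B \<le> c + d" "w \<le> e" "V \<le> - c - d" for A B V c d e w :: real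
        using that by linarith
      from this[OF 1 2 3 V'_le[OF t]] show ?thesis by (simp only: mult_minus_left)
    qed
    then show "- 2 / \<rho> * (\<eta> * L2_inner (ux t) (ux t) + L2_inner (\<tau> t) (ux t)) + (C1 * ?Z' t + C2 * - dissipation t)
      \<le> - (\<eta> / \<rho>) * L2_inner (u t) (u t)"
      unfolding X_def TX_def UU_def .
  qed (use pos in auto)
qed

lemma P_uniform_tendsto_0:
  assumes e: "e > 0"
  shows "\<forall>\<^sub>F t in at_top. \<forall>y\<in>{0..1}. \<bar>P t y\<bar> \<le> e"
proof -
  have "((\<lambda>t. 2 * sqrt (L2_inner (u t) (u t))) \<longlongrightarrow> 2 * sqrt 0) at_top"
    by (intro tendsto_intros u_tendsto_0)
  then have "\<forall>\<^sub>F t in at_top. 2 * sqrt (L2_inner (u t) (u t)) < e"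
    using e by (intro order_tendstoD(2)) auto
  then show ?thesis using eventually_ge_at_top[of "0::real"]
  proof eventually_elim
    case (elim t)
    show ?case
    proof
      fix y :: real assume y: "y \<in> {0..1}"
      show "\<bar>P t y\<bar> \<le> e" using P_sup_le[OF elim(2) y] elim(1) unfolding L2_norm_eq by linarith
    qed
  qed
qed

lemma D_tendsto_0: "((\<lambda>t. L2_inner (D t) (D t)) \<longlongrightarrow> 0) at_top"
proof (rule tendsto_sandwich[OF _ _ tendsto_const])
  let ?b = "\<lambda>t. (2 * L2_inner (Z t) (Z t) + 2 * (a * \<rho>)\<^sup>2 * (4 * L2_inner (u t) (u t))) / lam\<^sup>2"
  show "\<forall>\<^sub>F t in at_top. L2_inner (D t) (D t) \<le> ?b t"
    using eventually_ge_at_top[of "0::real"]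
  proof eventually_elim
    case (elim t)
    have "(L2_norm (P t))\<^sup>2 \<le> (2 * L2_norm (u t))\<^sup>2"
      using P_norm_le[OF elim] by (intro power_mono) auto
    then have "L2_inner (P t) (P t) \<le> 4 * L2_inner (u t) (u t)"
      by (simp add: power_mult_distrib L2_norm_square)
    then have "2 * (a * \<rho>)\<^sup>2 * L2_inner (P t) (P t) \<le> 2 * (a * \<rho>)\<^sup>2 * (4 * L2_inner (u t) (u t))"
      by (intro mult_left_mono) auto
    then have "lam\<^sup>2 * L2_inner (D t) (D t) \<le> 2 * L2_inner (Z t) (Z t) + 2 * (a * \<rho>)\<^sup>2 * (4 * L2_inner (u t) (u t))"
      using D_square_le[OF elim] by linarith
    then show ?case using pos by (simp add: pos_le_divide_eq mult.commute)
  qed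
  have "(?b \<longlongrightarrow> (2 * 0 + 2 * (a * \<rho>)\<^sup>2 * (4 * 0)) / lam\<^sup>2) at_top"
    using pos by (intro tendsto_intros Z_tendsto_0 u_tendsto_0) simp
  then show "(?b \<longlongrightarrow> 0) at_top" by simp
qed simp

section \<open>Decay of the mean stress\<close>

text \<open>
Orthogonal decomposition of the stress into its mean and its fluctuation.
\<close>

lemma tau_square_eq: "t \<ge> 0 \<Longrightarrow> L2_inner (\<tau> t) (\<tau> t) = (m t)\<^sup>2 + L2_inner (D t) (D t)"
proof -
  assume t: "t \<ge> 0"
  have "L2_inner (D t) (D t) = L2_inner (\<tau> t) (\<tau> t) - 2 * L2_inner (\<tau> t) (\<lambda>_. m t) + L2_inner (\<lambda>_. m t) (\<lambda>_. m t)"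
    unfolding D_def by (rule L2_inner_self_diff[OF tau_L2[OF t] L2_const])
  moreover have "L2_inner (\<tau> t) (\<lambda>_. m t) = (m t)\<^sup>2"
    by (simp add: L2_inner_commute[of "\<tau> t" "\<lambda>_. m t"] L2_inner_const_left power2_eq_square flip: m_def)
  moreover have "L2_inner (\<lambda>_. m t) (\<lambda>_. m t) = (m t)\<^sup>2"
    by (simp add: L2_inner_def power2_eq_square)
  ultimately show ?thesis by simp
qed

text \<open>
Of the energy only the mean stress survives in the limit, because \<open>u\<close> and \<open>D\<close> tend to zero.
\<close>

lemma m_square_tendsto:
  assumes "(energy \<longlongrightarrow> l) at_top"
  shows "((\<lambda>t. (m t)\<^sup>2) \<longlongrightarrow> 2 * l / lam) at_top"
proof -
  have "((\<lambda>t. (2 * energy t - \<rho> * G * L2_inner (u t) (u t)) / lam - L2_inner (D t) (D t)) \<longlongrightarrow>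
      (2 * l - \<rho> * G * 0) / lam - 0) at_top"
    using pos by (intro tendsto_intros assms u_tendsto_0 D_tendsto_0) simp
  moreover have "\<forall>\<^sub>F t in at_top. (2 * energy t - \<rho> * G * L2_inner (u t) (u t)) / lam - L2_inner (D t) (D t) = (m t)\<^sup>2"
    using eventually_ge_at_top[of "0::real"]
    by eventually_elim (use pos in \<open>simp add: energy_def tau_square_eq field_simps\<close>)
  ultimately have "((\<lambda>t. (m t)\<^sup>2) \<longlongrightarrow> (2 * l - \<rho> * G * 0) / lam - 0) at_top"
    by (rule Lim_transform_eventually)
  then show ?thesis by simp
qed

lemma m_eventually_one_sign:
  assumes c: "c > 0" and S: "S \<ge> 0" and m2: "\<And>t. t \<ge> S \<Longrightarrow> c\<^sup>2 \<le> (m t)\<^sup>2"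
  obtains s where "s = 1 \<or> s = - 1" "\<And>t. t \<ge> S \<Longrightarrow> c \<le> s * m t"
proof -
  have abs: "c \<le> \<bar>m t\<bar>" if "t \<ge> S" for t
    using m2[OF that] c by (metis abs_le_square_iff abs_of_pos)
  have cont: "continuous_on {S..t} m" for t
    by (rule continuous_on_subset[OF m_cont]) (use S in auto)
  define s :: real where "s = (if m S > 0 then 1 else - 1)"
  have "c \<le> s * m t" if t: "t \<ge> S" for t
  proof (rule ccontr)
    assume "\<not> c \<le> s * m t"
    then have neg: "s * m t \<le> 0" using abs[OF t] c by (auto simp: s_def abs_if split: if_splits)
    have pos': "s * m S \<ge> 0" using abs[of S] c by (auto simp: s_def)
    have "continuous_on {S..t} (\<lambda>x. s * m x)" by (intro continuous_intros cont)
    from IVT2'[of "\<lambda>x. s * m x", OF neg pos' t this] have "\<exists>x\<ge>S. x \<le> t \<and> s * m x = 0" .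
    then obtain x where x: "x \<ge> S" "s * m x = 0" by blast
    then have "m x = 0" by (auto simp: s_def split: if_splits)
    then show False using abs[OF x(1)] c by simp
  qed
  moreover have "s = 1 \<or> s = - 1" by (simp add: s_def)
  ultimately show ?thesis using that by blast
qed

text \<open>
With \<open>s\<close> the eventual sign of \<open>m\<close>, the relaxation target of \<open>s \<sigma>\<close> is eventually at least \<open>3 k / 4\<close> for
\<open>k = \<lambda> a c / (a + F0)\<close>, where \<open>F0\<close> bounds \<open>f\<close>. The transient and the correction by \<open>P\<close> that leads from
\<open>\<sigma>\<close> to \<open>\<lambda> \<tau>\<close> cost at most \<open>k / 4\<close> each, which leaves \<open>k / 4\<close> for \<open>s \<lambda> \<tau>\<close>.
\<close>

lemma tau_bounded_below:
  assumes c: "c > 0" and S: "S \<ge> 0" and m2: "\<And>t. t \<ge> S \<Longrightarrow> c\<^sup>2 \<le> (m t)\<^sup>2"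
  obtains c0 S' where "c0 > 0" "S' \<ge> 0" "\<And>t y. t \<ge> S' \<Longrightarrow> y \<in> {0..1} \<Longrightarrow> c0 \<le> \<bar>\<tau> t y\<bar>"
proof -
  obtain s where s: "s = 1 \<or> s = - 1" "\<And>t. t \<ge> S \<Longrightarrow> c \<le> s * m t"
    using m_eventually_one_sign[OF c S m2] by blast
  obtain F0 where F0: "F0 > 0" "\<And>t y. t \<ge> 0 \<Longrightarrow> y \<in> {0..1} \<Longrightarrow> f t y \<le> F0" using f_bounded by blast
  obtain B where B: "B \<ge> 0" "\<And>t y. t \<ge> 0 \<Longrightarrow> y \<in> {0..1} \<Longrightarrow> \<bar>\<sigma> t y\<bar> \<le> B" using sigma_bounded by blast
  define k where "k = lam * a * c / (a + F0)"
  have k: "k > 0" using pos a_pos c F0 by (simp add: k_def)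
  have "\<forall>\<^sub>F t in at_top. \<forall>y\<in>{0..1}. \<bar>P t y\<bar> \<le> k / 4 / (a * \<rho>)"
    by (rule P_uniform_tendsto_0) (use k a_pos pos in simp)
  then obtain S1 where S1: "\<And>t y. t \<ge> S1 \<Longrightarrow> y \<in> {0..1} \<Longrightarrow> \<bar>P t y\<bar> \<le> k / 4 / (a * \<rho>)"
    unfolding eventually_at_top_linorder by blast
  define R where "R = max S S1"
  have R: "R \<ge> 0" "R \<ge> S" "R \<ge> S1" using S by (auto simp: R_def)
  have P: "\<bar>a * \<rho> * P t y\<bar> \<le> k / 4" if "t \<ge> R" "y \<in> {0..1}" for t y
  proof -
    have "\<bar>a * \<rho> * P t y\<bar> = (a * \<rho>) * \<bar>P t y\<bar>" using a_pos pos by (simp add: abs_mult)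
    also have "\<dots> \<le> (a * \<rho>) * (k / 4 / (a * \<rho>))"
      using that R a_pos pos by (intro mult_left_mono S1) auto
    also have "\<dots> = k / 4" using a_pos pos by simp
    finally show ?thesis .
  qed
  have sP: "\<bar>s * (a * \<rho> * P t y)\<bar> \<le> k / 4" if "t \<ge> R" "y \<in> {0..1}" for t y
    using P[OF that] s(1) by auto
  have decay: "((\<lambda>t. (k + B) * exp (- (a / lam) * (t - R))) \<longlongrightarrow> (k + B) * 0) at_top"
    by (intro tendsto_intros exp_decay) (use a_pos pos in simp)
  then have "\<forall>\<^sub>F t in at_top. (k + B) * exp (- (a / lam) * (t - R)) < k / 4"
    using k by (intro order_tendstoD(2)[OF decay]) auto
  then obtain S2 where S2: "\<And>t. t \<ge> S2 \<Longrightarrow> (k + B) * exp (- (a / lam) * (t - R)) < k / 4"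
    unfolding eventually_at_top_linorder by blast
  define S' where "S' = max R S2"
  have "k / 4 / lam \<le> \<bar>\<tau> t y\<bar>" if t: "t \<ge> S'" and y: "y \<in> {0..1}" for t y
  proof -
    have tR: "t \<ge> R" "t \<ge> S2" "t \<ge> 0" using t R by (auto simp: S'_def)
    let ?q = "\<lambda>t. s * (lam * a * m t / (a + f t y) - a * \<rho> * P t y)"
    have "(k - k / 4) - max 0 ((k - k / 4) - s * \<sigma> R y) * exp (- (a / lam) * (t - R)) \<le> s * \<sigma> t y"
    proof (rule relaxation_lower_bound[where p = "\<lambda>t. (a + f t y) / lam" and q = ?q, OF _ R(1) _ _ _ tR(1)])
      fix t :: real assume t: "t \<ge> 0"
      show "((\<lambda>t. s * \<sigma> t y) has_real_derivative - ((a + f t y) / lam) * (s * \<sigma> t y - ?q t)) (at t within {0..})"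
        using DERIV_cmult[OF sigma_relaxation[OF t y], of s] by (simp add: right_diff_distrib mult.left_commute)
    next
      show "0 \<le> a / lam" using a_pos pos by simp
      fix t :: real assume t: "t \<ge> R"
      then have t0: "t \<ge> 0" "t \<ge> S" using R by auto
      have f: "0 \<le> f t y" "f t y \<le> F0" using f_nonneg F0(2) t0 y by auto
      show "a / lam \<le> (a + f t y) / lam" using f pos by (simp add: divide_right_mono)
      have "k \<le> lam * a * (s * m t) / (a + f t y)"
        unfolding k_def using f a_pos pos c s(2)[OF t0(2)] by (intro frac_le mult_left_mono) auto
      moreover have "?q t = lam * a * (s * m t) / (a + f t y) - s * (a * \<rho> * P t y)"
        by (simp add: right_diff_distrib mult.left_commute)
      ultimately show "k - k / 4 \<le> ?q t" using sP[OF t y] by linarith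
    qed
    moreover have "max 0 ((k - k / 4) - s * \<sigma> R y) * exp (- (a / lam) * (t - R)) \<le> (k + B) * exp (- (a / lam) * (t - R))"
    proof (rule mult_right_mono)
      have "\<bar>s * \<sigma> R y\<bar> \<le> B" using B(2)[OF R(1) y] s(1) by auto
      then show "max 0 ((k - k / 4) - s * \<sigma> R y) \<le> k + B" using k B(1) by auto
    qed simp
    ultimately have "k / 2 \<le> s * \<sigma> t y" using S2[OF tR(2)] by linarith
    moreover have "s * (lam * \<tau> t y) = s * \<sigma> t y + s * (a * \<rho> * P t y)"
      by (simp add: \<sigma>_def algebra_simps)
    ultimately have "k / 4 \<le> s * (lam * \<tau> t y)" using sP[OF tR(1) y] by linarith
    also have "\<dots> \<le> \<bar>s * (lam * \<tau> t y)\<bar>" by simp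
    also have "\<dots> = lam * \<bar>\<tau> t y\<bar>" using s(1) pos by (auto simp: abs_mult)
    finally show ?thesis using pos by (simp add: field_simps)
  qed
  moreover have "k / 4 / lam > 0" "S' \<ge> 0" using k pos R by (auto simp: S'_def)
  ultimately show ?thesis using that by blast
qed

text \<open>
Dropping the stress term and bounding one factor of the cubic term leaves
\<open>f' \<ge> - (1 + \<nu> F0) f\<^sup>2\<close>, that is, \<open>(1/f)' \<le> 1 + \<nu> F0\<close>.
\<close>

lemma f_lower_bound:
  assumes F0: "F0 > 0" "\<And>t y. t \<ge> 0 \<Longrightarrow> y \<in> {0..1} \<Longrightarrow> f t y \<le> F0" and d: "d > 0"
    and t: "t \<ge> 0" and y: "y \<in> {0..1}" and fd: "f 0 y \<ge> d"
  shows "1 / (1 / d + (1 + \<nu> * F0) * t) \<le> f t y"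
proof -
  let ?f' = "\<lambda>t. (- 1 + \<xi> * \<bar>\<tau> t y\<bar>) * (f t y)\<^sup>2 - \<nu> * f t y ^ 3"
  have fpos: "f t y > 0" if "t \<ge> 0" for t using f_pos[OF that y] fd d by simp
  have "1 / f t y - (1 + \<nu> * F0) * t \<le> 1 / f 0 y - (1 + \<nu> * F0) * 0"
  proof (rule nonpos_deriv_imp_antimono[where f' = "\<lambda>t. - (?f' t / (f t y)\<^sup>2) - (1 + \<nu> * F0)", OF _ _ order_refl t])
    fix t :: real assume t: "t \<ge> 0"
    show "((\<lambda>t. 1 / f t y - (1 + \<nu> * F0) * t) has_real_derivative - (?f' t / (f t y)\<^sup>2) - (1 + \<nu> * F0)) (at t within {0..})"
      using fpos[OF t] by (intro DERIV_diff DERIV_reciprocal f_deriv t y DERIV_cmult_Id) simp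
  next
    fix r :: real assume "0 < r" "r < t"
    then have r: "r \<ge> 0" by simp
    have "?f' r / (f r y)\<^sup>2 = - 1 + \<xi> * \<bar>\<tau> r y\<bar> - \<nu> * f r y"
      using fpos[OF r] by (simp add: diff_divide_distrib power2_eq_square power3_eq_cube)
    moreover have "\<xi> * \<bar>\<tau> r y\<bar> \<ge> 0" using pos by simp
    moreover have "\<nu> * f r y \<le> \<nu> * F0" using F0(2)[OF r y] pos by simp
    ultimately show "- (?f' r / (f r y)\<^sup>2) - (1 + \<nu> * F0) \<le> 0" by linarith
  qed
  moreover have "1 / f 0 y \<le> 1 / d" using d fd by (simp add: frac_le)
  ultimately have le: "1 / f t y \<le> 1 / d + (1 + \<nu> * F0) * t" by simp
  have "1 / (1 / d + (1 + \<nu> * F0) * t) \<le> 1 / (1 / f t y)"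
    using le fpos[OF t] by (intro divide_left_mono mult_pos_pos) (auto intro: less_le_trans[OF _ le])
  then show ?thesis by simp
qed

lemma f0_positive_interval:
  obtains d y0 y1 where "d > 0" "0 \<le> y0" "y0 < y1" "y1 \<le> 1" "\<And>y. y \<in> {y0..y1} \<Longrightarrow> d \<le> f 0 y"
proof -
  obtain z where z: "z \<in> {0..1}" "f 0 z \<noteq> 0" using f0_nonzero by blast
  then have fz: "f 0 z > 0" using f0_nonneg[of z] by simp
  have "continuous_on {0..1} (f 0)" by (rule f_slice) simp
  then obtain e where e: "e > 0" "\<And>y. y \<in> {0..1} \<Longrightarrow> dist y z < e \<Longrightarrow> dist (f 0 y) (f 0 z) < f 0 z / 2"
    using z(1) half_gt_zero[OF fz] unfolding continuous_on_iff by blast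
  define y0 where "y0 = max 0 (z - e / 2)"
  define y1 where "y1 = min 1 (z + e / 2)"
  have "f 0 z / 2 \<le> f 0 y" if "y \<in> {y0..y1}" for y
  proof -
    have "y \<in> {0..1}" "dist y z < e" using that e(1) by (auto simp: y0_def y1_def dist_real_def)
    from e(2)[OF this] show ?thesis by (simp add: dist_real_def abs_if split: if_splits)
  qed
  moreover have "y0 < y1" "0 \<le> y0" "y1 \<le> 1" using z(1) e(1) by (auto simp: y0_def y1_def)
  ultimately show ?thesis using that[of "f 0 z / 2" y0 y1] fz by simp
qed

lemma f_integral_lower_bound:
  obtains c1 c2 C where "c1 > 0" "c2 > 0" "C > 0"
    "\<And>t. t \<ge> 0 \<Longrightarrow> c1 / (c2 + C * t) \<le> L2_inner (f t) (\<lambda>_. 1)"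
proof -
  obtain d y0 y1 where d: "d > 0" and y01: "0 \<le> y0" "y0 < y1" "y1 \<le> 1"
    and fd: "\<And>y. y \<in> {y0..y1} \<Longrightarrow> d \<le> f 0 y"
    using f0_positive_interval by blast
  obtain F0 where F0: "F0 > 0" "\<And>t y. t \<ge> 0 \<Longrightarrow> y \<in> {0..1} \<Longrightarrow> f t y \<le> F0" using f_bounded by blast
  have "(y1 - y0) / (1 / d + (1 + \<nu> * F0) * t) \<le> L2_inner (f t) (\<lambda>_. 1)" if t: "t \<ge> 0" for t
  proof -
    let ?c = "1 / (1 / d + (1 + \<nu> * F0) * t)"
    have int: "f t integrable_on {0..1}" by (rule L2_integrable_on[OF f_L2[OF t]])
    then have int': "f t integrable_on {y0..y1}" using y01 by (auto elim!: integrable_on_subinterval)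
    have "(y1 - y0) * ?c = integral {y0..y1} (\<lambda>y. ?c)" using y01 by simp
    also have "\<dots> \<le> integral {y0..y1} (f t)"
      by (intro integral_le int' integrable_const_ivl f_lower_bound[OF F0 d t]) (use y01 fd in auto)
    also have "\<dots> \<le> integral {0..1} (f t)"
      by (intro integral_subset_le int int') (use y01 f_nonneg[OF t] in auto)
    also have "\<dots> = L2_inner (f t) (\<lambda>_. 1)"
      using lebesgue_integral_eq_integral[OF L2_integrable[OF f_L2[OF t]]] by (simp add: L2_inner_def)
    finally show ?thesis by simp
  qed
  moreover have "y1 - y0 > 0" "1 / d > 0" using y01 d by auto
  moreover have "1 + \<nu> * F0 > 0" using pos F0 by (intro add_pos_pos mult_pos_pos) auto
  ultimately show ?thesis using that by blast
qed

text \<open>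
A positive limit would force dissipation at a rate at least \<open>c0\<^sup>2 c1 / (c2 + C t)\<close>, whose integral
diverges logarithmically: the energy would become negative at an explicit time.
\<close>

lemma energy_tendsto_0: "(energy \<longlongrightarrow> 0) at_top"
proof -
  obtain l where l: "l \<ge> 0" "(energy \<longlongrightarrow> l) at_top"
    by (rule nonneg_antimono_converges[of energy, OF energy_antimono energy_nonneg])
  have False if "l > 0"
  proof -
    define c where "c = sqrt (l / lam)"
    have c: "c > 0" "c\<^sup>2 = l / lam" using that pos by (simp_all add: c_def)
    have "\<forall>\<^sub>F t in at_top. (m t)\<^sup>2 > l / lam"
      using that pos by (intro order_tendstoD(1)[OF m_square_tendsto[OF l(2)]]) (simp add: field_simps)
    then obtain S0 where S0: "\<And>t. t \<ge> S0 \<Longrightarrow> (m t)\<^sup>2 > l / lam"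
      unfolding eventually_at_top_linorder by blast
    have m2: "\<And>t. t \<ge> max 0 S0 \<Longrightarrow> c\<^sup>2 \<le> (m t)\<^sup>2" using S0 unfolding c(2) by (simp add: less_imp_le)
    obtain c0 S where S: "c0 > 0" "S \<ge> 0" and tau: "\<And>t y. t \<ge> S \<Longrightarrow> y \<in> {0..1} \<Longrightarrow> c0 \<le> \<bar>\<tau> t y\<bar>"
      using tau_bounded_below[OF c(1) max.cobounded1 m2] by blast
    obtain c1 c2 C where cs: "c1 > 0" "c2 > 0" "C > 0"
      and low: "\<And>t. t \<ge> 0 \<Longrightarrow> c1 / (c2 + C * t) \<le> L2_inner (f t) (\<lambda>_. 1)"
      using f_integral_lower_bound by blast
    have diss: "c0\<^sup>2 * (c1 / (c2 + C * t)) \<le> dissipation t" if t: "t \<ge> S" for t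
    proof -
      have t0: "t \<ge> 0" using t S by simp
      have "c0\<^sup>2 * (c1 / (c2 + C * t)) \<le> c0\<^sup>2 * L2_inner (f t) (\<lambda>_. 1)"
        by (intro mult_left_mono low t0) simp
      also have "\<dots> = (LINT y|Omega. c0\<^sup>2 * f t y)" by (simp add: L2_inner_def)
      also have "\<dots> \<le> (LINT y|Omega. f t y * \<tau> t y * \<tau> t y)"
      proof (rule integral_mono_AE)
        show "AE y in Omega. c0\<^sup>2 * f t y \<le> f t y * \<tau> t y * \<tau> t y"
        proof (rule AE_I2)
          fix y assume "y \<in> space Omega"
          then have y: "y \<in> {0..1}" by simp
          have "c0\<^sup>2 \<le> \<bar>\<tau> t y\<bar>\<^sup>2" using tau[OF t y] S by (intro power_mono) auto
          then have "c0\<^sup>2 * f t y \<le> (\<tau> t y)\<^sup>2 * f t y" using f_nonneg[OF t0 y] by (intro mult_right_mono) auto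
          then show "c0\<^sup>2 * f t y \<le> f t y * \<tau> t y * \<tau> t y" by (simp add: power2_eq_square mult_ac)
        qed
      qed (use L2_integrable[OF f_L2[OF t0]] L2_mult_integrable[OF ftau_L2[OF t0] tau_L2[OF t0]] in auto)
      also have "\<dots> = L2_inner (\<lambda>y. f t y * \<tau> t y) (\<tau> t)" by (simp add: L2_inner_def)
      also have "\<dots> \<le> dissipation t" by (rule ftau_tau_le_dissipation)
      finally show ?thesis .
    qed
    define k where "k = c0\<^sup>2 * c1 / C"
    have k: "k > 0" using cs S by (simp add: k_def)
    have arg: "c2 + C * t > 0" if "t \<ge> 0" for t using cs that by (simp add: add_pos_nonneg)
    have decr: "energy t + k * ln (c2 + C * t) \<le> energy S + k * ln (c2 + C * S)" if t: "t \<ge> S" for t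
    proof (rule nonpos_deriv_imp_antimono[where f' = "\<lambda>t. - dissipation t + k * (C / (c2 + C * t))", OF _ _ S(2) t])
      fix t :: real assume t: "t \<ge> 0"
      have "((\<lambda>t. ln (c2 + C * t)) has_real_derivative C / (c2 + C * t)) (at t within {0..})"
        using arg[OF t] by (auto intro!: derivative_eq_intros)
      then show "((\<lambda>t. energy t + k * ln (c2 + C * t)) has_real_derivative - dissipation t + k * (C / (c2 + C * t))) (at t within {0..})"
        by (intro DERIV_add DERIV_cmult energy_deriv t)
    next
      fix r assume "S < r" "r < t"
      then have "c0\<^sup>2 * (c1 / (c2 + C * r)) \<le> dissipation r" by (intro diss) simp
      moreover have "k * (C / (c2 + C * r)) = c0\<^sup>2 * (c1 / (c2 + C * r))" using cs by (simp add: k_def)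
      ultimately show "- dissipation r + k * (C / (c2 + C * r)) \<le> 0" by linarith
    qed
    \<comment> \<open>The time at which the logarithm has used up one unit more than the energy left at \<open>S\<close>.\<close>
    define X where "X = ln (c2 + C * S) + (energy S + 1) / k"
    define t where "t = (exp X - c2) / C"
    have X: "X \<ge> ln (c2 + C * S)" using k energy_nonneg[of S] by (simp add: X_def)
    then have "exp (ln (c2 + C * S)) \<le> exp X" by simp
    then have "exp X \<ge> c2 + C * S" using arg[OF S(2)] by simp
    then have tS: "t \<ge> S" using cs by (simp add: t_def field_simps)
    have "c2 + C * t = exp X" using cs by (simp add: t_def)
    then have "energy t + k * X \<le> energy S + k * ln (c2 + C * S)" using decr[OF tS] by simp
    moreover have "k * X = k * ln (c2 + C * S) + (energy S + 1)" using k by (simp add: X_def field_simps)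
    ultimately show False using energy_nonneg[of t] by simp
  qed
  then have "l = 0" using l(1) by force
  then show ?thesis using l(2) by simp
qed

lemma m_tendsto_0: "(m \<longlongrightarrow> 0) at_top"
proof -
  have "((\<lambda>t. (m t)\<^sup>2) \<longlongrightarrow> 0) at_top" using m_square_tendsto[OF energy_tendsto_0] by simp
  from tendsto_real_sqrt[OF this] have "((\<lambda>t. \<bar>m t\<bar>) \<longlongrightarrow> 0) at_top" by simp
  then show ?thesis by (rule tendsto_rabs_zero_cancel)
qed

section \<open>Uniform decay of stress and fluidity\<close>

lemma tau_uniform_tendsto_0:
  assumes e: "e > 0"
  shows "\<forall>\<^sub>F t in at_top. \<forall>y\<in>{0..1}. \<bar>\<tau> t y\<bar> \<le> e"
proof -
  define k where "k = lam * e / 4"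
  have k: "k > 0" using e pos by (simp add: k_def)
  have "\<forall>\<^sub>F t in at_top. \<bar>m t\<bar> < k / (2 * lam)"
    using tendsto_rabs_zero[OF m_tendsto_0] k pos by (intro order_tendstoD(2)) auto
  moreover have "\<forall>\<^sub>F t in at_top. \<forall>y\<in>{0..1}. \<bar>P t y\<bar> \<le> k / (2 * a * \<rho>)"
    by (rule P_uniform_tendsto_0) (use k a_pos pos in simp)
  ultimately have "\<forall>\<^sub>F t in at_top. \<bar>m t\<bar> < k / (2 * lam) \<and> (\<forall>y\<in>{0..1}. \<bar>P t y\<bar> \<le> k / (2 * a * \<rho>))"
    by (rule eventually_conj)
  then obtain S0 where S0: "\<And>t. t \<ge> S0 \<Longrightarrow> \<bar>m t\<bar> < k / (2 * lam) \<and> (\<forall>y\<in>{0..1}. \<bar>P t y\<bar> \<le> k / (2 * a * \<rho>))"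
    unfolding eventually_at_top_linorder by blast
  define S where "S = max 0 S0"
  have S: "S \<ge> 0" by (simp add: S_def)
  have mS: "lam * \<bar>m t\<bar> \<le> k / 2" and PS: "\<And>y. y \<in> {0..1} \<Longrightarrow> a * \<rho> * \<bar>P t y\<bar> \<le> k / 2" if "t \<ge> S" for t
  proof -
    have t: "t \<ge> S0" using that by (simp add: S_def)
    have "lam * \<bar>m t\<bar> \<le> lam * (k / (2 * lam))" using S0[OF t] pos by (intro mult_left_mono) auto
    then show "lam * \<bar>m t\<bar> \<le> k / 2" using pos by simp
    fix y :: real assume "y \<in> {0..1}"
    then have "a * \<rho> * \<bar>P t y\<bar> \<le> a * \<rho> * (k / (2 * a * \<rho>))" using S0[OF t] pos a_pos by (intro mult_left_mono) auto
    then show "a * \<rho> * \<bar>P t y\<bar> \<le> k / 2" using pos a_pos by simp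
  qed
  obtain B where B: "B \<ge> 0" "\<And>t y. t \<ge> 0 \<Longrightarrow> y \<in> {0..1} \<Longrightarrow> \<bar>\<sigma> t y\<bar> \<le> B" using sigma_bounded by blast
  have decay: "((\<lambda>t. B * exp (- (a / lam) * (t - S))) \<longlongrightarrow> B * 0) at_top"
    by (intro tendsto_intros exp_decay) (use a_pos pos in simp)
  have "\<forall>\<^sub>F t in at_top. B * exp (- (a / lam) * (t - S)) < k"
    using k by (intro order_tendstoD(2)[OF decay]) auto
  then show ?thesis using eventually_ge_at_top[of S]
  proof eventually_elim
    case (elim t)
    show ?case
    proof
      fix y :: real assume y: "y \<in> {0..1}"
      have "\<bar>\<sigma> t y\<bar> \<le> k + \<bar>\<sigma> S y\<bar> * exp (- (a / lam) * (t - S))"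
      proof (rule sigma_abs_bound[OF S y _ elim(2)])
        fix t assume t: "t \<ge> S"
        show "lam * \<bar>m t\<bar> + a * \<rho> * \<bar>P t y\<bar> \<le> k" using mS[OF t] PS[OF t y] by linarith
      qed
      also have "\<bar>\<sigma> S y\<bar> * exp (- (a / lam) * (t - S)) \<le> B * exp (- (a / lam) * (t - S))"
        using B(2)[OF S y] by (intro mult_right_mono) auto
      finally have sigma_le: "\<bar>\<sigma> t y\<bar> \<le> 2 * k" using elim(1) by linarith
      have "lam * \<tau> t y = \<sigma> t y + a * \<rho> * P t y" by (simp add: \<sigma>_def)
      then have "lam * \<bar>\<tau> t y\<bar> = \<bar>\<sigma> t y + a * \<rho> * P t y\<bar>" using pos by (metis abs_mult abs_of_pos)
      also have "\<dots> \<le> \<bar>\<sigma> t y\<bar> + a * \<rho> * \<bar>P t y\<bar>"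
        using abs_triangle_ineq[of "\<sigma> t y" "a * \<rho> * P t y"] pos a_pos by (simp add: abs_mult)
      also have "\<dots> \<le> 4 * k" using sigma_le PS[OF elim(2) y] k by linarith
      finally show "\<bar>\<tau> t y\<bar> \<le> e" using pos by (simp add: k_def)
    qed
  qed
qed

text \<open>
Once \<open>\<xi> \<bar>\<tau>\<bar> \<le> 1/2\<close>, the reciprocal of \<open>f\<close> grows at least at the rate \<open>1/2\<close>, whatever its initial
value, so that the bound \<open>2 / (t - S)\<close> does not depend on the point.
\<close>

lemma f_uniform_tendsto_0:
  assumes e: "e > 0"
  shows "\<forall>\<^sub>F t in at_top. \<forall>y\<in>{0..1}. \<bar>f t y\<bar> \<le> e"
proof -
  have "\<forall>\<^sub>F t in at_top. \<forall>y\<in>{0..1}. \<bar>\<tau> t y\<bar> \<le> 1 / (2 * \<xi>)"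
    by (rule tau_uniform_tendsto_0) (use pos in simp)
  then obtain S0 where S0: "\<And>t y. t \<ge> S0 \<Longrightarrow> y \<in> {0..1} \<Longrightarrow> \<bar>\<tau> t y\<bar> \<le> 1 / (2 * \<xi>)"
    unfolding eventually_at_top_linorder by blast
  define S where "S = max 0 S0"
  have S: "S \<ge> 0" by (simp add: S_def)
  have bound: "f t y * (t - S) \<le> 2" if t: "t \<ge> S" and y: "y \<in> {0..1}" for t y
  proof (cases "f 0 y = 0")
    case True
    then have "f t y = 0" using f_explicit[OF _ y, of t] t S by simp
    then show ?thesis by simp
  next
    case False
    then have f0: "f 0 y > 0" using f0_nonneg[OF y] by simp
    have fpos: "f t y > 0" if "t \<ge> 0" for t using f_pos[OF that y f0] .
    let ?f' = "\<lambda>t. (- 1 + \<xi> * \<bar>\<tau> t y\<bar>) * (f t y)\<^sup>2 - \<nu> * f t y ^ 3"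
    have "t / 2 - 1 / f t y \<le> S / 2 - 1 / f S y"
    proof (rule nonpos_deriv_imp_antimono[where f' = "\<lambda>t. 1 / 2 + ?f' t / (f t y)\<^sup>2", OF _ _ S t])
      fix t :: real assume t: "t \<ge> 0"
      show "((\<lambda>t. t / 2 - 1 / f t y) has_real_derivative 1 / 2 + ?f' t / (f t y)\<^sup>2) (at t within {0..})"
        using DERIV_diff[OF DERIV_cdivide[OF DERIV_ident] DERIV_reciprocal[OF f_deriv[OF t y]], of 2] fpos[OF t] by simp
    next
      fix r assume r: "S < r" "r < t"
      then have r0: "r \<ge> 0" "r \<ge> S0" using S by (auto simp: S_def)
      have "?f' r / (f r y)\<^sup>2 = - 1 + \<xi> * \<bar>\<tau> r y\<bar> - \<nu> * f r y"
        using fpos[OF r0(1)] by (simp add: diff_divide_distrib power2_eq_square power3_eq_cube)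
      moreover have "\<xi> * \<bar>\<tau> r y\<bar> \<le> \<xi> * (1 / (2 * \<xi>))" using S0[OF r0(2) y] pos by (intro mult_left_mono) auto
      moreover have "\<xi> * (1 / (2 * \<xi>)) = 1 / 2" using pos by simp
      moreover have "\<nu> * f r y \<ge> 0" using fpos[OF r0(1)] pos by simp
      ultimately show "1 / 2 + ?f' r / (f r y)\<^sup>2 \<le> 0" by linarith
    qed
    moreover have "1 / f S y > 0" using fpos[OF S] by simp
    ultimately have "(t - S) / 2 \<le> 1 / f t y" unfolding diff_divide_distrib by linarith
    moreover have "f t y > 0" using fpos t S by simp
    ultimately show ?thesis by (simp add: field_simps)
  qed
  show ?thesis unfolding eventually_at_top_linorder
  proof (intro exI[of _ "S + 2 / e"] allI impI ballI)
    fix t y :: real assume t: "S + 2 / e \<le> t" and y: "y \<in> {0..1}"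
    have "2 / e > 0" using e by simp
    then have tS: "t \<ge> S" "t - S \<ge> 2 / e" using t by linarith+
    have fn: "f t y \<ge> 0" using f_nonneg[OF _ y, of t] tS S by simp
    have "f t y * (2 / e) \<le> f t y * (t - S)" using fn tS by (intro mult_left_mono) auto
    also have "\<dots> \<le> 2" by (rule bound[OF tS(1) y])
    finally have "f t y \<le> e" using e by (simp add: field_simps)
    then show "\<bar>f t y\<bar> \<le> e" using fn by simp
  qed
qed

section \<open>Decay of the velocity gradient\<close>

text \<open>
The rate \<open>G u\<^sub>y - f \<tau>\<close> of the stress is dominated by the dissipation, and the dissipation over the time
step is the loss of energy. Testing with the increment itself keeps the argument scalar: the
comparison function combines the tested stress, a linear term and the energy.
\<close>

lemma tau_increment_le:
  obtains C where "C > 0" "\<And>t h. t \<ge> 0 \<Longrightarrow> h > 0 \<Longrightarrow>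
    L2_inner (\<lambda>y. \<tau> (h + t) y - \<tau> t y) (\<lambda>y. \<tau> (h + t) y - \<tau> t y) \<le> C * h * (energy t - energy (h + t))"
proof -
  obtain F0 where F0: "F0 > 0" "\<And>t y. t \<ge> 0 \<Longrightarrow> y \<in> {0..1} \<Longrightarrow> f t y \<le> F0" using f_bounded by blast
  define K where "K = 2 * G\<^sup>2 / (\<eta> * G) + 2 * F0"
  have K: "K > 0" unfolding K_def using pos F0 by (intro add_pos_pos divide_pos_pos mult_pos_pos) auto
  have rate: "L2_inner (\<lambda>y. G * ux t y - f t y * \<tau> t y) (\<lambda>y. G * ux t y - f t y * \<tau> t y) \<le> K * dissipation t"
    if t: "t \<ge> 0" for t
  proof -
    have Gu: "(\<lambda>y. G * ux t y) \<in> L2" by (intro L2_cmult ux_L2 t)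
    have "\<bar>2 * L2_inner (\<lambda>y. G * ux t y) (\<lambda>y. f t y * \<tau> t y)\<bar>
        \<le> 1 * L2_inner (\<lambda>y. G * ux t y) (\<lambda>y. G * ux t y) + L2_inner (\<lambda>y. f t y * \<tau> t y) (\<lambda>y. f t y * \<tau> t y) / 1"
      by (rule L2_Young_abs[OF Gu ftau_L2[OF t] zero_less_one])
    then have "L2_inner (\<lambda>y. G * ux t y - f t y * \<tau> t y) (\<lambda>y. G * ux t y - f t y * \<tau> t y)
        \<le> 2 * L2_inner (\<lambda>y. G * ux t y) (\<lambda>y. G * ux t y) + 2 * L2_inner (\<lambda>y. f t y * \<tau> t y) (\<lambda>y. f t y * \<tau> t y)"
      unfolding L2_inner_self_diff[OF Gu ftau_L2[OF t]] by linarith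
    also have "L2_inner (\<lambda>y. G * ux t y) (\<lambda>y. G * ux t y) = G\<^sup>2 * L2_inner (ux t) (ux t)"
      unfolding L2_inner_cmult_left L2_inner_cmult_right by (simp add: power2_eq_square)
    also have "2 * (G\<^sup>2 * L2_inner (ux t) (ux t)) \<le> 2 * (G\<^sup>2 * (dissipation t / (\<eta> * G)))"
      by (intro mult_left_mono ux_square_le_dissipation t) auto
    also have "L2_inner (\<lambda>y. f t y * \<tau> t y) (\<lambda>y. f t y * \<tau> t y) \<le> F0 * dissipation t"
      by (rule order_trans[OF ftau_norm_le[OF F0(2) t] mult_left_mono[OF ftau_tau_le_dissipation]]) (use F0 in auto)
    finally show ?thesis by (simp add: K_def distrib_right)
  qed
  have "L2_inner (\<lambda>y. \<tau> (h + t) y - \<tau> t y) (\<lambda>y. \<tau> (h + t) y - \<tau> t y) \<le> (K / lam\<^sup>2) * h * (energy t - energy (h + t))"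
    if t: "t \<ge> 0" and h: "h > 0" for t h
  proof -
    define \<psi> where "\<psi> = (\<lambda>y. \<tau> (h + t) y - \<tau> t y)"
    define p where "p = L2_inner \<psi> \<psi>"
    have \<psi>: "\<psi> \<in> L2" unfolding \<psi>_def using t h by (intro L2_diff tau_L2) auto
    \<comment> \<open>Young with weight \<open>h / \<lambda>\<close>: half of \<open>p\<close> is absorbed, and \<open>kk\<close> is what remains in front of the dissipation.\<close>
    define kk where "kk = K * h / (2 * lam\<^sup>2)"
    have "L2_inner (\<tau> (h + t)) \<psi> - p / (2 * h) * (h + t) + kk * energy (h + t) \<le> L2_inner (\<tau> t) \<psi> - p / (2 * h) * t + kk * energy t"
    proof (rule nonpos_deriv_imp_antimono[where f = "\<lambda>r. L2_inner (\<tau> r) \<psi> - p / (2 * h) * r + kk * energy r" and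
          f' = "\<lambda>r. L2_inner (\<lambda>y. G * ux r y - f r y * \<tau> r y) \<psi> / lam - p / (2 * h) + kk * - dissipation r"])
      fix r :: real assume "r \<ge> 0"
      then show "((\<lambda>r. L2_inner (\<tau> r) \<psi> - p / (2 * h) * r + kk * energy r) has_real_derivative
        L2_inner (\<lambda>y. G * ux r y - f r y * \<tau> r y) \<psi> / lam - p / (2 * h) + kk * - dissipation r) (at r within {0..})"
        by (intro DERIV_add DERIV_diff DERIV_cmult DERIV_cmult_Id constitutive energy_deriv \<psi>)
    next
      fix r assume "t < r" "r < h + t"
      then have r: "r \<ge> 0" using t by simp
      let ?R = "\<lambda>y. G * ux r y - f r y * \<tau> r y"
      have R: "?R \<in> L2" by (intro L2_diff L2_cmult ux_L2 ftau_L2 r)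
      have "2 * L2_inner ?R \<psi> \<le> (h / lam) * L2_inner ?R ?R + L2_inner \<psi> \<psi> / (h / lam)"
        using h pos by (intro L2_Young R \<psi>) simp
      also have "\<dots> \<le> (h / lam) * (K * dissipation r) + p * lam / h"
        using h pos by (intro add_mono mult_left_mono rate r) (auto simp: p_def)
      finally have "2 * L2_inner ?R \<psi> / (2 * lam) \<le> ((h / lam) * (K * dissipation r) + p * lam / h) / (2 * lam)"
        using pos by (intro divide_right_mono) auto
      also have "\<dots> = kk * dissipation r + p / (2 * h)"
        using pos h by (simp add: kk_def add_divide_distrib power2_eq_square mult_ac)
      finally show "L2_inner ?R \<psi> / lam - p / (2 * h) + kk * - dissipation r \<le> 0" by simp
    qed (use t h in auto)
    moreover have "L2_inner (\<tau> (h + t)) \<psi> - L2_inner (\<tau> t) \<psi> = p"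
    proof -
      have "p = L2_inner (\<lambda>y. \<tau> (h + t) y - \<tau> t y) \<psi>" by (simp only: p_def \<psi>_def)
      also have "\<dots> = L2_inner (\<tau> (h + t)) \<psi> - L2_inner (\<tau> t) \<psi>"
        using t h by (intro L2_inner_diff_left tau_L2 \<psi>) auto
      finally show ?thesis ..
    qed
    moreover have "p / (2 * h) * (h + t) = p / 2 + p / (2 * h) * t" using h by (simp add: distrib_left)
    ultimately have "p / 2 \<le> kk * energy t - kk * energy (h + t)" by linarith
    then have "p \<le> 2 * (kk * (energy t - energy (h + t)))" by (simp add: right_diff_distrib)
    then show ?thesis by (simp add: p_def \<psi>_def kk_def)
  qed
  moreover have "K / lam\<^sup>2 > 0" using K pos by simp
  ultimately show ?thesis using that by blast
qed

text \<open>
The momentum equation is linear in \<open>(u, \<tau>)\<close> and autonomous, so that its time increments satisfy the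
same energy identity as the solution.
\<close>

lemma u_increment_deriv:
  assumes t: "t \<ge> 0" and h: "h > 0"
  defines "v \<equiv> \<lambda>t y. u (h + t) y - u t y" and "vx \<equiv> \<lambda>t y. ux (h + t) y - ux t y" and "d\<tau> \<equiv> \<lambda>t y. \<tau> (h + t) y - \<tau> t y"
  shows "((\<lambda>t. L2_inner (v t) (v t)) has_real_derivative
    - 2 / \<rho> * (\<eta> * L2_inner (vx t) (vx t) + L2_inner (d\<tau> t) (vx t))) (at t within {0..})"
proof -
  have vL2: "v t \<in> L2" and vxL2: "vx t \<in> L2" and dL2: "d\<tau> t \<in> L2" if "t \<ge> 0" for t
    using that h unfolding v_def vx_def d\<tau>_def by (auto intro!: L2_diff u_L2 ux_L2 tau_L2)
  have vxc: "L2_continuous_on {0..} vx" and dc: "L2_continuous_on {0..} d\<tau>"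
    unfolding vx_def d\<tau>_def using h by (auto intro!: L2_continuous_on_diff L2_continuous_on_shift ux_cont tau_L2cont)
  let ?W = "\<lambda>t y. - (1 / \<rho>) * (\<eta> * vx t y + d\<tau> t y)"
  have WL2: "(\<lambda>y. \<eta> * vx t y + d\<tau> t y) \<in> L2" if "t \<ge> 0" for t by (intro L2_add L2_cmult vxL2 dL2 that)
  have "((\<lambda>t. L2_inner (v t) (v t)) has_real_derivative 2 * L2_inner (?W t) (vx t)) (at t within {0..})"
  proof (rule L2_energy_identity[OF vL2 vxc _ _ t])
    show "L2_continuous_on {0..} ?W" by (intro L2_continuous_on_cmult L2_continuous_on_add vxc dc)
    fix t s0 s1 :: real assume t: "t \<ge> 0" and s: "s0 \<ge> 0" "s1 \<ge> 0"
    define k where "k = (\<lambda>y. vx s0 y + vx s1 y)"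
    have k: "k \<in> L2" unfolding k_def by (intro L2_add vxL2 s)
    have k0: "L2_inner k (\<lambda>_. 1) = 0"
      using s h unfolding k_def vx_def by (simp add: L2_inner_add_left L2_inner_diff_left L2_diff ux_L2 ux_mean)
    have prim: "integral {0..y} k = v s0 y + v s1 y" if y: "y \<in> {0..1}" for y
    proof -
      have int: "ux r integrable_on {0..y}" if "r \<ge> 0" for r
        using L2_integrable_on[OF ux_L2[OF that]] y by (auto elim!: integrable_on_subinterval)
      have "(k has_integral (integral {0..y} (ux (h + s0)) - integral {0..y} (ux s0)) + (integral {0..y} (ux (h + s1)) - integral {0..y} (ux s1))) {0..y}"
        unfolding k_def vx_def using s h
        by (intro has_integral_add has_integral_diff integrable_integral int) auto
      then show ?thesis using s h y by (simp add: integral_unique v_def u_ux)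
    qed
    let ?K = "\<lambda>y. integral {0..y} k"
    let ?w = "\<lambda>t y. \<eta> * ux t y + \<tau> t y"
    have "((\<lambda>t. L2_inner (u (h + t)) ?K - L2_inner (u t) ?K) has_real_derivative
       (- L2_inner (?w (h + t)) k / \<rho>) - (- L2_inner (?w t) k / \<rho>)) (at t within {0..})"
      using t h by (intro DERIV_diff DERIV_shift_Ici momentum k k0) auto
    moreover have "(- L2_inner (?w (h + t)) k / \<rho>) - (- L2_inner (?w t) k / \<rho>) = L2_inner (?W t) k"
    proof -
      have "(\<lambda>y. \<eta> * vx t y + d\<tau> t y) = (\<lambda>y. ?w (h + t) y - ?w t y)"
        by (auto simp: vx_def d\<tau>_def algebra_simps)
      then have "L2_inner (\<lambda>y. \<eta> * vx t y + d\<tau> t y) k = L2_inner (?w (h + t)) k - L2_inner (?w t) k"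
        using t h k by (simp add: L2_inner_diff_left stress_L2)
      then show ?thesis unfolding L2_inner_cmult_left by (simp add: diff_divide_distrib)
    qed
    ultimately have "((\<lambda>t. L2_inner (u (h + t)) ?K - L2_inner (u t) ?K) has_real_derivative L2_inner (?W t) k) (at t within {0..})"
      by simp
    then show "((\<lambda>t. L2_inner (v t) (\<lambda>y. v s0 y + v s1 y)) has_real_derivative L2_inner (?W t) (\<lambda>y. vx s0 y + vx s1 y)) (at t within {0..})"
      unfolding k_def[symmetric]
    proof (rule has_field_derivative_transform_within[OF _ zero_less_one])
      fix r :: real assume "r \<in> {0..}"
      then have r: "r \<ge> 0" by simp
      have K: "?K \<in> L2" by (rule continuous_L2[OF continuous_on_L2_primitive[OF k]])
      have "L2_inner (v r) (\<lambda>y. v s0 y + v s1 y) = L2_inner (v r) ?K"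
        by (rule L2_inner_cong) (simp_all add: prim)
      also have "\<dots> = L2_inner (u (h + r)) ?K - L2_inner (u r) ?K"
        unfolding v_def using r h by (intro L2_inner_diff_left u_L2 K) auto
      finally show "L2_inner (u (h + r)) ?K - L2_inner (u r) ?K = L2_inner (v r) (\<lambda>y. v s0 y + v s1 y)" ..
    qed (use t in simp)
  qed
  moreover have "2 * L2_inner (?W t) (vx t) = - 2 / \<rho> * (\<eta> * L2_inner (vx t) (vx t) + L2_inner (d\<tau> t) (vx t))"
  proof -
    have "L2_inner (\<lambda>y. \<eta> * vx t y + d\<tau> t y) (vx t) = \<eta> * L2_inner (vx t) (vx t) + L2_inner (d\<tau> t) (vx t)"
      using t by (simp add: L2_inner_add_left L2_cmult vxL2 dL2 L2_inner_cmult_left)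
    then show ?thesis unfolding L2_inner_cmult_left by simp
  qed
  ultimately show ?thesis by simp
qed

text \<open>
The squared norm of the increment \<open>v\<close>, corrected by a multiple of the energy over the sliding window
\<open>[t, t + h]\<close>, does not increase. It remains to find one time \<open>s \<le> 1\<close> at which \<open>\<parallel>v(s)\<parallel>\<close> is of order \<open>h\<close>;
for \<open>h = 1/n\<close> one of the \<open>n\<close> steps that make up \<open>[0,1]\<close> has this property, by square-integrability of
the acceleration.
\<close>

lemma u_difference_quotient_bounded:
  obtains Y where "Y \<ge> 0" "\<And>t n. t \<ge> 1 \<Longrightarrow> n > 0 \<Longrightarrow>
    L2_norm (\<lambda>y. u (1 / real n + t) y - u t y) \<le> Y * (1 / real n)"
proof -
  obtain C where C: "C > 0" "\<And>t h. t \<ge> 0 \<Longrightarrow> h > 0 \<Longrightarrow>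
    L2_inner (\<lambda>y. \<tau> (h + t) y - \<tau> t y) (\<lambda>y. \<tau> (h + t) y - \<tau> t y) \<le> C * h * (energy t - energy (h + t))"
    using tau_increment_le by blast
  define c where "c = C / (2 * \<rho> * \<eta>)"
  have c: "c > 0" using C(1) pos by (simp add: c_def)
  have Ec: "continuous_on {0..} energy"
    by (rule DERIV_continuous_on[OF energy_deriv]) simp
  \<comment> \<open>A primitive of the energy; \<open>A (h + t) - A t\<close> is the energy over the sliding window.\<close>
  define A where "A = (\<lambda>t. integral {0..t} energy)"
  have A: "(A has_real_derivative energy t) (at t within {0..})" if "t \<ge> 0" for t
  proof -
    have "(A has_real_derivative energy t) (at t within {0..t+1})"
      unfolding A_def using integral_has_vector_derivative[OF continuous_on_subset[OF Ec], of 0 "t+1" t] that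
      by (simp add: has_real_derivative_iff_has_vector_derivative)
    then show ?thesis using at_within_atLeastAtMost_extend[of t "t+1"] that by simp
  qed
  define Y where "Y = sqrt (g 1 - g 0 + c * energy 0)"
  have "L2_norm (\<lambda>y. u (1 / real n + t) y - u t y) \<le> Y * (1 / real n)" if t: "t \<ge> 1" and n: "n > 0" for t n
  proof -
    define h where "h = 1 / real n"
    have h: "h > 0" using n by (simp add: h_def)
    define v where "v = (\<lambda>t y. u (h + t) y - u t y)"
    define vx where "vx = (\<lambda>t y. ux (h + t) y - ux t y)"
    define dt where "dt = (\<lambda>t y. \<tau> (h + t) y - \<tau> t y)"
    have incr: "0 \<le> A (h + t) - A t" "A (h + t) - A t \<le> h * energy 0" if t: "t \<ge> 0" for t
    proof -
      obtain r where r: "t < r" "A (h + t) - A t = (h + t - t) * energy r"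
        using mean_value_Ici[OF A t, of "h + t"] h by auto
      then show "0 \<le> A (h + t) - A t" using h energy_nonneg[of r] by simp
      show "A (h + t) - A t \<le> h * energy 0" using r h t energy_antimono[of 0 r] by simp
    qed
    have mono: "L2_inner (v t) (v t) + c * h * (A (h + t) - A t) \<le> L2_inner (v s) (v s) + c * h * (A (h + s) - A s)"
      if st: "0 \<le> s" "s \<le> t" for s t
    proof (rule nonpos_deriv_imp_antimono[where f = "\<lambda>t. L2_inner (v t) (v t) + c * h * (A (h + t) - A t)" and
        f' = "\<lambda>t. - 2 / \<rho> * (\<eta> * L2_inner (vx t) (vx t) + L2_inner (dt t) (vx t)) + c * h * (energy (h + t) - energy t)", OF _ _ st])
      fix t :: real assume "t \<ge> 0"
      then show "((\<lambda>t. L2_inner (v t) (v t) + c * h * (A (h + t) - A t)) has_real_derivative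
          - 2 / \<rho> * (\<eta> * L2_inner (vx t) (vx t) + L2_inner (dt t) (vx t)) + c * h * (energy (h + t) - energy t)) (at t within {0..})"
        unfolding v_def vx_def dt_def using h
        by (intro DERIV_add DERIV_cmult DERIV_diff DERIV_shift_Ici A u_increment_deriv) auto
    next
      fix r assume "s < r" "r < t"
      then have r: "r \<ge> 0" using st by simp
      have L: "vx r \<in> L2" "dt r \<in> L2" unfolding vx_def dt_def using r h by (auto intro!: L2_diff ux_L2 tau_L2)
      define X where "X = L2_inner (vx r) (vx r)"
      define T where "T = L2_inner (dt r) (dt r)"
      define W where "W = L2_inner (dt r) (vx r)"
      have "\<bar>2 * L2_inner (vx r) (dt r)\<bar> \<le> (2 * \<eta>) * X + T / (2 * \<eta>)"
        unfolding X_def T_def by (intro L2_Young_abs L) (use pos in simp)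
      then have "- 2 * \<eta> * X - 2 * W \<le> T / (2 * \<eta>)" unfolding W_def L2_inner_commute[of "vx r"] by linarith
      then have "(- 2 * \<eta> * X - 2 * W) / \<rho> \<le> T / (2 * \<eta>) / \<rho>" using pos by (intro divide_right_mono) auto
      moreover have "(- 2 * \<eta> * X - 2 * W) / \<rho> = - 2 / \<rho> * (\<eta> * X + W)"
        by (simp add: diff_divide_distrib add_divide_distrib algebra_simps)
      moreover have "T / (2 * \<eta>) / \<rho> \<le> C * h * (energy r - energy (h + r)) / (2 * \<eta>) / \<rho>"
        unfolding T_def dt_def using pos by (intro divide_right_mono C(2)[OF r h]) auto
      moreover have "C * h * (energy r - energy (h + r)) / (2 * \<eta>) / \<rho> = - (c * h * (energy (h + r) - energy r))"
        using pos by (simp add: c_def field_simps)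
      ultimately show "- 2 / \<rho> * (\<eta> * L2_inner (vx r) (vx r) + L2_inner (dt r) (vx r)) + c * h * (energy (h + r) - energy r) \<le> 0"
        unfolding X_def T_def W_def by linarith
    qed
    obtain j where j: "j < n" "g (real (Suc j) / real n) - g (real j / real n) \<le> (g 1 - g 0) / real n"
      using pigeonhole_increment[OF n] by blast
    define s where "s = real j / real n"
    have s: "0 \<le> s" "s \<le> 1" using j(1) by (auto simp: s_def)
    have hs: "real (Suc j) / real n = h + s" by (simp add: h_def s_def add_divide_distrib)
    have "L2_inner (v s) (v s) \<le> (h + s - s) * (g (h + s) - g s)"
      unfolding v_def using u_increment[of s "h + s"] s h by simp
    also have "\<dots> \<le> h * (h * (g 1 - g 0))"
    proof -
      have "g (h + s) - g s \<le> h * (g 1 - g 0)" using j(2) unfolding hs s_def[symmetric] by (simp add: h_def)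
      then show ?thesis using h by simp
    qed
    finally have vs: "L2_inner (v s) (v s) \<le> h\<^sup>2 * (g 1 - g 0)" by (simp add: power2_eq_square)
    have "L2_inner (v t) (v t) \<le> L2_inner (v t) (v t) + c * h * (A (h + t) - A t)"
      using incr(1)[of t] t c h by simp
    also have "\<dots> \<le> L2_inner (v s) (v s) + c * h * (A (h + s) - A s)"
      using mono[of s t] s t by simp
    also have "\<dots> \<le> h\<^sup>2 * (g 1 - g 0) + c * h * (h * energy 0)"
      using incr(2)[of s] s c h by (intro add_mono mult_left_mono vs) auto
    also have "\<dots> = h\<^sup>2 * (g 1 - g 0 + c * energy 0)" by (simp add: power2_eq_square algebra_simps)
    finally have "sqrt (L2_inner (v t) (v t)) \<le> sqrt (h\<^sup>2 * (g 1 - g 0 + c * energy 0))" by (rule real_sqrt_le_mono)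
    then show ?thesis using h by (simp add: L2_norm_eq Y_def real_sqrt_mult v_def h_def mult.commute)
  qed
  moreover have "Y \<ge> 0" unfolding Y_def using g_mono[of 0 1] c energy_nonneg[of 0] by simp
  ultimately show ?thesis using that by blast
qed

text \<open>
Up to its sign, the left-hand side is \<open>\<rho>\<close> times the time derivative of \<open>\<langle>u, u(t)\<rangle>\<close> at \<open>t\<close>. As a limit of difference
quotients it is bounded by \<open>\<parallel>u(t)\<parallel>\<close> times the bound of the quotients of \<open>u\<close>.
\<close>

lemma stress_ux_bounded:
  obtains Y where "Y \<ge> 0" "\<And>t. t \<ge> 1 \<Longrightarrow>
    \<bar>\<eta> * L2_inner (ux t) (ux t) + L2_inner (\<tau> t) (ux t)\<bar> \<le> \<rho> * Y * L2_norm (u t)"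
proof -
  obtain Y where Y: "Y \<ge> 0" "\<And>t n. t \<ge> 1 \<Longrightarrow> n > 0 \<Longrightarrow>
    L2_norm (\<lambda>y. u (1 / real n + t) y - u t y) \<le> Y * (1 / real n)"
    using u_difference_quotient_bounded by blast
  have "\<bar>\<eta> * L2_inner (ux t) (ux t) + L2_inner (\<tau> t) (ux t)\<bar> \<le> \<rho> * Y * L2_norm (u t)" if t: "t \<ge> 1" for t
  proof -
    have t0: "t \<ge> 0" using t by simp
    let ?\<phi> = "\<lambda>s. L2_inner (u s) (u t)"
    let ?d = "- L2_inner (\<lambda>y. \<eta> * ux t y + \<tau> t y) (ux t) / \<rho>"
    have "L2_inner (u s) (\<lambda>y. integral {0..y} (ux t)) = ?\<phi> s" for s
      by (rule L2_inner_cong) (use t0 in \<open>simp_all add: u_ux\<close>)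
    then have "(?\<phi> has_real_derivative ?d) (at t within {0..})"
      using momentum[OF ux_L2[OF t0] ux_mean[OF t0] t0] by simp
    then have lim: "((\<lambda>s. (?\<phi> s - ?\<phi> t) / (s - t)) \<longlongrightarrow> ?d) (at t within {0..})"
      by (simp add: has_field_derivative_iff)
    have "(\<lambda>n. 1 / real (Suc n) + t) \<longlonglongrightarrow> 0 + t"
      by (intro tendsto_intros LIMSEQ_Suc[OF lim_1_over_n])
    then have "filterlim (\<lambda>n. 1 / real (Suc n) + t) (at t within {0..}) sequentially"
      using t0 by (auto simp: filterlim_at simp del: of_nat_Suc)
    from filterlim_compose[OF lim this]
    have seq: "(\<lambda>n. (?\<phi> (1 / real (Suc n) + t) - ?\<phi> t) / (1 / real (Suc n) + t - t)) \<longlonglongrightarrow> ?d" .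
    have bound: "\<bar>(?\<phi> (1 / real (Suc n) + t) - ?\<phi> t) / (1 / real (Suc n) + t - t)\<bar> \<le> Y * L2_norm (u t)" for n
    proof -
      define h where "h = 1 / real (Suc n)"
      have h: "h > 0" by (simp add: h_def)
      have ht: "h + t \<ge> 0" using h t0 by simp
      have "?\<phi> (h + t) - ?\<phi> t = L2_inner (\<lambda>y. u (h + t) y - u t y) (u t)"
        by (rule L2_inner_diff_left[symmetric, OF u_L2[OF ht] u_L2[OF t0] u_L2[OF t0]])
      also have "\<bar>\<dots>\<bar> \<le> L2_norm (\<lambda>y. u (h + t) y - u t y) * L2_norm (u t)"
        by (rule L2_Cauchy_Schwarz[OF L2_diff[OF u_L2[OF ht] u_L2[OF t0]] u_L2[OF t0]])
      also have "\<dots> \<le> Y * h * L2_norm (u t)"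
        using Y(2)[OF t, of "Suc n"] by (intro mult_right_mono) (auto simp: h_def)
      finally have "\<bar>?\<phi> (h + t) - ?\<phi> t\<bar> / h \<le> Y * L2_norm (u t)" using h by (simp add: field_simps)
      then show ?thesis using h unfolding h_def[symmetric] by (simp add: abs_divide)
    qed
    have "\<bar>?d\<bar> \<le> Y * L2_norm (u t)"
      by (rule tendsto_upperbound[OF tendsto_rabs[OF seq]]) (use bound in auto)
    moreover have "L2_inner (\<lambda>y. \<eta> * ux t y + \<tau> t y) (ux t) = \<eta> * L2_inner (ux t) (ux t) + L2_inner (\<tau> t) (ux t)"
      using t0 by (simp add: L2_inner_add_left L2_cmult ux_L2 tau_L2 L2_inner_cmult_left)
    ultimately show ?thesis using pos by (simp add: field_simps)
  qed
  then show ?thesis using that Y(1) by blast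
qed

lemma tau_square_tendsto_0: "((\<lambda>t. L2_inner (\<tau> t) (\<tau> t)) \<longlongrightarrow> 0) at_top"
proof -
  have "((\<lambda>t. (m t)\<^sup>2 + L2_inner (D t) (D t)) \<longlongrightarrow> 0\<^sup>2 + 0) at_top"
    by (intro tendsto_intros m_tendsto_0 D_tendsto_0)
  moreover have "\<forall>\<^sub>F t in at_top. (m t)\<^sup>2 + L2_inner (D t) (D t) = L2_inner (\<tau> t) (\<tau> t)"
    using eventually_ge_at_top[of 0] by eventually_elim (simp add: tau_square_eq)
  ultimately have "((\<lambda>t. L2_inner (\<tau> t) (\<tau> t)) \<longlongrightarrow> 0\<^sup>2 + 0) at_top" by (rule Lim_transform_eventually)
  then show ?thesis by simp
qed

lemma ux_tendsto_0: "((\<lambda>t. L2_inner (ux t) (ux t)) \<longlongrightarrow> 0) at_top"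
proof -
  obtain Y where Y: "Y \<ge> 0" "\<And>t. t \<ge> 1 \<Longrightarrow>
    \<bar>\<eta> * L2_inner (ux t) (ux t) + L2_inner (\<tau> t) (ux t)\<bar> \<le> \<rho> * Y * L2_norm (u t)"
    using stress_ux_bounded by blast
  let ?b = "\<lambda>t. 2 / \<eta> * (\<rho> * Y * sqrt (L2_inner (u t) (u t)) + L2_inner (\<tau> t) (\<tau> t) / (2 * \<eta>))"
  show ?thesis
  proof (rule tendsto_sandwich[OF _ _ tendsto_const])
    show "\<forall>\<^sub>F t in at_top. L2_inner (ux t) (ux t) \<le> ?b t"
      using eventually_ge_at_top[of 1]
    proof eventually_elim
      case (elim t)
      then have t0: "t \<ge> 0" by simp
      have "\<bar>2 * L2_inner (ux t) (\<tau> t)\<bar> \<le> \<eta> * L2_inner (ux t) (ux t) + L2_inner (\<tau> t) (\<tau> t) / \<eta>"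
        by (rule L2_Young_abs[OF ux_L2[OF t0] tau_L2[OF t0] pos(2)])
      define T where "T = L2_inner (\<tau> t) (\<tau> t) / \<eta>"
      have "- L2_inner (\<tau> t) (ux t) \<le> \<eta> * L2_inner (ux t) (ux t) / 2 + T / 2"
        using \<open>\<bar>2 * L2_inner (ux t) (\<tau> t)\<bar> \<le> _\<close>
        unfolding L2_inner_commute[of "ux t" "\<tau> t"] T_def[symmetric] by linarith
      then have "\<eta> * L2_inner (ux t) (ux t) / 2 \<le> \<rho> * Y * L2_norm (u t) + L2_inner (\<tau> t) (\<tau> t) / \<eta> / 2"
        using Y(2)[OF elim] unfolding T_def[symmetric] by linarith
      then have "\<eta> * L2_inner (ux t) (ux t) / 2 \<le> \<rho> * Y * sqrt (L2_inner (u t) (u t)) + L2_inner (\<tau> t) (\<tau> t) / (2 * \<eta>)"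
        by (simp add: L2_norm_eq mult.commute)
      from mult_left_mono[OF this, of "2 / \<eta>"] show ?case using pos by simp
    qed
    have "(?b \<longlongrightarrow> 2 / \<eta> * (\<rho> * Y * sqrt 0 + 0 / (2 * \<eta>))) at_top"
      using pos by (intro tendsto_intros u_tendsto_0 tau_square_tendsto_0) simp
    then show "(?b \<longlongrightarrow> 0) at_top" by simp
  qed simp
qed

theorem convergence_to_rest:
  "((\<lambda>t. ereal (sqrt ((L2_norm (u t))\<^sup>2 + (L2_norm (ux t))\<^sup>2)) + Linf_norm (\<tau> t) + Linf_norm (f t)) \<longlongrightarrow> 0) at_top"
proof -
  have "((\<lambda>t. sqrt (L2_inner (u t) (u t) + L2_inner (ux t) (ux t))) \<longlongrightarrow> sqrt (0 + 0)) at_top"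
    by (intro tendsto_intros u_tendsto_0 ux_tendsto_0)
  then have 1: "((\<lambda>t. ereal (sqrt ((L2_norm (u t))\<^sup>2 + (L2_norm (ux t))\<^sup>2))) \<longlongrightarrow> 0) at_top"
    by (simp add: L2_norm_square zero_ereal_def)
  have 2: "((\<lambda>t. Linf_norm (\<tau> t)) \<longlongrightarrow> 0) at_top" "((\<lambda>t. Linf_norm (f t)) \<longlongrightarrow> 0) at_top"
    by (intro Linf_norm_tendsto_0 tau_slice f_slice tau_uniform_tendsto_0 f_uniform_tendsto_0; assumption)+
  have "((\<lambda>t. ereal (sqrt ((L2_norm (u t))\<^sup>2 + (L2_norm (ux t))\<^sup>2)) + Linf_norm (\<tau> t)) \<longlongrightarrow> 0 + 0) at_top"
    by (rule tendsto_add_ereal[OF _ _ 1 2(1)]) simp_all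
  then have "((\<lambda>t. ereal (sqrt ((L2_norm (u t))\<^sup>2 + (L2_norm (ux t))\<^sup>2)) + Linf_norm (\<tau> t) + Linf_norm (f t)) \<longlongrightarrow> (0 + 0) + 0) at_top"
    by (rule tendsto_add_ereal[OF _ _ _ 2(2), rotated 2]) simp_all
  then show ?thesis by simp
qed

end

section \<open>Solutions in the energy class\<close>

lemma L2_time_mem: "F \<in> L2_time T X N \<Longrightarrow> AE t in lebesgue_on {0..T}. F t \<in> X"
  by (simp add: L2_time_def)

text \<open>
By the momentum equation, the total stress has the weak derivative \<open>\<rho> u\<^sub>t\<close>. Testing it with a primitive
leaves no second derivative of the velocity in the identity.
\<close>

lemma momentum_weak_form:
  assumes u: "u \<in> H2" and \<tau>: "\<tau> \<in> H1" and ut: "ut \<in> L2"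
    and eq: "AE y in Omega. \<rho> * ut y = \<eta> * wderiv (wderiv u) y + wderiv \<tau> y"
    and k: "k \<in> L2" "L2_inner k (\<lambda>_. 1) = 0"
  shows "\<rho> * L2_inner ut (\<lambda>y. integral {0..y} k) = - L2_inner (\<lambda>y. \<eta> * wderiv u y + \<tau> y) k"
proof -
  note uH = H2_wderiv[OF u] and u1 = H1_wderiv[OF H2_wderiv(1)[OF u]] and t1 = H1_wderiv[OF \<tau>]
  have "has_weak_deriv (\<lambda>y. \<eta> * wderiv u y + \<tau> y) (\<lambda>y. \<rho> * ut y)"
  proof (rule has_weak_deriv_cong_AE)
    show "has_weak_deriv (\<lambda>y. \<eta> * wderiv u y + \<tau> y) (\<lambda>y. \<eta> * wderiv (wderiv u) y + wderiv \<tau> y)"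
      by (rule has_weak_deriv_lincomb[OF uH(3) t1(2) u1(1) t1(3) uH(2) t1(1)])
    show "AE y in Omega. \<eta> * wderiv (wderiv u) y + wderiv \<tau> y = \<rho> * ut y"
      using eq by (rule AE_symmetric)
  qed (intro L2_add L2_cmult uH t1 ut)+
  from weak_deriv_test_primitive[OF _ L2_cmult[OF ut] this k]
  have "L2_inner (\<lambda>y. \<eta> * wderiv u y + \<tau> y) k = - L2_inner (\<lambda>y. \<rho> * ut y) (\<lambda>y. integral {0..y} k)"
    using u1(1) t1(3) by (simp add: L2_add L2_cmult)
  then show ?thesis unfolding L2_inner_cmult_left by simp
qed

text \<open>
The differential equations hold at almost every time. Once they are tested, their right-hand sides are
continuous in time, because the solution is continuous into \<open>H\<^sup>1\<close>; hence the tested equations hold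
at every time.
\<close>

lemma global_solution_imp_flow:
  fixes u \<tau> f :: "real \<Rightarrow> real \<Rightarrow> real"
  assumes pos: "\<rho> > 0" "\<eta> > 0" "lam > 0" "G > 0" "\<xi> > 0" "\<nu> > 0"
    and f0: "\<forall>y\<in>{0..1}. f\<^sub>0 y \<ge> 0" "\<exists>y\<in>{0..1}. f\<^sub>0 y \<noteq> 0"
    and sol: "global_solution \<rho> \<eta> lam G \<xi> \<nu> u\<^sub>0 \<tau>\<^sub>0 f\<^sub>0 u \<tau> f"
  shows "\<exists>g. viscoelastic_flow \<rho> \<eta> lam G \<xi> \<nu> u \<tau> f (\<lambda>t. wderiv (u t)) g"
proof -
  obtain ut \<tau>t ft where
    u: "\<And>T. T > 0 \<Longrightarrow> u \<in> C_time T H1 H1_norm" "\<And>T. T > 0 \<Longrightarrow> u \<in> L2_time T H2 H2_norm" and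
    \<tau>: "\<And>T. T > 0 \<Longrightarrow> \<tau> \<in> C_time T H1 H1_norm" and
    f: "\<And>T. T > 0 \<Longrightarrow> f \<in> C_time T H1 H1_norm" and
    ut: "\<And>T. T > 0 \<Longrightarrow> has_weak_time_deriv T u ut" "\<And>T. T > 0 \<Longrightarrow> ut \<in> L2_time T L2 L2_norm" and
    \<tau>t: "\<And>T. T > 0 \<Longrightarrow> has_weak_time_deriv T \<tau> \<tau>t" "\<And>T. T > 0 \<Longrightarrow> \<tau>t \<in> C_time T L2 L2_norm" and
    ft: "\<And>T. T > 0 \<Longrightarrow> has_weak_time_deriv T f ft" "\<And>T. T > 0 \<Longrightarrow> ft \<in> C_time T L2 L2_norm" and
    eqs: "\<And>T. T > 0 \<Longrightarrow> AE t in lebesgue_on {0..T}. AE y in Omega.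
          \<rho> * ut t y = \<eta> * wderiv (wderiv (u t)) y + wderiv (\<tau> t) y \<and>
          lam * \<tau>t t y = G * wderiv (u t) y - f t y * \<tau> t y \<and>
          ft t y = (- 1 + \<xi> * \<bar>\<tau> t y\<bar>) * (f t y)\<^sup>2 - \<nu> * (f t y) ^ 3"
    using sol unfolding global_solution_def by blast
  have bc: "u t 0 = 0" "u t 1 = 0" if "t \<ge> 0" for t
    using sol that unfolding global_solution_def by auto
  have init: "f 0 y = f\<^sub>0 y" if "y \<in> {0..1}" for y
    using sol that unfolding global_solution_def by auto
  have H1: "u t \<in> H1" "\<tau> t \<in> H1" "f t \<in> H1" if "t \<ge> 0" for t
    using u(1)[of "t+1"] \<tau>[of "t+1"] f[of "t+1"] that by (auto simp: C_time_def)
  have u_c: "continuous_on ({0..} \<times> {0..1}) (\<lambda>(t,y). u t y)"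
    and \<tau>_c: "continuous_on ({0..} \<times> {0..1}) (\<lambda>(t,y). \<tau> t y)"
    and f_c: "continuous_on ({0..} \<times> {0..1}) (\<lambda>(t,y). f t y)"
    by (rule C_time_H1_joint_continuous, (rule u(1) \<tau> f; assumption))+
  have u_L: "L2_continuous_on {0..} u" and ux_L: "L2_continuous_on {0..} (\<lambda>t. wderiv (u t))"
    and \<tau>_L: "L2_continuous_on {0..} \<tau>" and f_L: "L2_continuous_on {0..} f"
    using C_time_H1_L2_continuous_on u(1) \<tau> f by (auto intro!: L2_continuous_on_Ici)
  have f\<tau>_c: "continuous_on ({0..} \<times> {0..1}) (\<lambda>(t,y). f t y * \<tau> t y)"
    using f_c \<tau>_c unfolding case_prod_unfold by (intro continuous_intros)
  have R_c: "continuous_on ({0..} \<times> {0..1}) (\<lambda>(t,y). (- 1 + \<xi> * \<bar>\<tau> t y\<bar>) * (f t y)\<^sup>2 - \<nu> * (f t y) ^ 3)"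
    using f_c \<tau>_c unfolding case_prod_unfold by (intro continuous_intros)
  have L2: "wderiv (u t) \<in> L2" "(\<lambda>y. f t y * \<tau> t y) \<in> L2"
    "(\<lambda>y. (- 1 + \<xi> * \<bar>\<tau> t y\<bar>) * (f t y)\<^sup>2 - \<nu> * (f t y) ^ 3) \<in> L2" if "t \<ge> 0" for t
    using H1_wderiv(1)[OF H1(1)[OF that]] continuous_L2[OF joint_continuous_slice[OF f\<tau>_c that]]
      continuous_L2[OF joint_continuous_slice[OF R_c that]] by auto
  have FTC: "u t y = integral {0..y} (wderiv (u t))" if "t \<ge> 0" "y \<in> {0..1}" for t y
    using weak_deriv_FTC[OF H1_wderiv(4,1,2)[OF H1(1)[OF that(1)]] that(2)] bc(1)[OF that(1)] by simp
  have mean: "L2_inner (wderiv (u t)) (\<lambda>_. 1) = 0" if "t \<ge> 0" for t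
    using FTC[OF that, of 1] bc(2)[OF that] lebesgue_integral_eq_integral[OF L2_integrable[OF L2(1)[OF that]]]
    by (simp add: L2_inner_def)
  define g where "g = (\<lambda>t. integral {0..t} (\<lambda>r. (L2_norm (ut r))\<^sup>2))"
  have N_int: "(\<lambda>r. (L2_norm (ut r))\<^sup>2) integrable_on {0..T}" if "T > 0" for T
    using ut(2)[OF that] by (intro integrable_on_lebesgue_on) (auto simp: L2_time_def)
  have g_diff: "g t - g s = integral {s..t} (\<lambda>r. (L2_norm (ut r))\<^sup>2)" if "0 \<le> s" "s \<le> t" for s t
  proof -
    have "(\<lambda>r. (L2_norm (ut r))\<^sup>2) integrable_on {0..t}"
      by (rule integrable_on_subinterval[OF N_int[of "t+1"]]) (use that in auto)
    from Henstock_Kurzweil_Integration.integral_combine[OF that this] show ?thesis by (simp add: g_def)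
  qed
  have "viscoelastic_flow \<rho> \<eta> lam G \<xi> \<nu> u \<tau> f (\<lambda>t. wderiv (u t)) g"
  proof (unfold_locales; (fact pos u_c \<tau>_c f_c ux_L FTC mean)?)
    fix k :: "real \<Rightarrow> real" and t :: real assume k: "k \<in> L2" "L2_inner k (\<lambda>_. 1) = 0" and t: "t \<ge> 0"
    have K: "(\<lambda>y. integral {0..y} k) \<in> L2" by (rule continuous_L2[OF continuous_on_L2_primitive[OF k(1)]])
    show "((\<lambda>t. L2_inner (u t) (\<lambda>y. integral {0..y} k)) has_real_derivative
        - L2_inner (\<lambda>y. \<eta> * wderiv (u t) y + \<tau> t y) k / \<rho>) (at t within {0..})"
    proof (rule weak_time_deriv_imp_deriv[OF u_L K ut(1) _ _ t])
      have "L2_continuous_on {0..} (\<lambda>t y. \<eta> * wderiv (u t) y + \<tau> t y)"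
        by (intro L2_continuous_on_add L2_continuous_on_cmult ux_L \<tau>_L)
      from continuous_on_L2_inner[OF this L2_continuous_on_const[OF k(1)]]
      show "continuous_on {0..} (\<lambda>t. - L2_inner (\<lambda>y. \<eta> * wderiv (u t) y + \<tau> t y) k / \<rho>)"
        using pos by (intro continuous_intros) auto
      fix T :: real assume T: "T > 0"
      show "AE t in lebesgue_on {0..T}. L2_inner (ut t) (\<lambda>y. integral {0..y} k)
          = - L2_inner (\<lambda>y. \<eta> * wderiv (u t) y + \<tau> t y) k / \<rho>"
        using eqs[OF T] L2_time_mem[OF u(2)[OF T]] L2_time_mem[OF ut(2)[OF T]] AE_space
      proof eventually_elim
        case (elim t)
        then have t: "t \<ge> 0" by simp
        have "AE y in Omega. \<rho> * ut t y = \<eta> * wderiv (wderiv (u t)) y + wderiv (\<tau> t) y"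
          using elim(1) by (rule AE_mp) (rule AE_I2, simp)
        from momentum_weak_form[OF elim(2) H1(2)[OF t] elim(3) this k]
        show ?case using pos by (simp add: field_simps)
      qed
    qed
  next
    fix \<psi> :: "real \<Rightarrow> real" and t :: real assume \<psi>: "\<psi> \<in> L2" and t: "t \<ge> 0"
    show "((\<lambda>t. L2_inner (\<tau> t) \<psi>) has_real_derivative
        L2_inner (\<lambda>y. G * wderiv (u t) y - f t y * \<tau> t y) \<psi> / lam) (at t within {0..})"
    proof (rule weak_time_deriv_imp_deriv[OF \<tau>_L \<psi> \<tau>t(1) _ _ t])
      have "L2_continuous_on {0..} (\<lambda>t y. G * wderiv (u t) y - f t y * \<tau> t y)"
        by (intro L2_continuous_on_diff L2_continuous_on_cmult ux_L joint_continuous_imp_L2_continuous_on[OF f\<tau>_c])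
      from continuous_on_L2_inner[OF this L2_continuous_on_const[OF \<psi>]]
      show "continuous_on {0..} (\<lambda>t. L2_inner (\<lambda>y. G * wderiv (u t) y - f t y * \<tau> t y) \<psi> / lam)"
        using pos by (intro continuous_intros) auto
      fix T :: real assume T: "T > 0"
      show "AE t in lebesgue_on {0..T}. L2_inner (\<tau>t t) \<psi>
          = L2_inner (\<lambda>y. G * wderiv (u t) y - f t y * \<tau> t y) \<psi> / lam"
        using eqs[OF T] AE_space
      proof eventually_elim
        case (elim t)
        then have t: "t \<ge> 0" "t \<in> {0..T}" by auto
        have \<tau>tL: "\<tau>t t \<in> L2" using \<tau>t(2)[OF T] t by (simp add: C_time_def)
        have AE: "AE y in Omega. lam * \<tau>t t y = G * wderiv (u t) y - f t y * \<tau> t y"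
          using elim(1) by (rule AE_mp) (rule AE_I2, simp)
        have "L2_inner (\<lambda>y. lam * \<tau>t t y) \<psi> = L2_inner (\<lambda>y. G * wderiv (u t) y - f t y * \<tau> t y) \<psi>"
          by (rule L2_inner_cong_AE[OF AE _ L2_cmult[OF \<tau>tL] L2_diff[OF L2_cmult[OF L2(1)[OF t(1)]] L2(2)[OF t(1)]] \<psi> \<psi>]) simp
        then show ?case using pos unfolding L2_inner_cmult_left by (simp add: field_simps)
      qed
    qed
    show "((\<lambda>t. L2_inner (f t) \<psi>) has_real_derivative
        L2_inner (\<lambda>y. (- 1 + \<xi> * \<bar>\<tau> t y\<bar>) * (f t y)\<^sup>2 - \<nu> * (f t y) ^ 3) \<psi>) (at t within {0..})"
    proof (rule weak_time_deriv_imp_deriv[OF f_L \<psi> ft(1) _ _ t])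
      show "continuous_on {0..} (\<lambda>t. L2_inner (\<lambda>y. (- 1 + \<xi> * \<bar>\<tau> t y\<bar>) * (f t y)\<^sup>2 - \<nu> * (f t y) ^ 3) \<psi>)"
        by (rule continuous_on_L2_inner[OF joint_continuous_imp_L2_continuous_on[OF R_c] L2_continuous_on_const[OF \<psi>]])
      fix T :: real assume T: "T > 0"
      show "AE t in lebesgue_on {0..T}. L2_inner (ft t) \<psi>
          = L2_inner (\<lambda>y. (- 1 + \<xi> * \<bar>\<tau> t y\<bar>) * (f t y)\<^sup>2 - \<nu> * (f t y) ^ 3) \<psi>"
        using eqs[OF T] AE_space
      proof eventually_elim
        case (elim t)
        then have t: "t \<ge> 0" "t \<in> {0..T}" by auto
        have ftL: "ft t \<in> L2" using ft(2)[OF T] t by (simp add: C_time_def)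
        have AE: "AE y in Omega. ft t y = (- 1 + \<xi> * \<bar>\<tau> t y\<bar>) * (f t y)\<^sup>2 - \<nu> * (f t y) ^ 3"
          using elim(1) by (rule AE_mp) (rule AE_I2, simp)
        show ?case by (rule L2_inner_cong_AE[OF AE _ ftL L2(3)[OF t(1)] \<psi> \<psi>]) simp
      qed
    qed
  next
    fix y :: real assume "y \<in> {0..1}"
    then show "f 0 y \<ge> 0" using f0(1) init by simp
  next
    show "\<exists>y\<in>{0..1}. f 0 y \<noteq> 0" using f0(2) init by auto
  next
    fix s t :: real assume st: "0 \<le> s" "s \<le> t"
    have int: "(\<lambda>r. (L2_norm (ut r))\<^sup>2) integrable_on {s..t}"
      by (rule integrable_on_subinterval[OF N_int[of "t+1"]]) (use st in auto)
    have "integral {s..t} (\<lambda>r. (L2_norm (ut r))\<^sup>2) \<ge> 0" by (rule integral_nonneg[OF int]) simp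
    then show "g s \<le> g t" using g_diff[OF st] by simp
    have T: "t + 1 > 0" "t \<le> t + 1" using st by auto
    have "L2_continuous_on {0..t + 1} u" by (rule L2_continuous_on_subset[OF u_L]) auto
    from Cauchy_Schwarz_time_increment[OF this T(1) ut(1)[OF T(1)] ut(2)[OF T(1)] st T(2)]
    show "L2_inner (\<lambda>y. u t y - u s y) (\<lambda>y. u t y - u s y) \<le> (t - s) * (g t - g s)"
      unfolding g_diff[OF st] .
  qed
  then show ?thesis by blast
qed

theorem theorem3p1:
  fixes \<rho> \<eta> lam G \<xi> \<nu> :: real
    and u\<^sub>0 \<tau>\<^sub>0 f\<^sub>0 :: "real \<Rightarrow> real"
    and u \<tau> f :: "real \<Rightarrow> real \<Rightarrow> real"
  assumes "\<rho> > 0" "\<eta> > 0" "lam > 0" "G > 0" "\<xi> > 0" "\<nu> > 0"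
    and "u\<^sub>0 \<in> H1" "\<tau>\<^sub>0 \<in> H1" "f\<^sub>0 \<in> H1"
    and "u\<^sub>0 0 = 0" "u\<^sub>0 1 = 0"
    and "\<forall>y\<in>{0..1}. f\<^sub>0 y \<ge> 0" "\<exists>y\<in>{0..1}. f\<^sub>0 y \<noteq> 0"
    and "global_solution \<rho> \<eta> lam G \<xi> \<nu> u\<^sub>0 \<tau>\<^sub>0 f\<^sub>0 u \<tau> f"
  shows "((\<lambda>t. ereal (H1_norm (u t)) + Linf_norm (\<tau> t) + Linf_norm (f t)) \<longlongrightarrow> 0) at_top"
proof -
  obtain g where "viscoelastic_flow \<rho> \<eta> lam G \<xi> \<nu> u \<tau> f (\<lambda>t. wderiv (u t)) g"
    using global_solution_imp_flow[OF assms(1-6,12-14)] by blast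
  from viscoelastic_flow.convergence_to_rest[OF this] show ?thesis
    by (simp only: H1_norm_def)
qed

end
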